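(* Let $r=\min\{m,n\}$, let $h^{\mathcal V}\in\overline{\mathrm{Conv}}(D)$ for a nonempty convex $D\subseteq\mathbb R^r$ and let $f_2^{\mathcal V}$ be continuously differentiable on $D$ with $M_2$-Lipschitz gradient ($M_2>0$), both absolutely symmetric; put $f_2=f_2^{\mathcal V}\circ\sigma$, $h=h^{\mathcal V}\circ\sigma$, and let $f_1$ be continuously differentiable on $\operatorname{dom}h$. Let $\lambda>0$, $\theta\in(0,1)$, $Z_0\in\mathbb R^{m\times n}$ (a point where $\nabla f_1(Z_0)$ is defined), and let $(Z,V,\varepsilon,\pi_S)$ be the output of the $\sigma$.ACG method (described in the context). Define on $\mathbb R^{m\times n}$ $$\psi_s=\lambda[\ell_{f_1}(\cdot;Z_0)+f_2]+\tfrac12\|\cdot-Z_0\|_F^2,\qquad\psi_n=\lambda h,\qquad\psi=\psi_s+\psi_n,\qquad L=\lambda M_2+1 .$$ Then: (a) if $\pi_S=\mathtt{true}$, then $(Z,V,\varepsilon)\in\operatorname{dom}h\times\mathbb R^{m\times n}\times\mathbb R_+$ satisfies $$\|V\|_F^2+2\varepsilon\le\theta^2\|Z-Z_0\|_F^2\quad\text{and}\quad\psi(Z)-\psi(\hat Z)+\langle V,\hat Z-Z\rangle+\tfrac12\|\hat Z-Z\|_F^2\le\varepsilon,$$ where $\hat Z=\operatorname{argmin}_U\{\ell_{\psi_s}(U;Z)-\langle V,U\rangle+\frac L2\|U-Z\|_F^2+\psi_n(U)\}$; (b) if $f_2$ is convex, then $\pi_S=\mathtt{true}$ and $(Z,V,\varepsilon)$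 satisfies $$V\in\partial_\varepsilon\left(\psi-\tfrac12\|\cdot-Z\|_F^2\right)(Z),\qquad\|V\|_F^2+2\varepsilon\le\theta^2\|Z-Z_0\|_F^2 .$$
   Context: $\sigma(U)\in\mathbb R^r$ is the vector of singular values of $U\in\mathbb R^{m\times n}$ in nonincreasing order. A function on $\mathbb R^r$ is absolutely symmetric if its value does not depend on the order or the signs of the entries of its argument. $\overline{\mathrm{Conv}}(D)$: proper lower semicontinuous convex functions real-valued exactly on $D$ ($+\infty$ outside). $\ell_F(u;z)=F(z)+\langle\nabla F(z),u-z\rangle$. $\partial_\varepsilon\Psi(z)=\{v:\Psi(u)\ge\Psi(z)+\langle v,u-z\rangle-\varepsilon\ \forall u\}$. $\operatorname{dg}z\in\mathbb R^{r\times r}$ is the diagonal matrix with diagonal $z\in\mathbb R^r$, and $[\operatorname{Dg}W]_i=W_{ii}$. SVDs are written $U=P[\operatorname{dg}\sigma(U)]Q^*$ with $P\in\mathbb R^{m\times r}$, $Q\in\mathbb R^{n\times r}$ having orthonormal columns. S.ACG$(\psi_s,\psi_n,y_0,\theta,\mu,L)$, with $\psi=\psi_s+\psi_n$ and $\Delta_\mu(u;z,v)=\psi(z)-\psi(u)+\langle v,u-z\rangle+\frac\mu2\|u-z\|^2$: set $A_0=0$, $\Gamma_0\equiv0$, $x_0=y_0$, and for $k\ge1$ compute $\tau_{k-1}=(1+\mu A_{k-1})/L$, $a_{k-1}=\frac12(\tau_{k-1}+\sqrt{\tau_{k-1}^2+4\tau_{k-1}A_{k-1}})$, $A_k=A_{k-1}+a_{k-1}$,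 $\tilde x_{k-1}=\frac{A_{k-1}}{A_k}y_{k-1}+\frac{a_{k-1}}{A_k}x_{k-1}$, $q_k=\ell_{\psi_s}(\cdot;\tilde x_{k-1})+\psi_n+\frac\mu2\|\cdot-\tilde x_{k-1}\|^2$, $y_k=\operatorname{argmin}_y\{\frac1Lq_k(y)+\frac12\|y-\tilde x_{k-1}\|^2\}$, $x_k=x_{k-1}+\frac{a_{k-1}}{1+\mu A_k}[L(y_k-\tilde x_{k-1})+\mu(y_k-x_{k-1})]$, $\gamma_{k-1}=q_k(y_k)+L\langle\tilde x_{k-1}-y_k,\cdot-y_k\rangle+\frac\mu2\|\cdot-y_k\|^2$, $\Gamma_k=\frac{A_{k-1}}{A_k}\Gamma_{k-1}+\frac{a_{k-1}}{A_k}\gamma_{k-1}$, $r_k=(x_0-x_k)/A_k$, $\eta_k=\psi(y_k)-\Gamma_k(x_k)-\langle r_k,y_k-x_k\rangle$, $\tilde r_k=r_k+\mu(y_k-x_k)$, $\tilde\eta_k=\eta_k-\frac\mu2\|y_k-x_k\|^2$. If $\frac1{1+\mu A_k}\|A_k\tilde r_k+y_k-y_0\|^2+2A_k\tilde\eta_k>\|y_k-y_0\|^2$, return $(y_0,\infty,\infty,\mathtt{false})$. If $\|\tilde r_k\|^2+2\tilde\eta_k\le\theta^2\|y_k-y_0\|^2$, let $\hat y_k=\operatorname{argmin}_u\{\ell_{\psi_s}(u;y_k)-\langle\tilde r_k,u\rangle+\frac L2\|u-y_k\|^2+\psi_n(u)\}$; if $\Delta_\mu(\hat y_k;y_k,\tilde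 r_k)>\tilde\eta_k$ return $(y_0,\infty,\infty,\mathtt{false})$, else return $(y_k,\tilde r_k,\tilde\eta_k,\mathtt{true})$. $\sigma$.ACG method: set $\mu=1$, $L=\lambda M_2+1$, $Z_0^\lambda=Z_0-\lambda\nabla f_1(Z_0)$, with SVD $Z_0^\lambda=P[\operatorname{dg}s]Q^*$, $s=\sigma(Z_0^\lambda)$. On $\mathbb R^r$ let $\psi_s^{\mathcal V}=\lambda f_2^{\mathcal V}-\langle s,\cdot\rangle+\frac12\|\cdot\|^2$, $\psi_n^{\mathcal V}=\lambda h^{\mathcal V}$, and let $(z,v,\varepsilon,\pi_S)$ be the output of S.ACG$(\psi_s^{\mathcal V},\psi_n^{\mathcal V},\operatorname{Dg}(P^*Z_0Q),\theta,\mu,L)$. If $\pi_S=\mathtt{true}$, output $(Z,V,\varepsilon,\pi_S)$ with $Z=P(\operatorname{dg}z)Q^*$, $V=P(\operatorname{dg}v)Q^*$; otherwise output $(Z_0,\infty,\infty,\pi_S)$.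
   Formalization: In (b), f₂^V is assumed C¹ with M₂-Lipschitz gradient, and f₂ convex, on an absolutely symmetric set G ⊇ D (e.g. ℝ^r) containing the points x̃_k used by the method; with the gradient condition on D only, (b) fails (D={0}, f₂^V=2x², M₂=1, Z₀=1). *)

theory Defs
  imports "HOL-Analysis.Analysis"
begin

section \<open>Extended real-valued convex functions, gradients\<close>

text \<open>Proper lower semicontinuous convex functions with effective domain exactly \<open>D\<close>.
  As such functions are \<open>\<infinity>\<close> off the convex set \<open>D\<close>, convexity only has to be
  required of their (real) values on \<open>D\<close>.\<close>

definition Conv_bar :: "'a::euclidean_space set \<Rightarrow> ('a \<Rightarrow> ereal) set" where
  "Conv_bar D = {h. D \<noteq> {} \<and> (\<forall>x\<in>D. \<bar>h x\<bar> \<noteq> \<infinity>) \<and> (\<forall>x. x \<notin> D \<longrightarrow> h x = \<infinity>) \<and>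
     convex_on D (\<lambda>x. real_of_ereal (h x)) \<and> (\<forall>x. h x \<le> Liminf (at x) h)}"

definition edom :: "('a \<Rightarrow> ereal) \<Rightarrow> 'a set" where
  "edom h = {x. h x < \<infinity>}"

definition eps_subdifferential :: "real \<Rightarrow> ('a::real_inner \<Rightarrow> ereal) \<Rightarrow> 'a \<Rightarrow> 'a set" where
  "eps_subdifferential \<epsilon> \<Psi> z = {v. \<forall>u. \<Psi> u \<ge> \<Psi> z + ereal (v \<bullet> (u - z) - \<epsilon>)}"

text \<open>The value of \<open>gradient f x\<close> is meaningful only where \<open>f\<close> is differentiable.\<close>

definition gradient :: "('a::real_inner \<Rightarrow> real) \<Rightarrow> 'a \<Rightarrow> 'a" where
  "gradient f x = (THE g. GDERIV f x :> g)"

text \<open>The derivative is taken in the whole space also at points of \<open>S\<close> that are not interior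
  to \<open>S\<close>, so that the gradient is unique.\<close>

definition C1_on :: "'a::real_inner set \<Rightarrow> ('a \<Rightarrow> real) \<Rightarrow> bool" where
  "C1_on S f \<longleftrightarrow> (\<forall>x\<in>S. \<exists>g. GDERIV f x :> g) \<and> continuous_on S (gradient f)"

definition lin_approx :: "('a::real_inner \<Rightarrow> real) \<Rightarrow> 'a \<Rightarrow> 'a \<Rightarrow> real" where
  "lin_approx F z u = F z + gradient F z \<bullet> (u - z)"


section \<open>Singular values and spectral functions\<close>

definition dg :: "real^'r \<Rightarrow> real^'r^'r" where
  "dg z = (\<chi> i j. if i = j then z $ i else 0)"

definition Dg :: "real^'r^'r \<Rightarrow> real^'r" where
  "Dg W = (\<chi> i. W $ i $ i)"

text \<open>Thin singular value decomposition \<open>U = P (dg s) Q\<^sup>T\<close> of an \<open>m \<times> n\<close> matrix. It is intended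
  for \<open>CARD('r) = min CARD('m) CARD('n)\<close>; the linear order on \<open>'r\<close> is only used to express that
  the entries of \<open>s\<close> are nonincreasing.\<close>

definition is_svd ::
  "real^'n^'m \<Rightarrow> real^('r::{finite,linorder})^'m \<Rightarrow> real^('r::{finite,linorder}) \<Rightarrow> real^('r::{finite,linorder})^'n \<Rightarrow> bool" where
  "is_svd U P s Q \<longleftrightarrow>
     transpose P ** P = mat 1 \<and> transpose Q ** Q = mat 1 \<and>
     (\<forall>i. 0 \<le> s $ i) \<and> (\<forall>i j. i \<le> j \<longrightarrow> s $ j \<le> s $ i) \<and>
     U = P ** dg s ** transpose Q"

definition sing_vals :: "real^'n^'m \<Rightarrow> real^('r::{finite,linorder})" where
  "sing_vals U = (THE s. \<exists>P Q. is_svd U P s Q)"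

text \<open>Applied to a predicate, this is absolute symmetry of the corresponding set.\<close>

definition abs_symmetric :: "(real^'r \<Rightarrow> 'b) \<Rightarrow> bool" where
  "abs_symmetric f \<longleftrightarrow>
     (\<forall>x \<pi> e. bij \<pi> \<longrightarrow> (\<forall>i. e i = 1 \<or> e i = - 1) \<longrightarrow> f (\<chi> i. e i * x $ \<pi> i) = f x)"


section \<open>The S.ACG algorithm\<close>

text \<open>\<open>Success z v \<epsilon>\<close> is the output \<open>(z, v, \<epsilon>, true)\<close> and \<open>Failure y\<^sub>0\<close> is the output
  \<open>(y\<^sub>0, \<infinity>, \<infinity>, false)\<close>. \<open>Diverges\<close> stands for a run that never returns.\<close>

datatype 'a acg_result = Success 'a 'a real | Failure 'a | Diverges

definition refined_point ::
  "('a::euclidean_space \<Rightarrow> real) \<Rightarrow> ('a \<Rightarrow> ereal) \<Rightarrow> real \<Rightarrow> 'a \<Rightarrow> 'a \<Rightarrow> 'a" where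
  "refined_point \<psi>\<^sub>s \<psi>\<^sub>n L z v =
     arg_min (\<lambda>u. ereal (lin_approx \<psi>\<^sub>s z u - v \<bullet> u + L / 2 * (norm (u - z))\<^sup>2) + \<psi>\<^sub>n u) (\<lambda>_. True)"

definition Delta :: "real \<Rightarrow> ('a::real_inner \<Rightarrow> ereal) \<Rightarrow> 'a \<Rightarrow> 'a \<Rightarrow> 'a \<Rightarrow> ereal" where
  "Delta \<mu> \<psi> u z v = \<psi> z - \<psi> u + ereal (v \<bullet> (u - z) + \<mu> / 2 * (norm (u - z))\<^sup>2)"

text \<open>The quantities \<open>a\<close>, \<open>xt\<close>, \<open>q\<close> and \<open>\<gamma>\<close> with argument \<open>k\<close> are the ones computed in iteration
  \<open>k + 1\<close>, that is \<open>a\<^sub>k\<close>, \<open>\<tilde>x\<^sub>k\<close>, \<open>q\<^sub>k\<^sub>+\<^sub>1\<close> and \<open>\<gamma>\<^sub>k\<close>. \<open>real_of_ereal\<close> is only applied to values at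
  the minimisers \<open>y\<^sub>k\<close>, \<open>k \<ge> 1\<close>, where \<open>\<psi>\<^sub>n\<close> is finite.\<close>

locale sacg =
  fixes \<psi>\<^sub>s :: "'a::euclidean_space \<Rightarrow> real"
    and \<psi>\<^sub>n :: "'a \<Rightarrow> ereal"
    and y\<^sub>0 :: 'a
    and \<theta> \<mu> L :: real
begin

definition \<psi> :: "'a \<Rightarrow> ereal" where
  "\<psi> u = ereal (\<psi>\<^sub>s u) + \<psi>\<^sub>n u"

definition next_a :: "real \<Rightarrow> real" where
  "next_a B = (let \<tau> = (1 + \<mu> * B) / L in (\<tau> + sqrt (\<tau>\<^sup>2 + 4 * \<tau> * B)) / 2)"

primrec A :: "nat \<Rightarrow> real" where
  "A 0 = 0"
| "A (Suc k) = A k + next_a (A k)"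

definition a :: "nat \<Rightarrow> real" where
  "a k = next_a (A k)"

definition extrapolate :: "nat \<Rightarrow> 'a \<Rightarrow> 'a \<Rightarrow> 'a" where
  "extrapolate k y' x' = (A k / A (Suc k)) *\<^sub>R y' + (a k / A (Suc k)) *\<^sub>R x'"

definition model :: "'a \<Rightarrow> 'a \<Rightarrow> ereal" where
  "model w u = ereal (lin_approx \<psi>\<^sub>s w u) + \<psi>\<^sub>n u + ereal (\<mu> / 2 * (norm (u - w))\<^sup>2)"

definition prox_step :: "'a \<Rightarrow> 'a" where
  "prox_step w =
     arg_min (\<lambda>u. ereal (1 / L) * model w u + ereal (1 / 2 * (norm (u - w))\<^sup>2)) (\<lambda>_. True)"

primrec yx :: "nat \<Rightarrow> 'a \<times> 'a" where
  "yx 0 = (y\<^sub>0, y\<^sub>0)"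
| "yx (Suc k) =
     (let x' = snd (yx k);
          w = extrapolate k (fst (yx k)) x';
          y' = prox_step w
      in (y', x' + (a k / (1 + \<mu> * A (Suc k))) *\<^sub>R (L *\<^sub>R (y' - w) + \<mu> *\<^sub>R (y' - x'))))"

definition y :: "nat \<Rightarrow> 'a" where "y k = fst (yx k)"

definition x :: "nat \<Rightarrow> 'a" where "x k = snd (yx k)"

definition xt :: "nat \<Rightarrow> 'a" where "xt k = extrapolate k (y k) (x k)"

definition q :: "nat \<Rightarrow> 'a \<Rightarrow> ereal" where "q k = model (xt k)"

definition \<gamma> :: "nat \<Rightarrow> 'a \<Rightarrow> real" where
  "\<gamma> k u = real_of_ereal (q k (y (Suc k))) + L * ((xt k - y (Suc k)) \<bullet> (u - y (Suc k)))
           + \<mu> / 2 * (norm (u - y (Suc k)))\<^sup>2"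

primrec \<Gamma> :: "nat \<Rightarrow> 'a \<Rightarrow> real" where
  "\<Gamma> 0 = (\<lambda>u. 0)"
| "\<Gamma> (Suc k) = (\<lambda>u. A k / A (Suc k) * \<Gamma> k u + a k / A (Suc k) * \<gamma> k u)"

definition r :: "nat \<Rightarrow> 'a" where
  "r k = (x 0 - x k) /\<^sub>R A k"

definition \<eta> :: "nat \<Rightarrow> real" where
  "\<eta> k = real_of_ereal (\<psi> (y k)) - \<Gamma> k (x k) - r k \<bullet> (y k - x k)"

definition rt :: "nat \<Rightarrow> 'a" where
  "rt k = r k + \<mu> *\<^sub>R (y k - x k)"

definition \<eta>t :: "nat \<Rightarrow> real" where
  "\<eta>t k = \<eta> k - \<mu> / 2 * (norm (y k - x k))\<^sup>2"

definition fails :: "nat \<Rightarrow> bool" where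
  "fails k \<longleftrightarrow>
     1 / (1 + \<mu> * A k) * (norm (A k *\<^sub>R rt k + y k - y\<^sub>0))\<^sup>2 + 2 * A k * \<eta>t k > (norm (y k - y\<^sub>0))\<^sup>2"

definition accurate :: "nat \<Rightarrow> bool" where
  "accurate k \<longleftrightarrow> (norm (rt k))\<^sup>2 + 2 * \<eta>t k \<le> \<theta>\<^sup>2 * (norm (y k - y\<^sub>0))\<^sup>2"

definition stops :: "nat \<Rightarrow> bool" where
  "stops k \<longleftrightarrow> 1 \<le> k \<and> (fails k \<or> accurate k)"

definition yh :: "nat \<Rightarrow> 'a" where
  "yh k = refined_point \<psi>\<^sub>s \<psi>\<^sub>n L (y k) (rt k)"

definition result :: "'a acg_result" where
  "result =
     (if \<exists>k. stops k then
        (let k = (LEAST k. stops k) in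
         if fails k then Failure y\<^sub>0
         else if Delta \<mu> \<psi> (yh k) (y k) (rt k) > ereal (\<eta>t k) then Failure y\<^sub>0
         else Success (y k) (rt k) (\<eta>t k))
      else Diverges)"

text \<open>The points \<open>\<tilde>x\<^sub>k\<close> of the iterations \<open>k + 1\<close> that are actually carried out.
  They need not belong to the domain of \<open>\<psi>\<^sub>n\<close>, so assumptions on \<open>\<psi>\<^sub>s\<close> over that domain
  alone say nothing about the gradients used there.\<close>

definition gradient_points :: "'a set" where
  "gradient_points = {xt k | k. \<forall>j\<le>k. \<not> stops j}"

end


section \<open>The sigma-ACG method\<close>

text \<open>\<open>P\<close> and \<open>Q\<close> are the factors of the singular value decomposition of \<open>Z\<^sub>0 - lam \<nabla>f\<^sub>1(Z\<^sub>0)\<close> that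
  the method has picked.\<close>

locale sigma_acg =
  fixes f\<^sub>1 :: "real^'n^'m \<Rightarrow> real"
    and f2V :: "real^('r::{finite,linorder}) \<Rightarrow> real"
    and hV :: "real^('r::{finite,linorder}) \<Rightarrow> ereal"
    and lam \<theta> M\<^sub>2 :: real
    and Z\<^sub>0 :: "real^'n^'m"
    and P :: "real^('r::{finite,linorder})^'m"
    and Q :: "real^('r::{finite,linorder})^'n"
begin

definition s :: "real^('r::{finite,linorder})" where
  "s = sing_vals (Z\<^sub>0 - lam *\<^sub>R gradient f\<^sub>1 Z\<^sub>0)"

definition \<psi>sV :: "real^('r::{finite,linorder}) \<Rightarrow> real" where
  "\<psi>sV u = lam * f2V u - s \<bullet> u + 1 / 2 * (norm u)\<^sup>2"

definition \<psi>nV :: "real^('r::{finite,linorder}) \<Rightarrow> ereal" where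
  "\<psi>nV u = ereal lam * hV u"

definition start :: "real^('r::{finite,linorder})" where
  "start = Dg (transpose P ** Z\<^sub>0 ** Q)"

definition result :: "(real^'n^'m) acg_result" where
  "result =
     (case sacg.result \<psi>sV \<psi>nV start \<theta> 1 (lam * M\<^sub>2 + 1) of
        Success z v \<epsilon> \<Rightarrow> Success (P ** dg z ** transpose Q) (P ** dg v ** transpose Q) \<epsilon>
      | Failure _ \<Rightarrow> Failure Z\<^sub>0
      | Diverges \<Rightarrow> Diverges)"

definition gradient_points :: "(real^('r::{finite,linorder})) set" where
  "gradient_points = sacg.gradient_points \<psi>sV \<psi>nV start \<theta> 1 (lam * M\<^sub>2 + 1)"

end

end

theory Submission
  imports Defs
begin

text \<open>
  For matrices \<open>P\<close>, \<open>Q\<close> with orthonormal columns let \<open>diag_lift P Q z = P (dg z) Q\<^sup>T\<close>, an isometry, and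
  let \<open>diag_part P Q U = Dg (P\<^sup>T U Q)\<close> be its adjoint. By von Neumann's trace inequality and separation,
  \<open>diag_part P Q U\<close> lies in the convex hull of the signed permutations of the singular values of \<open>U\<close>,
  so convex absolutely symmetric functions do not increase when \<open>\<sigma>(U)\<close> is replaced by \<open>diag_part P Q U\<close>.
  As \<open>P\<close> and \<open>Q\<close> diagonalise the linear term of \<open>\<psi>\<^sub>s\<close>, projecting a matrix to the range of
  \<open>diag_lift P Q\<close> decreases all matrix objectives involved, by at least a multiple of the squared
  distance to that range. Hence the matrix prox problem and the matrix \<open>\<epsilon>\<close>-subdifferential inclusion
  both reduce to their counterparts on vectors. The linearisation of \<open>\<psi>\<^sub>s\<close> requires Lewis' formula for
  the gradient of a spectral function, which holds without convexity. On vectors, part (a) is the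
  descent lemma, and part (b) is the usual estimate-sequence analysis of the accelerated method,
  which shows that the failure tests never trigger and that the accuracy test is met once \<open>A\<^sub>k\<close> is large.
\<close>

section \<open>Singular values and spectral functions\<close>

text \<open>Part (a) makes no convexity assumption on \<open>f2V\<close>, which shapes two steps.
  Nonnegativity of \<open>\<epsilon>\<close> cannot be read off an estimate sequence; it comes from
  the refined point, which beats \<open>z\<close> in its own subproblem, so that the tested quantity
  is nonnegative. And the gradient formula for spectral functions has to be derived from
  differentiability at one point. Singular vectors are neither unique nor continuous in the matrix,
  so nothing can be differentiated through the factors; instead the factors of two matrices are
  compared, and the loss in von Neumann's inequality between them is shown to be of second order. In
  part (b) the obstacle is that the extrapolated points \<open>xt k\<close> may leave
  \<open>D\<close>. The set \<open>G\<close> carries smoothness and convexity of \<open>f2V\<close>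
  to them, and the analysis of the accelerated method uses only two-sided bounds at these base
  points, tested against points of \<open>D\<close>. The accuracy test passes from vectors to
  matrices because \<open>start\<close> is the diagonal part of \<open>Z\<^sub>0\<close>: projecting
  cannot increase the distance to a lifted point.\<close>

definition diag_lift :: "real^'r^'m \<Rightarrow> real^'r^'n \<Rightarrow> real^'r \<Rightarrow> real^'n^'m" where
  "diag_lift P Q z = P ** dg z ** transpose Q"

definition diag_part :: "real^'r^'m \<Rightarrow> real^'r^'n \<Rightarrow> real^'n^'m \<Rightarrow> real^'r" where
  "diag_part P Q U = Dg (transpose P ** U ** Q)"

section \<open>The diagonal lift as an isometry with adjoint \<open>diag_part\<close>\<close>

lemma diag_lift_nth: "diag_lift P Q z $ i $ j = (\<Sum>k\<in>UNIV. P $ i $ k * z $ k * Q $ j $ k)"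
proof -
  have "(\<Sum>l\<in>UNIV. P $ i $ l * (if l = k then z $ l else 0)) = P $ i $ k * z $ k" for k
    by (simp add: if_distrib[where f="(*) _"] cong: if_cong)
  then show ?thesis
    by (simp add: diag_lift_def matrix_matrix_mult_def transpose_def dg_def)
qed

lemma diag_part_nth: "diag_part P Q U $ k = column k P \<bullet> (U *v column k Q)"
proof -
  have "diag_part P Q U $ k = (\<Sum>j\<in>UNIV. (\<Sum>i\<in>UNIV. P $ i $ k * U $ i $ j) * Q $ j $ k)"
    by (simp add: diag_part_def matrix_matrix_mult_def transpose_def Dg_def)
  also have "\<dots> = (\<Sum>j\<in>UNIV. \<Sum>i\<in>UNIV. P $ i $ k * (U $ i $ j * Q $ j $ k))"
    by (simp add: sum_distrib_right mult.assoc)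
  also have "\<dots> = (\<Sum>i\<in>UNIV. \<Sum>j\<in>UNIV. P $ i $ k * (U $ i $ j * Q $ j $ k))"
    by (rule sum.swap)
  also have "\<dots> = column k P \<bullet> (U *v column k Q)"
    by (simp add: inner_vec_def matrix_vector_mult_def column_def sum_distrib_left)
  finally show ?thesis .
qed

lemma diag_lift_mult_vec: "diag_lift P Q z *v v = (\<Sum>k\<in>UNIV. (z $ k * (column k Q \<bullet> v)) *\<^sub>R column k P)"
proof (subst vec_eq_iff, intro allI)
  fix i
  have "(diag_lift P Q z *v v) $ i = (\<Sum>j\<in>UNIV. \<Sum>k\<in>UNIV. P $ i $ k * z $ k * Q $ j $ k * v $ j)"
    by (simp add: matrix_vector_mult_def diag_lift_nth sum_distrib_right)
  also have "\<dots> = (\<Sum>k\<in>UNIV. \<Sum>j\<in>UNIV. P $ i $ k * z $ k * Q $ j $ k * v $ j)"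
    by (rule sum.swap)
  also have "\<dots> = (\<Sum>k\<in>UNIV. (z $ k * (column k Q \<bullet> v)) *\<^sub>R column k P) $ i"
    by (simp add: inner_vec_def column_def sum_distrib_left sum_distrib_right algebra_simps)
  finally show "(diag_lift P Q z *v v) $ i = (\<Sum>k\<in>UNIV. (z $ k * (column k Q \<bullet> v)) *\<^sub>R column k P) $ i" .
qed

lemma inner_diag_lift: "diag_lift P Q z \<bullet> U = z \<bullet> diag_part P Q U"
proof -
  have "diag_lift P Q z \<bullet> U = (\<Sum>i\<in>UNIV. \<Sum>j\<in>UNIV. \<Sum>k\<in>UNIV. z $ k * (P $ i $ k * (U $ i $ j * Q $ j $ k)))"
    by (simp add: inner_vec_def diag_lift_nth sum_distrib_right sum_distrib_left algebra_simps)
  also have "\<dots> = (\<Sum>i\<in>UNIV. \<Sum>k\<in>UNIV. \<Sum>j\<in>UNIV. z $ k * (P $ i $ k * (U $ i $ j * Q $ j $ k)))"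
    by (rule sum.cong[OF refl]) (rule sum.swap)
  also have "\<dots> = (\<Sum>k\<in>UNIV. \<Sum>i\<in>UNIV. \<Sum>j\<in>UNIV. z $ k * (P $ i $ k * (U $ i $ j * Q $ j $ k)))"
    by (rule sum.swap)
  also have "\<dots> = z \<bullet> diag_part P Q U"
    by (simp add: inner_vec_def diag_part_nth matrix_vector_mult_def column_def sum_distrib_left)
  finally show ?thesis .
qed

lemma diag_lift_add: "diag_lift P Q (z + w) = diag_lift P Q z + diag_lift P Q w"
  by (simp add: vec_eq_iff diag_lift_nth algebra_simps sum.distrib)

lemma diag_lift_scaleR: "diag_lift P Q (c *\<^sub>R z) = c *\<^sub>R diag_lift P Q z"
  by (simp add: vec_eq_iff diag_lift_nth algebra_simps sum_distrib_left)

lemma diag_lift_minus: "diag_lift P Q (- z) = - diag_lift P Q z"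
  using diag_lift_scaleR[of P Q "-1" z] by simp

lemma diag_lift_diff: "diag_lift P Q (z - w) = diag_lift P Q z - diag_lift P Q w"
  using diag_lift_add[of P Q z "-w"] by (simp add: diag_lift_minus)

lemma orthonormal_columns:
  fixes P :: "real^'r^'m"
  shows "transpose P ** P = mat 1 \<longleftrightarrow> (\<forall>k l. column k P \<bullet> column l P = (if k = l then 1 else 0))"
  by (auto simp: vec_eq_iff matrix_matrix_mult_def transpose_def mat_def inner_vec_def column_def inner_real_def)

text \<open>For two different factor pairs the composition is the entrywise product of
  \<open>transpose P ** P'\<close> and \<open>transpose Q ** Q'\<close>. This matrix governs both
  the trace inequality and the distance expansion below.\<close>

lemma diag_part_diag_lift_nth:
  "diag_part P Q (diag_lift P' Q' w) $ k =
     (\<Sum>l\<in>UNIV. (column k P \<bullet> column l P') * (column k Q \<bullet> column l Q') * w $ l)"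
  by (simp add: diag_part_nth diag_lift_mult_vec inner_sum_right inner_commute algebra_simps)

lemma diag_part_diag_lift [simp]:
  assumes "transpose P ** P = mat 1" "transpose Q ** Q = mat 1"
  shows "diag_part P Q (diag_lift P Q z) = z"
proof (subst vec_eq_iff, intro allI)
  fix k
  have "(column k P \<bullet> column l P) * (column k Q \<bullet> column l Q) * z $ l = (if l = k then z $ l else 0)" for l
    using assms unfolding orthonormal_columns by auto
  then show "diag_part P Q (diag_lift P Q z) $ k = z $ k"
    by (simp add: diag_part_diag_lift_nth)
qed

lemma inner_diag_lift_diag_lift:
  assumes "transpose P ** P = mat 1" "transpose Q ** Q = mat 1"
  shows "diag_lift P Q z \<bullet> diag_lift P Q w = z \<bullet> w"
  using assms by (simp add: inner_diag_lift)

lemma norm_diag_lift: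
  assumes "transpose P ** P = mat 1" "transpose Q ** Q = mat 1"
  shows "norm (diag_lift P Q z) = norm z"
  using assms by (simp add: norm_eq_sqrt_inner inner_diag_lift_diag_lift)

text \<open>Pythagoras: \<open>U - diag_lift P Q (diag_part P Q U)\<close> is orthogonal to the
  range of the lift. The second term on the right is the squared distance to that range.\<close>

lemma norm_diff_diag_lift:
  assumes "transpose P ** P = mat 1" "transpose Q ** Q = mat 1"
  shows "(norm (U - diag_lift P Q z))\<^sup>2 = (norm (diag_part P Q U - z))\<^sup>2 + (norm (U - diag_lift P Q (diag_part P Q U)))\<^sup>2"
proof -
  have 1: "U \<bullet> diag_lift P Q w = w \<bullet> diag_part P Q U" for w
    by (simp add: inner_commute[of U] inner_diag_lift)
  show ?thesis
    unfolding power2_norm_eq_inner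
    by (simp add: inner_diff_left inner_diff_right inner_diag_lift_diag_lift[OF assms] 1
        inner_diag_lift diag_part_diag_lift[OF assms] inner_commute[of z "diag_part P Q U"])
qed

section \<open>Bessel's inequality and von Neumann's trace inequality\<close>

lemma Bessel_columns:
  fixes P :: "real^'r^'m"
  assumes "transpose P ** P = mat 1"
  shows "(\<Sum>l\<in>UNIV. (v \<bullet> column l P)\<^sup>2) \<le> (norm v)\<^sup>2"
proof -
  let ?u = "\<Sum>l\<in>UNIV. (v \<bullet> column l P) *\<^sub>R column l P"
  have 1: "v \<bullet> ?u = (\<Sum>l\<in>UNIV. (v \<bullet> column l P)\<^sup>2)"
    by (simp add: inner_sum_right power2_eq_square)
  have "?u \<bullet> column k P = v \<bullet> column k P" for k
    using assms unfolding orthonormal_columns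
    by (simp add: inner_sum_left if_distrib[where f="(*) _"] cong: if_cong)
  then have 2: "?u \<bullet> ?u = (\<Sum>l\<in>UNIV. (v \<bullet> column l P)\<^sup>2)"
    by (simp add: inner_sum_right[of ?u] power2_eq_square)
  have "0 \<le> (norm (v - ?u))\<^sup>2" by simp
  also have "\<dots> = (norm v)\<^sup>2 - (\<Sum>l\<in>UNIV. (v \<bullet> column l P)\<^sup>2)"
    using 1 2 by (simp add: power2_norm_eq_inner inner_diff_left inner_diff_right inner_commute[of ?u v])
  finally show ?thesis by simp
qed

text \<open>With fewer columns than rows \<open>transpose P ** P'\<close> need not be orthogonal,
  but expanding a unit column of one factor in the columns of the other still bounds its rows and
  columns.\<close>

lemma Bessel_column_column:
  fixes P P' :: "real^'r^'m"
  assumes "transpose P ** P = mat 1" "transpose P' ** P' = mat 1"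
  shows "(\<Sum>l\<in>UNIV. (column k P \<bullet> column l P')\<^sup>2) \<le> 1"
    and "(\<Sum>k\<in>UNIV. (column k P \<bullet> column l P')\<^sup>2) \<le> 1"
proof -
  have n: "(norm (column k P))\<^sup>2 = 1" "(norm (column k P'))\<^sup>2 = 1" for k
    using assms by (simp_all add: orthonormal_columns power2_norm_eq_inner)
  show "(\<Sum>l\<in>UNIV. (column k P \<bullet> column l P')\<^sup>2) \<le> 1"
    using Bessel_columns[OF assms(2), of "column k P"] n by simp
  show "(\<Sum>k\<in>UNIV. (column k P \<bullet> column l P')\<^sup>2) \<le> 1"
    using Bessel_columns[OF assms(1), of "column l P'"] n by (simp add: inner_commute[of "column l P'"])
qed

text \<open>Summation by parts as an induction: removing the largest index \<open>m\<close> leaves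
  \<open>z m\<close> times the full partial sum plus the same kind of sum with weights
  \<open>z i - z m\<close>, which are again nonnegative and nonincreasing.\<close>

lemma Abel_summation_nonneg:
  fixes z b :: "'i::linorder \<Rightarrow> real"
  assumes "finite A" "\<And>i j. i \<in> A \<Longrightarrow> j \<in> A \<Longrightarrow> i \<le> j \<Longrightarrow> z j \<le> z i" "\<And>i. i \<in> A \<Longrightarrow> 0 \<le> z i"
    and "\<And>p. p \<in> A \<Longrightarrow> 0 \<le> (\<Sum>i | i \<in> A \<and> i \<le> p. b i)"
  shows "0 \<le> (\<Sum>i\<in>A. z i * b i)"
  using assms
proof (induction A arbitrary: z rule: finite_linorder_max_induct)
  case empty
  then show ?case by simp
next
  case (insert m A)
  have m: "m \<notin> A" using insert.hyps by auto
  have le: "{i. i \<in> insert m A \<and> i \<le> p} = {i. i \<in> A \<and> i \<le> p}" if "p \<in> A" for p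
    using insert.hyps that by force
  have all: "{i. i \<in> insert m A \<and> i \<le> m} = insert m A"
    using insert.hyps by auto
  have "0 \<le> (\<Sum>i\<in>A. (z i - z m) * b i)"
  proof (rule insert.IH)
    fix p assume p: "p \<in> A"
    show "0 \<le> (\<Sum>i | i \<in> A \<and> i \<le> p. b i)"
      using insert.prems(3)[of p] le[OF p] p by simp
  qed (use insert.prems insert.hyps in \<open>auto simp: less_imp_le\<close>)
  moreover have "0 \<le> z m * (\<Sum>i\<in>insert m A. b i)"
    using insert.prems(2,3)[of m] unfolding all by (intro mult_nonneg_nonneg) auto
  moreover have "(\<Sum>i\<in>insert m A. z i * b i) = (\<Sum>i\<in>A. (z i - z m) * b i) + z m * (\<Sum>i\<in>insert m A. b i)"
    using m insert.hyps by (simp add: algebra_simps sum_subtractf sum_distrib_left)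
  ultimately show ?case by simp
qed

definition sorted_vec :: "real^('r::{finite,linorder}) \<Rightarrow> bool" where
  "sorted_vec z \<longleftrightarrow> (\<forall>i. 0 \<le> z $ i) \<and> (\<forall>i j. i \<le> j \<longrightarrow> z $ j \<le> z $ i)"

lemma Abel_summation_vec:
  fixes b :: "'r::{finite,linorder} \<Rightarrow> real"
  assumes "sorted_vec z" "\<And>p. 0 \<le> (\<Sum>i\<in>{..p}. b i)"
  shows "0 \<le> (\<Sum>i\<in>UNIV. z $ i * b i)"
  using Abel_summation_nonneg[of UNIV "\<lambda>i. z $ i" b] assms
  by (auto simp: sorted_vec_def atMost_def)

text \<open>Abel summation, once against \<open>z\<close> and once against \<open>w\<close>, reduces
  the claim to initial segments of indices. There it says that a corner block of \<open>K\<close>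
  sums to at most the smaller of its two side lengths.\<close>

lemma substochastic_rearrangement:
  fixes K :: "'r::{finite,linorder} \<Rightarrow> 'r \<Rightarrow> real"
  assumes "sorted_vec z" "sorted_vec w"
    and row: "\<And>i. (\<Sum>j\<in>UNIV. \<bar>K i j\<bar>) \<le> 1" and col: "\<And>j. (\<Sum>i\<in>UNIV. \<bar>K i j\<bar>) \<le> 1"
  shows "(\<Sum>i\<in>UNIV. z $ i * (\<Sum>j\<in>UNIV. K i j * w $ j)) \<le> z \<bullet> w"
proof -
  define b where "b i = w $ i - (\<Sum>j\<in>UNIV. K i j * w $ j)" for i
  have "0 \<le> (\<Sum>i\<in>{..p}. b i)" for p
  proof -
    define c where "c j = (if j \<le> p then 1 else 0) - (\<Sum>i\<in>{..p}. K i j)" for j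
    have "(\<Sum>i\<in>{..p}. b i) = (\<Sum>i\<in>{..p}. w $ i) - (\<Sum>j\<in>UNIV. w $ j * (\<Sum>i\<in>{..p}. K i j))"
      by (simp add: b_def sum_subtractf sum_distrib_left mult.commute sum.swap[of _ "UNIV" "{..p}"])
    also have "(\<Sum>i\<in>{..p}. w $ i) = (\<Sum>j\<in>UNIV. w $ j * (if j \<le> p then 1 else 0))"
      by (simp add: if_distrib[where f="(*) _"] sum.If_cases atMost_def cong: if_cong)
    finally have "(\<Sum>i\<in>{..p}. b i) = (\<Sum>j\<in>UNIV. w $ j * c j)"
      by (simp add: c_def algebra_simps sum_subtractf)
    moreover have "0 \<le> (\<Sum>j\<in>UNIV. w $ j * c j)"
    proof (rule Abel_summation_vec[OF assms(2)])
      fix q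
      \<comment> \<open>The row bounds are used when the block has no more rows than columns, the
        column bounds otherwise.\<close>
      have s: "(\<Sum>j\<in>{..q}. \<Sum>i\<in>{..p}. K i j) \<le> card {..min p q}"
      proof (cases "p \<le> q")
        case True
        have "(\<Sum>j\<in>{..q}. \<Sum>i\<in>{..p}. K i j) = (\<Sum>i\<in>{..p}. \<Sum>j\<in>{..q}. K i j)"
          by (rule sum.swap)
        also have "\<dots> \<le> (\<Sum>i\<in>{..p}. 1)"
        proof (rule sum_mono)
          fix i
          have "(\<Sum>j\<in>{..q}. K i j) \<le> (\<Sum>j\<in>{..q}. \<bar>K i j\<bar>)" by (intro sum_mono) auto
          also have "\<dots> \<le> (\<Sum>j\<in>UNIV. \<bar>K i j\<bar>)" by (intro sum_mono2) auto
          finally show "(\<Sum>j\<in>{..q}. K i j) \<le> 1" using row[of i] by simp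
        qed
        finally show ?thesis using True by simp
      next
        case False
        have "(\<Sum>j\<in>{..q}. \<Sum>i\<in>{..p}. K i j) \<le> (\<Sum>j\<in>{..q}. 1)"
        proof (rule sum_mono)
          fix j
          have "(\<Sum>i\<in>{..p}. K i j) \<le> (\<Sum>i\<in>{..p}. \<bar>K i j\<bar>)" by (intro sum_mono) auto
          also have "\<dots> \<le> (\<Sum>i\<in>UNIV. \<bar>K i j\<bar>)" by (intro sum_mono2) auto
          finally show "(\<Sum>i\<in>{..p}. K i j) \<le> 1" using col[of j] by simp
        qed
        then show ?thesis using False by simp
      qed
      have "(\<Sum>j\<in>{..q}. if j \<le> p then 1 else 0) = real (card ({..q} \<inter> {j. j \<le> p}))"
        by (simp add: sum.If_cases)
      also have "{..q} \<inter> {j. j \<le> p} = {..min p q}" by auto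
      finally show "0 \<le> (\<Sum>j\<in>{..q}. c j)"
        using s by (simp add: c_def sum_subtractf)
    qed
    ultimately show ?thesis by simp
  qed
  then have "0 \<le> (\<Sum>i\<in>UNIV. z $ i * b i)" by (rule Abel_summation_vec[OF assms(1)])
  then show ?thesis by (simp add: b_def inner_vec_def algebra_simps sum_subtractf)
qed

text \<open>By the arithmetic-geometric mean inequality. It makes the entrywise product of two
  matrices with rows and columns of norm at most 1 doubly substochastic.\<close>

lemma abs_prod_sum_le_one:
  fixes f g :: "'r::finite \<Rightarrow> real"
  assumes "(\<Sum>i\<in>UNIV. (f i)\<^sup>2) \<le> 1" "(\<Sum>i\<in>UNIV. (g i)\<^sup>2) \<le> 1"
  shows "(\<Sum>i\<in>UNIV. \<bar>f i * g i\<bar>) \<le> 1"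
proof -
  have "\<bar>f i * g i\<bar> \<le> ((f i)\<^sup>2 + (g i)\<^sup>2) / 2" for i
    using sum_squares_bound[of "\<bar>f i\<bar>" "\<bar>g i\<bar>"] by (simp add: abs_mult)
  then have "(\<Sum>i\<in>UNIV. \<bar>f i * g i\<bar>) \<le> (\<Sum>i\<in>UNIV. ((f i)\<^sup>2 + (g i)\<^sup>2) / 2)" by (intro sum_mono)
  also have "\<dots> = ((\<Sum>i\<in>UNIV. (f i)\<^sup>2) + (\<Sum>i\<in>UNIV. (g i)\<^sup>2)) / 2"
    by (simp add: sum.distrib flip: sum_divide_distrib)
  finally show ?thesis using assms by simp
qed

text \<open>The left-hand side is the bilinear form of an entrywise product that is doubly
  substochastic by Bessel, so the rearrangement bound applies.\<close>

theorem von_Neumann_trace: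
  fixes P P' :: "real^('r::{finite,linorder})^'m" and Q Q' :: "real^('r::{finite,linorder})^'n"
  assumes "transpose P ** P = mat 1" "transpose Q ** Q = mat 1"
    and "transpose P' ** P' = mat 1" "transpose Q' ** Q' = mat 1"
    and "sorted_vec z" "sorted_vec w"
  shows "diag_lift P Q z \<bullet> diag_lift P' Q' w \<le> z \<bullet> w"
proof -
  have "diag_lift P Q z \<bullet> diag_lift P' Q' w = (\<Sum>k\<in>UNIV. z $ k *
     (\<Sum>l\<in>UNIV. (column k P \<bullet> column l P') * (column k Q \<bullet> column l Q') * w $ l))"
    by (simp add: inner_diag_lift inner_vec_def[of z] diag_part_diag_lift_nth)
  also have "\<dots> \<le> z \<bullet> w"
    using Bessel_column_column[OF assms(1,3)] Bessel_column_column[OF assms(2,4)]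
    by (intro substochastic_rearrangement assms abs_prod_sum_le_one)
  finally show ?thesis .
qed

section \<open>Uniqueness and Lipschitz continuity of singular values\<close>

lemma is_svd_iff:
  "is_svd U P s Q \<longleftrightarrow> transpose P ** P = mat 1 \<and> transpose Q ** Q = mat 1 \<and> sorted_vec s \<and> U = diag_lift P Q s"
  by (auto simp: is_svd_def sorted_vec_def diag_lift_def)

text \<open>The lifts preserve norms, so only the cross terms differ, and these are compared by the
  trace inequality. With \<open>Z = W\<close> this is uniqueness of the singular values.\<close>

lemma svd_dist_le:
  assumes "is_svd Z P z Q" "is_svd W P' w Q'"
  shows "norm (w - z) \<le> norm (W - Z)"
proof -
  have "Z \<bullet> W \<le> z \<bullet> w" using von_Neumann_trace assms by (auto simp: is_svd_iff)
  moreover have "Z \<bullet> Z = z \<bullet> z" "W \<bullet> W = w \<bullet> w" using assms by (auto simp: is_svd_iff inner_diag_lift_diag_lift)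
  ultimately have "(norm (w - z))\<^sup>2 \<le> (norm (W - Z))\<^sup>2"
    by (simp add: power2_norm_eq_inner inner_diff_left inner_diff_right inner_commute)
  then show ?thesis by (rule power2_le_imp_le) simp
qed

lemma sing_vals_svd:
  fixes U :: "real^'n^'m" and P :: "real^('r::{finite,linorder})^'m" and s :: "real^('r::{finite,linorder})"
    and Q :: "real^('r::{finite,linorder})^'n"
  assumes "is_svd U P s Q"
  shows "sing_vals U = s"
  unfolding sing_vals_def
proof (rule the_equality)
  fix t :: "real^('r::{finite,linorder})" assume "\<exists>P Q. is_svd U P t Q"
  then obtain P' Q' where "is_svd U P' t Q'" by blast
  from svd_dist_le[OF assms this] show "t = s" by simp
qed (use assms in blast)

section \<open>Signed permutations and their absorption into the factors\<close>

text \<open>The largest index receives an element with the smallest value of \<open>g\<close>, and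
  the rest follows by induction. It supplies the permutation that sorts a vector.\<close>

lemma exists_antimono_enumeration:
  fixes g :: "'b \<Rightarrow> 'c::linorder"
  assumes "finite A" "finite B" "card A = card B"
  shows "\<exists>\<pi>. bij_betw \<pi> A B \<and> (\<forall>i\<in>A. \<forall>j\<in>A. (i::'a::linorder) \<le> j \<longrightarrow> g (\<pi> j) \<le> g (\<pi> i))"
  using assms
proof (induction A arbitrary: B rule: finite_linorder_max_induct)
  case empty
  then show ?case by (auto simp: bij_betw_def)
next
  case (insert m A)
  have m: "m \<notin> A" using insert.hyps by auto
  then have ne: "B \<noteq> {}" using insert.prems insert.hyps by auto
  then obtain b where b: "b \<in> B" "\<forall>c\<in>B. g b \<le> g c"
    using insert.prems(1) ex_min_if_finite[of "g ` B"] by (metis (mono_tags) arg_min_if_finite(1) arg_min_least)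
  have "card A = card (B - {b})"
    using insert.prems insert.hyps m b by simp
  then obtain \<pi> where \<pi>: "bij_betw \<pi> A (B - {b})" "\<forall>i\<in>A. \<forall>j\<in>A. i \<le> j \<longrightarrow> g (\<pi> j) \<le> g (\<pi> i)"
    using insert.IH[of "B - {b}"] insert.prems by auto
  define \<rho> where "\<rho> = \<pi>(m := b)"
  have "bij_betw \<rho> A (B - {b})" 
    by (rule iffD2[OF bij_betw_cong \<pi>(1)]) (use m in \<open>auto simp: \<rho>_def\<close>)
  then have "bij_betw \<rho> (insert m A) (insert b (B - {b}))"
    using m by (simp add: \<rho>_def bij_betw_def)
  then have 1: "bij_betw \<rho> (insert m A) B" using b by (simp add: insert_absorb)
  have "g (\<rho> j) \<le> g (\<rho> i)" if "i \<in> insert m A" "j \<in> insert m A" "i \<le> j" for i j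
  proof (cases "j = m")
    case True
    then show ?thesis using bij_betwE[OF 1] that b by (auto simp: \<rho>_def)
  next
    case False
    then have "j \<in> A" "i \<in> A" using that insert.hyps by auto
    then show ?thesis using \<pi>(2) that m by (auto simp: \<rho>_def)
  qed
  with 1 show ?case by blast
qed

text \<open>This is the map occurring in \<open>abs_symmetric\<close>, named so that its inverse,
  its action on gradients and its action on factors can be stated.\<close>

definition signed_perm :: "('r \<Rightarrow> 'r) \<Rightarrow> ('r \<Rightarrow> real) \<Rightarrow> real^'r \<Rightarrow> real^'r" where
  "signed_perm \<pi> e x = (\<chi> i. e i * x $ \<pi> i)"

definition signed_perms :: "(('r \<Rightarrow> 'r) \<times> ('r \<Rightarrow> real)) set" where
  "signed_perms = {(\<pi>, e). bij \<pi> \<and> (\<forall>i. e i = 1 \<or> e i = - 1)}"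

lemma abs_symmetricD: "abs_symmetric f \<Longrightarrow> (\<pi>, e) \<in> signed_perms \<Longrightarrow> f (signed_perm \<pi> e x) = f x"
  by (auto simp: abs_symmetric_def signed_perms_def signed_perm_def)

text \<open>Finiteness makes the convex hull of an orbit compact, hence closed, as separation from a
  point requires.\<close>

lemma finite_signed_perms: "finite (signed_perms :: (('r::finite \<Rightarrow> 'r) \<times> ('r \<Rightarrow> real)) set)"
proof (rule finite_subset)
  show "(signed_perms :: (('r \<Rightarrow> 'r) \<times> ('r \<Rightarrow> real)) set) \<subseteq> UNIV \<times> (UNIV \<rightarrow>\<^sub>E {1, - 1})"
    by (auto simp: signed_perms_def PiE_def)
qed (auto intro!: finite_PiE)

lemma exists_sorting_signed_perm:
  fixes x :: "real^('r::{finite,linorder})"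
  shows "\<exists>\<pi> e. (\<pi>, e) \<in> signed_perms \<and> sorted_vec (signed_perm \<pi> e x)"
proof -
  obtain \<pi> :: "'r \<Rightarrow> 'r" where \<pi>: "bij \<pi>" "\<And>i j. i \<le> j \<Longrightarrow> \<bar>x $ \<pi> j\<bar> \<le> \<bar>x $ \<pi> i\<bar>"
    using exists_antimono_enumeration[of "UNIV :: 'r set" "UNIV :: 'r set" "\<lambda>i. \<bar>x $ i\<bar>"] by auto
  define e where "e i = (if x $ \<pi> i < 0 then - 1 else 1 :: real)" for i
  have "signed_perm \<pi> e x $ i = \<bar>x $ \<pi> i\<bar>" for i
    by (auto simp: signed_perm_def e_def)
  with \<pi> have "(\<pi>, e) \<in> signed_perms \<and> sorted_vec (signed_perm \<pi> e x)"
    by (auto simp: signed_perms_def sorted_vec_def e_def)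
  then show ?thesis by blast
qed

lemma signed_perm_square: "(\<pi>, e) \<in> signed_perms \<Longrightarrow> e i * e i = 1"
  by (auto simp: signed_perms_def dest: spec[of _ i])

lemma inner_signed_perm:
  assumes "(\<pi>, e) \<in> signed_perms"
  shows "signed_perm \<pi> e x \<bullet> signed_perm \<pi> e y = x \<bullet> y"
proof -
  have "signed_perm \<pi> e x \<bullet> signed_perm \<pi> e y = (\<Sum>i\<in>UNIV. (e i * e i) * (x $ \<pi> i * y $ \<pi> i))"
    by (simp add: inner_vec_def signed_perm_def algebra_simps)
  also have "\<dots> = (\<Sum>i\<in>UNIV. x $ \<pi> i * y $ \<pi> i)" using signed_perm_square[OF assms] by simp
  also have "\<dots> = (\<Sum>i\<in>UNIV. x $ i * y $ i)"
    using assms sum.reindex_bij_betw[of \<pi> UNIV UNIV "\<lambda>i. x $ i * y $ i"] by (simp add: signed_perms_def)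
  finally show ?thesis by (simp add: inner_vec_def)
qed

lemma exists_inverse_signed_perm:
  assumes "(\<pi>, e) \<in> signed_perms"
  shows "\<exists>\<rho> d. (\<rho>, d) \<in> signed_perms \<and> (\<forall>x. signed_perm \<rho> d (signed_perm \<pi> e x) = x)
      \<and> (\<forall>x. signed_perm \<pi> e (signed_perm \<rho> d x) = x)"
proof -
  have b: "bij \<pi>" using assms by (auto simp: signed_perms_def)
  \<comment> \<open>Signs are their own inverses, but they have to move along with the permuted
    positions.\<close>
  define d where "d i = e (inv \<pi> i)" for i
  have "(inv \<pi>, d) \<in> signed_perms"
    using assms b by (auto simp: signed_perms_def d_def bij_imp_bij_inv)
  moreover have "signed_perm (inv \<pi>) d (signed_perm \<pi> e x) = x" for x
    using signed_perm_square[OF assms] b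
    by (simp add: vec_eq_iff signed_perm_def d_def bij_is_surj surj_f_inv_f flip: mult.assoc)
  moreover have "signed_perm \<pi> e (signed_perm (inv \<pi>) d x) = x" for x
    using signed_perm_square[OF assms] b
    by (simp add: vec_eq_iff signed_perm_def d_def bij_is_inj inv_f_f flip: mult.assoc)
  ultimately show ?thesis by blast
qed

text \<open>The columns of both factors are permuted and the signs are put into \<open>P\<close>
  alone, so that each sign meets its copy in the vector exactly once and cancels.\<close>

lemma diag_lift_signed_perm:
  assumes "(\<pi>, e) \<in> signed_perms" "transpose P ** P = mat 1" "transpose Q ** Q = mat 1"
  shows "\<exists>P' Q'. transpose P' ** P' = mat 1 \<and> transpose Q' ** Q' = mat 1 \<and>
     (\<forall>z. diag_lift P Q z = diag_lift P' Q' (signed_perm \<pi> e z))"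
proof -
  have b: "bij \<pi>" using assms by (auto simp: signed_perms_def)
  define P' where "P' = (\<chi> i k. e k * P $ i $ \<pi> k)"
  define Q' where "Q' = (\<chi> i k. Q $ i $ \<pi> k)"
  have cP: "column k P' = e k *\<^sub>R column (\<pi> k) P" and cQ: "column k Q' = column (\<pi> k) Q" for k
    by (auto simp: vec_eq_iff column_def P'_def Q'_def)
  have 1: "transpose P' ** P' = mat 1"
    using assms(2) b signed_perm_square[OF assms(1)]
    by (auto simp: orthonormal_columns cP bij_is_inj inj_eq)
  have 2: "transpose Q' ** Q' = mat 1"
    using assms(3) b by (auto simp: orthonormal_columns cQ bij_is_inj inj_eq)
  have 3: "diag_lift P Q z = diag_lift P' Q' (signed_perm \<pi> e z)" for z
  proof -
    have "(\<Sum>k\<in>UNIV. P $ i $ k * z $ k * Q $ j $ k) = (\<Sum>k\<in>UNIV. P' $ i $ k * signed_perm \<pi> e z $ k * Q' $ j $ k)" for i j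
    proof -
      have "P' $ i $ k * signed_perm \<pi> e z $ k * Q' $ j $ k
         = e k * e k * (P $ i $ \<pi> k * z $ \<pi> k * Q $ j $ \<pi> k)" for k
        by (simp add: P'_def Q'_def signed_perm_def)
      then show ?thesis
        using sum.reindex_bij_betw[of \<pi> UNIV UNIV "\<lambda>k. P $ i $ k * z $ k * Q $ j $ k"] b
        by (simp add: signed_perm_square[OF assms(1)])
    qed
    then show ?thesis by (simp add: vec_eq_iff diag_lift_nth)
  qed
  from 1 2 3 show ?thesis by blast
qed

text \<open>Sorting an arbitrary diagonal, possibly with negative entries, turns a lift into a
  singular value decomposition. The last clause keeps the same new factors valid for all diagonals,
  so that a gradient can be transported together with its base point.\<close>

lemma diag_lift_svd:
  fixes z :: "real^('r::{finite,linorder})"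
  assumes "transpose P ** P = mat 1" "transpose Q ** Q = mat 1"
  obtains \<pi> e P' Q' where "(\<pi>, e) \<in> signed_perms" 
    "sing_vals (diag_lift P Q z) = signed_perm \<pi> e z"
    "is_svd (diag_lift P Q z) P' (signed_perm \<pi> e z) Q'"
    "\<And>w. diag_lift P Q w = diag_lift P' Q' (signed_perm \<pi> e w)"
proof -
  obtain \<pi> e where e: "(\<pi>, e) \<in> signed_perms" and s: "sorted_vec (signed_perm \<pi> e z)"
    using exists_sorting_signed_perm by blast
  obtain P' Q' where *: "transpose P' ** P' = mat 1" "transpose Q' ** Q' = mat 1"
     "\<And>z. diag_lift P Q z = diag_lift P' Q' (signed_perm \<pi> e z)"
    using diag_lift_signed_perm[OF e assms] by blast
  have "is_svd (diag_lift P Q z) P' (signed_perm \<pi> e z) Q'"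
    using * s by (simp add: is_svd_iff)
  with that e * show ?thesis using sing_vals_svd by blast
qed

lemma abs_symmetric_sing_vals_diag_lift:
  assumes "abs_symmetric f" "transpose P ** P = mat 1" "transpose Q ** Q = mat 1"
  shows "f (sing_vals (diag_lift P Q z)) = f z"
  using assms diag_lift_svd[OF assms(2,3), of z] by (metis abs_symmetricD)

section \<open>Existence of the thin singular value decomposition\<close>

lemma exists_unit_orthogonal:
  fixes p :: "'i \<Rightarrow> real^'m"
  assumes "finite A" "card A < CARD('m)"
  shows "\<exists>x. norm x = 1 \<and> (\<forall>i\<in>A. x \<bullet> p i = 0)"
proof -
  have "dim (p ` A) < DIM(real^'m)"
    using assms card_image_le[of A p] dim_le_card'[of "p ` A"] by simp
  then have "span (p ` A) \<noteq> UNIV" by (metis dim_UNIV dim_span less_irrefl)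
  then obtain x where x: "x \<noteq> 0" "\<forall>y\<in>span (p ` A). orthogonal x y"
    using orthogonal_to_subspace_exists[of "p ` A"] \<open>dim (p ` A) < DIM(real^'m)\<close> 
    by (metis orthogonal_commute span_base)
  then have "norm (x /\<^sub>R norm x) = 1 \<and> (\<forall>i\<in>A. (x /\<^sub>R norm x) \<bullet> p i = 0)"
    by (auto simp: orthogonal_def span_base)
  then show ?thesis by blast
qed

text \<open>The feasible pairs form a product of two unit spheres cut by hyperplanes: compact, and
  nonempty because there are fewer constraints than dimensions on either side.\<close>

lemma exists_max_bilinear:
  fixes U :: "real^'n^'m"
  assumes "finite A" "card A < CARD('m)" "card A < CARD('n)"
  obtains x y where "norm x = 1" "norm y = 1" "\<forall>i\<in>A. x \<bullet> p i = 0" "\<forall>i\<in>A. y \<bullet> q i = 0"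
    "\<And>x' y'. norm x' = 1 \<Longrightarrow> norm y' = 1 \<Longrightarrow> \<forall>i\<in>A. x' \<bullet> p i = 0 \<Longrightarrow> \<forall>i\<in>A. y' \<bullet> q i = 0
       \<Longrightarrow> x' \<bullet> (U *v y') \<le> x \<bullet> (U *v y)"
proof -
  define X where "X = sphere 0 1 \<inter> (\<Inter>i\<in>A. {x. p i \<bullet> x = 0})"
  define Y where "Y = sphere 0 1 \<inter> (\<Inter>i\<in>A. {y. q i \<bullet> y = 0})"
  have X: "x \<in> X \<longleftrightarrow> norm x = 1 \<and> (\<forall>i\<in>A. x \<bullet> p i = 0)" for x
    by (auto simp: X_def inner_commute[of x])
  have Y: "y \<in> Y \<longleftrightarrow> norm y = 1 \<and> (\<forall>i\<in>A. y \<bullet> q i = 0)" for y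
    by (auto simp: Y_def inner_commute[of y])
  have "compact X" "compact Y" unfolding X_def Y_def
    by (intro compact_Int_closed closed_INT ballI closed_hyperplane compact_sphere)+
  then have "compact (X \<times> Y)" by (rule compact_Times)
  moreover have "X \<noteq> {}" "Y \<noteq> {}"
    using exists_unit_orthogonal[OF assms(1,2), of p] exists_unit_orthogonal[OF assms(1,3), of q]
    by (metis X empty_iff, metis Y empty_iff)
  then have "X \<times> Y \<noteq> {}" by auto
  moreover have "continuous_on (X \<times> Y) (\<lambda>z. fst z \<bullet> (U *v snd z))"
    by (intro continuous_intros linear_continuous_on_compose[OF _ matrix_vector_mul_linear])
  ultimately obtain z where z: "z \<in> X \<times> Y"
    and max: "\<And>w. w \<in> X \<times> Y \<Longrightarrow> fst w \<bullet> (U *v snd w) \<le> fst z \<bullet> (U *v snd z)"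
    using continuous_attains_sup[of "X \<times> Y" "\<lambda>z. fst z \<bullet> (U *v snd z)"] by blast
  show ?thesis
  proof (rule that[of "fst z" "snd z"])
    fix x y assume "norm x = 1" "norm y = 1" "\<forall>i\<in>A. x \<bullet> p i = 0" "\<forall>i\<in>A. y \<bullet> q i = 0"
    then show "x \<bullet> (U *v y) \<le> fst z \<bullet> (U *v snd z)"
      using max[of "(x, y)"] by (simp add: X Y)
  qed (use z in \<open>auto simp: X Y mem_Times_iff\<close>)
qed

text \<open>Equality case of Cauchy-Schwarz, which turns maximality of a bilinear form into the
  singular vector equations.\<close>

lemma eq_scaleR_of_inner_eq:
  fixes x u :: "'a::real_inner"
  assumes "norm x = 1" "x \<bullet> u = t" "norm u \<le> t"
  shows "u = t *\<^sub>R x"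
proof -
  have "(norm u)\<^sup>2 \<le> t\<^sup>2" using assms(3) by (simp add: power_mono)
  moreover have "(norm (u - t *\<^sub>R x))\<^sup>2 = (norm u)\<^sup>2 - 2 * t * (x \<bullet> u) + t\<^sup>2 * (norm x)\<^sup>2"
    unfolding power2_norm_eq_inner
    by (simp add: inner_diff_left inner_diff_right inner_commute[of u x] power2_eq_square algebra_simps)
  ultimately have "(norm (u - t *\<^sub>R x))\<^sup>2 \<le> 0" using assms by (simp add: power2_eq_square)
  then show ?thesis by simp
qed

text \<open>The singular triples are found one after the other, by maximising \<open>x \<bullet> U y\<close> over the unit
  vectors orthogonal to the triples already found.\<close>

definition partial_svd :: "real^'n^'m \<Rightarrow> 'r::linorder set \<Rightarrow> ('r \<Rightarrow> real^'m) \<Rightarrow> ('r \<Rightarrow> real) \<Rightarrow> ('r \<Rightarrow> real^'n) \<Rightarrow> bool" where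
  "partial_svd U A p s q \<longleftrightarrow>
     (\<forall>i\<in>A. \<forall>j\<in>A. p i \<bullet> p j = (if i = j then 1 else 0)) \<and>
     (\<forall>i\<in>A. \<forall>j\<in>A. q i \<bullet> q j = (if i = j then 1 else 0)) \<and>
     (\<forall>i\<in>A. 0 \<le> s i \<and> U *v q i = s i *\<^sub>R p i \<and> p i v* U = s i *\<^sub>R q i) \<and>
     (\<forall>i\<in>A. \<forall>j\<in>A. i \<le> j \<longrightarrow> s j \<le> s i) \<and>
     (\<forall>i\<in>A. \<forall>x y. norm x = 1 \<longrightarrow> norm y = 1 \<longrightarrow> (\<forall>j\<in>A. x \<bullet> p j = 0) \<longrightarrow> (\<forall>j\<in>A. y \<bullet> q j = 0)
        \<longrightarrow> x \<bullet> (U *v y) \<le> s i)"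

text \<open>For a new maximiser, \<open>U *v y\<close> is orthogonal to the old left vectors because
  these satisfy their own equations. Hence it is itself feasible up to scaling, maximality bounds
  its norm by \<open>t\<close>, and the equality case gives \<open>U *v y = t *\<^sub>R x\<close>;
  the other side is symmetric. The last clause of the invariant orders the values.\<close>

lemma partial_svd_exists:
  fixes U :: "real^'n^'m" and A :: "'r::linorder set"
  assumes "finite A" "card A \<le> CARD('m)" "card A \<le> CARD('n)"
  shows "\<exists>p s q. partial_svd U A p s q"
  using assms
proof (induction A rule: finite_linorder_max_induct)
  case empty
  then show ?case by (simp add: partial_svd_def)
next
  case (insert b A)
  have b: "b \<notin> A" using insert.hyps by auto
  have c: "card A < CARD('m)" "card A < CARD('n)" using insert.prems insert.hyps b by auto
  then obtain p s q where IH: "partial_svd U A p s q" using insert.IH by auto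
  obtain x y where xy: "norm x = 1" "norm y = 1" "\<forall>i\<in>A. x \<bullet> p i = 0" "\<forall>i\<in>A. y \<bullet> q i = 0"
    and max: "\<And>x' y'. norm x' = 1 \<Longrightarrow> norm y' = 1 \<Longrightarrow> \<forall>i\<in>A. x' \<bullet> p i = 0 \<Longrightarrow> \<forall>i\<in>A. y' \<bullet> q i = 0
       \<Longrightarrow> x' \<bullet> (U *v y') \<le> x \<bullet> (U *v y)"
    using exists_max_bilinear[OF insert.hyps(1) c] by blast
  define t where "t = x \<bullet> (U *v y)"
  \<comment> \<open>Replacing \<open>x\<close> by \<open>- x\<close> keeps all constraints and flips
    the sign of the value.\<close>
  have t0: "0 \<le> t"
    using max[of "-x" y] xy by (simp add: t_def)
  have scaled: "v \<bullet> (U *v w) \<le> t * (norm v * norm w)"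
    if "\<forall>i\<in>A. v \<bullet> p i = 0" "\<forall>i\<in>A. w \<bullet> q i = 0" for v w
  proof (cases "v = 0 \<or> w = 0")
    case False
    then have "(v /\<^sub>R norm v) \<bullet> (U *v (w /\<^sub>R norm w)) \<le> t" unfolding t_def
      using that by (intro max) auto
    then show ?thesis using False
      by (simp add: matrix_vector_mult_scaleR field_simps)
  qed auto
  \<comment> \<open>Stated for an arbitrary inner product space since it is applied to vectors of
    both lengths, \<open>U *v y\<close> and \<open>x v* U\<close>.\<close>
  have self: "norm v \<le> t" if "v \<bullet> v \<le> t * norm v" for v :: "'c::real_inner"
  proof (cases "v = 0")
    case False
    then show ?thesis using that by (simp add: power2_eq_square flip: power2_norm_eq_inner)
  qed (use t0 in simp)
  have Uy: "U *v y = t *\<^sub>R x"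
  proof -
    have o: "(U *v y) \<bullet> p i = 0" if "i \<in> A" for i
    proof -
      have "p i v* U = s i *\<^sub>R q i" using IH that by (simp add: partial_svd_def)
      then have "p i \<bullet> (U *v y) = s i * (q i \<bullet> y)" by (simp flip: dot_lmul_matrix)
      then show ?thesis using xy that by (simp add: inner_commute)
    qed
    have "(U *v y) \<bullet> (U *v y) \<le> t * (norm (U *v y) * norm y)"
      using o xy by (intro scaled) auto
    then have "norm (U *v y) \<le> t" using xy by (intro self) simp
    then show ?thesis using xy by (intro eq_scaleR_of_inner_eq) (auto simp: t_def)
  qed
  have Ux: "x v* U = t *\<^sub>R y"
  proof -
    have o: "(x v* U) \<bullet> q i = 0" if "i \<in> A" for i
      using IH that xy by (simp add: partial_svd_def dot_lmul_matrix)
    have "x \<bullet> (U *v (x v* U)) \<le> t * (norm x * norm (x v* U))"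
      using o xy by (intro scaled) auto
    then have "norm (x v* U) \<le> t" using xy by (intro self) (simp add: dot_lmul_matrix)
    then show ?thesis using xy
      by (intro eq_scaleR_of_inner_eq) (auto simp: t_def inner_commute[of y] dot_lmul_matrix)
  qed
  have ts: "t \<le> s i" if "i \<in> A" for i
    using IH that xy unfolding partial_svd_def t_def by blast
  define p' s' q' where "p' = p(b := x)" and "s' = s(b := t)" and "q' = q(b := y)"
  have old: "p' i = p i" "s' i = s i" "q' i = q i" if "i \<in> A" for i
    using that b by (auto simp: p'_def s'_def q'_def)
  have new: "p' b = x" "s' b = t" "q' b = y" by (auto simp: p'_def s'_def q'_def)
  have xx: "x \<bullet> x = 1" "y \<bullet> y = 1" using xy by (simp_all flip: power2_norm_eq_inner)
  have p0: "p i \<bullet> x = 0" "q i \<bullet> y = 0" "x \<bullet> p i = 0" "y \<bullet> q i = 0" if "i \<in> A" for i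
    using xy(3,4) that by (auto simp: inner_commute)
  have "partial_svd U (insert b A) p' s' q'"
    unfolding partial_svd_def
  proof (intro conjI)
    show "\<forall>i\<in>insert b A. \<forall>j\<in>insert b A. p' i \<bullet> p' j = (if i = j then 1 else 0)"

    proof (intro ballI)
      fix i j assume "i \<in> insert b A" "j \<in> insert b A"
      then show "p' i \<bullet> p' j = (if i = j then 1 else 0)"
        using IH b xx p0 by (cases "i = b"; cases "j = b") (auto simp: old new partial_svd_def inner_commute)
    qed
    show "\<forall>i\<in>insert b A. \<forall>j\<in>insert b A. q' i \<bullet> q' j = (if i = j then 1 else 0)"

    proof (intro ballI)
      fix i j assume "i \<in> insert b A" "j \<in> insert b A"
      then show "q' i \<bullet> q' j = (if i = j then 1 else 0)"
        using IH b xx p0 by (cases "i = b"; cases "j = b") (auto simp: old new partial_svd_def inner_commute)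
    qed
    show "\<forall>i\<in>insert b A. 0 \<le> s' i \<and> U *v q' i = s' i *\<^sub>R p' i \<and> p' i v* U = s' i *\<^sub>R q' i"
      using IH Ux Uy t0 by (auto simp: old new partial_svd_def)
    show "\<forall>i\<in>insert b A. \<forall>j\<in>insert b A. i \<le> j \<longrightarrow> s' j \<le> s' i"
      using IH ts insert.hyps by (force simp: old new partial_svd_def)
    show "\<forall>i\<in>insert b A. \<forall>x' y'. norm x' = 1 \<longrightarrow> norm y' = 1 \<longrightarrow> (\<forall>j\<in>insert b A. x' \<bullet> p' j = 0) \<longrightarrow>
       (\<forall>j\<in>insert b A. y' \<bullet> q' j = 0) \<longrightarrow> x' \<bullet> (U *v y') \<le> s' i"
    proof (intro ballI allI impI)
      fix i x' y' assume *: "i \<in> insert b A" "norm x' = 1" "norm y' = 1"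
        "\<forall>j\<in>insert b A. x' \<bullet> p' j = 0" "\<forall>j\<in>insert b A. y' \<bullet> q' j = 0"
      then have "x' \<bullet> (U *v y') \<le> t" unfolding t_def by (intro max) (auto simp: old)
      then show "x' \<bullet> (U *v y') \<le> s' i" using *(1) ts[of i] by (auto simp: old new)
    qed
  qed
  then show ?case by blast
qed

lemma orthonormal_basis_ext:
  fixes q :: "'r::finite \<Rightarrow> real^'n"
  assumes "\<And>i j. q i \<bullet> q j = (if i = j then 1 else 0)" "CARD('r) = CARD('n)"
    and "\<And>i. U *v q i = (V::real^'n^'m) *v q i"
  shows "U = V"
proof -
  have inj: "inj q" using assms(1) by (metis injI zero_neq_one)
  have "0 \<notin> range q" using assms(1) by (metis (full_types) imageE inner_zero_left zero_neq_one)
  moreover have "pairwise orthogonal (range q)"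
    using assms(1) by (auto simp: pairwise_def orthogonal_def)
  ultimately have "independent (range q)" by (rule pairwise_orthogonal_independent[rotated])
  moreover have "card (range q) = DIM(real^'n)" using assms(2) inj by (simp add: card_image)
  ultimately have "UNIV \<subseteq> span (range q)"
    by (intro card_ge_dim_independent) (auto simp: dim_UNIV)
  then have "U *v v = V *v v" for v
    using linear_eq_on_span[of "(*v) U" "(*v) V" "range q" v] assms(3) by auto
  then show ?thesis by (simp add: matrix_eq)
qed

text \<open>The singular vectors form a basis only on the side of smaller dimension. If that is the
  left side, the transposes are compared instead.\<close>

theorem svd_exists:
  fixes U :: "real^'n^'m"
  assumes "CARD('r::{finite,linorder}) = min CARD('m) CARD('n)"
  shows "\<exists>P (s::real^('r::{finite,linorder})) Q. is_svd U P s Q"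
proof -
  obtain p s q where *: "partial_svd U (UNIV :: 'r set) p s q"
    using partial_svd_exists[of "UNIV :: 'r set" U] assms by auto
  define P where "P = (\<chi> i k. p k $ i)"
  define Q where "Q = (\<chi> i k. q k $ i)"
  define s' where "s' = (\<chi> k. s k)"
  have c: "column k P = p k" "column k Q = q k" for k
    by (auto simp: P_def Q_def column_def vec_eq_iff)
  have o: "transpose P ** P = mat 1" "transpose Q ** Q = mat 1" and s: "sorted_vec s'"
    using * by (auto simp: orthonormal_columns c partial_svd_def sorted_vec_def s'_def)
  have tr: "transpose (diag_lift P Q s') = diag_lift Q P s'"
    by (simp add: vec_eq_iff transpose_def diag_lift_nth mult_ac)
  have Q: "diag_lift P Q s' *v q k = U *v q k" and P: "diag_lift Q P s' *v p k = transpose U *v p k" for k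
    using * by (auto simp: diag_lift_mult_vec c partial_svd_def s'_def if_distrib[where f="\<lambda>x. x *\<^sub>R _"]
       if_distrib[where f="(*) _"] cong: if_cong)
  have "U = diag_lift P Q s'"
  proof (cases "CARD('n) \<le> CARD('m)")
    case True
    then show ?thesis
      using * assms Q by (intro orthonormal_basis_ext[of q]) (auto simp: partial_svd_def)
  next
    case False
    then have "transpose U = transpose (diag_lift P Q s')" unfolding tr
      using * assms P by (intro orthonormal_basis_ext[of p]) (auto simp: partial_svd_def)
    then show ?thesis by (metis transpose_transpose)
  qed
  with o s have "is_svd U P s' Q" by (simp add: is_svd_iff)
  then show ?thesis by blast
qed

section \<open>Convex absolutely symmetric functions under \<open>diag_part\<close>\<close>

lemma diag_part_in_hull:
  fixes U :: "real^'n^'m" and P P' :: "real^('r::{finite,linorder})^'m" and Q Q' :: "real^('r::{finite,linorder})^'n"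
  assumes P: "transpose P ** P = mat 1" "transpose Q ** Q = mat 1" and U: "is_svd U P' s Q'"
  shows "diag_part P Q U \<in> convex hull ((\<lambda>(\<pi>, e). signed_perm \<pi> e s) ` signed_perms)"
proof (rule ccontr)
  let ?S = "(\<lambda>(\<pi>, e). signed_perm \<pi> e s) ` signed_perms"
  assume "diag_part P Q U \<notin> convex hull ?S"
  moreover have "closed (convex hull ?S)"
    by (intro compact_imp_closed finite_imp_compact_convex_hull finite_imageI finite_signed_perms)
  ultimately obtain a b where ab: "a \<bullet> diag_part P Q U < b" "\<And>x. x \<in> convex hull ?S \<Longrightarrow> b < a \<bullet> x"
    using separating_hyperplane_closed_point[of "convex hull ?S"] by (metis convex_convex_hull)
  \<comment> \<open>The trace inequality needs sorted vectors, and the separating direction is not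
    sorted. Sorting it is absorbed by the factors, and the inverse signed permutation is then moved
    onto \<open>s\<close>, which yields an orbit point violating the separation.\<close>
  obtain \<pi> e where e: "(\<pi>, e) \<in> signed_perms" and sorted: "sorted_vec (signed_perm \<pi> e (- a))"
    using exists_sorting_signed_perm by blast
  obtain P2 Q2 where P2: "transpose P2 ** P2 = mat 1" "transpose Q2 ** Q2 = mat 1"
     "diag_lift P Q (- a) = diag_lift P2 Q2 (signed_perm \<pi> e (- a))"
    using diag_lift_signed_perm[OF e P] by blast
  obtain \<rho> d where d: "(\<rho>, d) \<in> signed_perms" "\<And>x. signed_perm \<rho> d (signed_perm \<pi> e x) = x"
    using exists_inverse_signed_perm[OF e] by blast
  have "- (a \<bullet> diag_part P Q U) = diag_lift P2 Q2 (signed_perm \<pi> e (- a)) \<bullet> U"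
    by (simp add: inner_diag_lift flip: P2(3))
  also have "\<dots> \<le> signed_perm \<pi> e (- a) \<bullet> s"
    using von_Neumann_trace[OF P2(1,2), of P' Q'] U sorted by (auto simp: is_svd_iff)
  also have "\<dots> = - a \<bullet> signed_perm \<rho> d s"
    by (simp add: d(2) flip: inner_signed_perm[OF d(1), of "signed_perm \<pi> e (- a)"])
  also have "\<dots> < - b"
    using ab(2)[OF hull_inc, of "signed_perm \<rho> d s"] d(1) by force
  finally show False using ab(1) by simp
qed

text \<open>\<open>C\<close> records where \<open>f\<close> is known to be convex; its symmetry
  keeps the whole orbit of the singular values, and thus its hull, inside \<open>C\<close>.\<close>

lemma convex_abs_symmetric_diag_part:
  fixes U :: "real^'n^'m" and P :: "real^('r::{finite,linorder})^'m" and Q :: "real^('r::{finite,linorder})^'n"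
  assumes P: "transpose P ** P = mat 1" "transpose Q ** Q = mat 1"
    and r: "CARD('r) = min CARD('m) CARD('n)"
    and C: "convex_on C f" "abs_symmetric f" "abs_symmetric (\<lambda>x. x \<in> C)" "sing_vals U \<in> C"
  shows "diag_part P Q U \<in> C" "f (diag_part P Q U) \<le> (f (sing_vals U) :: real)"
proof -
  obtain P' s Q' where U: "is_svd U P' (s :: real^('r::{finite,linorder})) Q'"
    using svd_exists[OF r] by blast
  let ?S = "(\<lambda>(\<pi>, e). signed_perm \<pi> e s) ` signed_perms"
  have s: "sing_vals U = s" using U by (rule sing_vals_svd)
  have "?S \<subseteq> C"
    using C(4) abs_symmetricD[OF C(3)] unfolding s by auto
  then have sub: "convex hull ?S \<subseteq> C"
    using C(1) by (intro hull_minimal) (auto simp: convex_on_def)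
  have hull: "diag_part P Q U \<in> convex hull ?S" by (rule diag_part_in_hull[OF P U])
  with sub show "diag_part P Q U \<in> C" by blast
  have "convex_on (convex hull ?S) f"
    using C(1) sub by (rule convex_on_subset) simp
  moreover have "\<forall>x\<in>?S. f x \<le> f s" using abs_symmetricD[OF C(2)] by auto
  ultimately have "\<forall>x\<in>convex hull ?S. f x \<le> f s" by (rule convex_on_convex_hull_bound)
  with hull show "f (diag_part P Q U) \<le> f (sing_vals U)" unfolding s by blast
qed

section \<open>Differentiability of spectral functions\<close>

text \<open>With \<open>M = P\<^sup>T P'\<close> and \<open>N = Q\<^sup>T Q'\<close> the weights satisfy \<open>M k l * N k l = \<alpha> k l - \<beta> k l\<close>, and \<open>\<alpha> + \<beta>\<close>
  is doubly substochastic. All coefficients on the right-hand side are therefore nonnegative, which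
  allows the expansions for two vectors to be compared term by term.\<close>

lemma diag_lift_dist_square:
  fixes P P' :: "real^'r^'m" and Q Q' :: "real^'r^'n"
  assumes "transpose P ** P = mat 1" "transpose Q ** Q = mat 1"
    and "transpose P' ** P' = mat 1" "transpose Q' ** Q' = mat 1"
  defines "\<alpha> \<equiv> \<lambda>k l. ((column k P \<bullet> column l P' + column k Q \<bullet> column l Q') / 2)\<^sup>2"
    and "\<beta> \<equiv> \<lambda>k l. ((column k P \<bullet> column l P' - column k Q \<bullet> column l Q') / 2)\<^sup>2"
  shows "(norm (diag_lift P Q g - diag_lift P' Q' g))\<^sup>2 =
      (\<Sum>k\<in>UNIV. \<Sum>l\<in>UNIV. \<alpha> k l * (g $ k - g $ l)\<^sup>2 + \<beta> k l * (g $ k + g $ l)\<^sup>2) +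
      (\<Sum>k\<in>UNIV. (g $ k)\<^sup>2 * (1 - (\<Sum>l\<in>UNIV. \<alpha> k l + \<beta> k l))) +
      (\<Sum>l\<in>UNIV. (g $ l)\<^sup>2 * (1 - (\<Sum>k\<in>UNIV. \<alpha> k l + \<beta> k l)))"
proof -
  let ?K = "\<lambda>k l. (column k P \<bullet> column l P') * (column k Q \<bullet> column l Q')"
  have K: "?K k l = \<alpha> k l - \<beta> k l" for k l
    by (simp add: \<alpha>_def \<beta>_def power2_eq_square field_simps)
  have "diag_lift P Q g \<bullet> diag_lift P' Q' g = (\<Sum>k\<in>UNIV. \<Sum>l\<in>UNIV. g $ k * g $ l * (\<alpha> k l - \<beta> k l))"
    by (simp add: inner_diag_lift inner_vec_def[of g] diag_part_diag_lift_nth K sum_distrib_left algebra_simps)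
  then have lhs: "(norm (diag_lift P Q g - diag_lift P' Q' g))\<^sup>2 =
      (\<Sum>k\<in>UNIV. (g $ k)\<^sup>2) + (\<Sum>k\<in>UNIV. (g $ k)\<^sup>2) - 2 * (\<Sum>k\<in>UNIV. \<Sum>l\<in>UNIV. g $ k * g $ l * (\<alpha> k l - \<beta> k l))"
    unfolding power2_norm_eq_inner
    by (simp add: inner_diff_left inner_diff_right inner_commute[of "diag_lift P' Q' g" "diag_lift P Q g"]
        inner_diag_lift_diag_lift[OF assms(1,2)] inner_diag_lift_diag_lift[OF assms(3,4)] inner_vec_def[of g]
        power2_eq_square)
  have "\<alpha> k l * (g $ k - g $ l)\<^sup>2 + \<beta> k l * (g $ k + g $ l)\<^sup>2 =
     (g $ k)\<^sup>2 * (\<alpha> k l + \<beta> k l) + (g $ l)\<^sup>2 * (\<alpha> k l + \<beta> k l) - 2 * (g $ k * g $ l * (\<alpha> k l - \<beta> k l))" for k l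
    by (simp add: power2_eq_square algebra_simps)
  then have "(\<Sum>k\<in>UNIV. \<Sum>l\<in>UNIV. \<alpha> k l * (g $ k - g $ l)\<^sup>2 + \<beta> k l * (g $ k + g $ l)\<^sup>2) =
     (\<Sum>k\<in>UNIV. \<Sum>l\<in>UNIV. (g $ k)\<^sup>2 * (\<alpha> k l + \<beta> k l)) + (\<Sum>k\<in>UNIV. \<Sum>l\<in>UNIV. (g $ l)\<^sup>2 * (\<alpha> k l + \<beta> k l))
     - 2 * (\<Sum>k\<in>UNIV. \<Sum>l\<in>UNIV. g $ k * g $ l * (\<alpha> k l - \<beta> k l))"
    by (simp only: sum.distrib sum_subtractf sum_distrib_left)
  also have "(\<Sum>k\<in>UNIV. \<Sum>l\<in>UNIV. (g $ l)\<^sup>2 * (\<alpha> k l + \<beta> k l)) =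
     (\<Sum>l\<in>UNIV. (g $ l)\<^sup>2 * (\<Sum>k\<in>UNIV. \<alpha> k l + \<beta> k l))"
    by (subst sum.swap) (simp only: sum_distrib_left)
  also have "(\<Sum>k\<in>UNIV. \<Sum>l\<in>UNIV. (g $ k)\<^sup>2 * (\<alpha> k l + \<beta> k l)) =
     (\<Sum>k\<in>UNIV. (g $ k)\<^sup>2 * (\<Sum>l\<in>UNIV. \<alpha> k l + \<beta> k l))"
    by (simp only: sum_distrib_left)
  finally show ?thesis unfolding lhs
    by (simp only: right_diff_distrib sum_subtractf mult_1_right)
qed

text \<open>The two conditions say that the odd assignment of \<open>g $ i\<close> to
  \<open>z $ i\<close> and of \<open>- g $ i\<close> to \<open>- z $ i\<close> is well defined and
  \<open>c\<close>-Lipschitz. The lemma bounds the effect of a change of factors on \<open>g\<close>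
  by its effect on \<open>z\<close>.\<close>

lemma diag_lift_Lipschitz:
  fixes P P' :: "real^'r^'m" and Q Q' :: "real^'r^'n"
  assumes P: "transpose P ** P = mat 1" "transpose Q ** Q = mat 1"
    "transpose P' ** P' = mat 1" "transpose Q' ** Q' = mat 1"
    and c: "0 \<le> c" "\<And>i j. \<bar>g $ i - g $ j\<bar> \<le> c * \<bar>z $ i - z $ j\<bar>"
      "\<And>i j. \<bar>g $ i + g $ j\<bar> \<le> c * \<bar>z $ i + z $ j\<bar>"
  shows "norm (diag_lift P Q g - diag_lift P' Q' g) \<le> c * norm (diag_lift P Q z - diag_lift P' Q' z)"
proof -
  define \<alpha> where "\<alpha> k l = ((column k P \<bullet> column l P' + column k Q \<bullet> column l Q') / 2)\<^sup>2" for k l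
  define \<beta> where "\<beta> k l = ((column k P \<bullet> column l P' - column k Q \<bullet> column l Q') / 2)\<^sup>2" for k l
  note expand = diag_lift_dist_square[OF P, folded \<alpha>_def \<beta>_def]
  have nonneg: "0 \<le> \<alpha> k l" "0 \<le> \<beta> k l" for k l by (auto simp: \<alpha>_def \<beta>_def)
  have sumsq: "\<alpha> k l + \<beta> k l = (column k P \<bullet> column l P')\<^sup>2 / 2 + (column k Q \<bullet> column l Q')\<^sup>2 / 2" for k l
    by (simp add: \<alpha>_def \<beta>_def power2_eq_square field_simps)
  have row: "0 \<le> 1 - (\<Sum>l\<in>UNIV. \<alpha> k l + \<beta> k l)" for k
    using Bessel_column_column(1)[OF P(1,3), of k] Bessel_column_column(1)[OF P(2,4), of k]
    unfolding sumsq by (simp add: sum.distrib flip: sum_divide_distrib)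
  have col: "0 \<le> 1 - (\<Sum>k\<in>UNIV. \<alpha> k l + \<beta> k l)" for l
    using Bessel_column_column(2)[OF P(1,3), of l] Bessel_column_column(2)[OF P(2,4), of l]
    unfolding sumsq by (simp add: sum.distrib flip: sum_divide_distrib)
  have sq: "x\<^sup>2 \<le> c\<^sup>2 * y\<^sup>2" if "\<bar>x\<bar> \<le> c * \<bar>y\<bar>" for x y :: real
    using power_mono[OF that, of 2] by (simp add: power_mult_distrib)
  \<comment> \<open>The bound for a single entry is the condition on sums with equal
    indices.\<close>
  have d: "(g $ i - g $ j)\<^sup>2 \<le> c\<^sup>2 * (z $ i - z $ j)\<^sup>2" "(g $ i + g $ j)\<^sup>2 \<le> c\<^sup>2 * (z $ i + z $ j)\<^sup>2"
    "(g $ i)\<^sup>2 \<le> c\<^sup>2 * (z $ i)\<^sup>2" for i j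
    using sq[OF c(2)] sq[OF c(3)] sq[OF c(3)[of i i]] by (auto simp: power2_eq_square)
  have "(norm (diag_lift P Q g - diag_lift P' Q' g))\<^sup>2 \<le>
      (\<Sum>k\<in>UNIV. \<Sum>l\<in>UNIV. \<alpha> k l * (c\<^sup>2 * (z $ k - z $ l)\<^sup>2) + \<beta> k l * (c\<^sup>2 * (z $ k + z $ l)\<^sup>2)) +
      (\<Sum>k\<in>UNIV. (c\<^sup>2 * (z $ k)\<^sup>2) * (1 - (\<Sum>l\<in>UNIV. \<alpha> k l + \<beta> k l))) +
      (\<Sum>l\<in>UNIV. (c\<^sup>2 * (z $ l)\<^sup>2) * (1 - (\<Sum>k\<in>UNIV. \<alpha> k l + \<beta> k l)))"
    unfolding expand
    by (intro add_mono sum_mono mult_left_mono mult_right_mono d nonneg row col)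
  also have "\<dots> = c\<^sup>2 * (norm (diag_lift P Q z - diag_lift P' Q' z))\<^sup>2"
    unfolding expand distrib_left sum_distrib_left by (simp only: mult.left_commute[of _ "c\<^sup>2"] mult.assoc)
  also have "\<dots> = (c * norm (diag_lift P Q z - diag_lift P' Q' z))\<^sup>2"
    by (simp add: power_mult_distrib)
  finally show ?thesis
    by (rule power2_le_imp_le) (use c in auto)
qed

text \<open>The loss in the trace inequality is of second order in \<open>W - Z\<close>. Using that
  inequality again with the two factor pairs exchanged bounds the loss by
  \<open>(?G' - ?G) \<bullet> (W - Z)\<close>, where both factors are of first order.\<close>

lemma svd_inner_error:
  assumes Z: "is_svd Z P z Q" and W: "is_svd W P' w Q'"
    and g: "sorted_vec g" and c: "0 \<le> c" "\<And>i j. \<bar>g $ i - g $ j\<bar> \<le> c * \<bar>z $ i - z $ j\<bar>" "\<And>i. g $ i \<le> c * z $ i"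
  shows "0 \<le> g \<bullet> w - diag_lift P Q g \<bullet> W" "g \<bullet> w - diag_lift P Q g \<bullet> W \<le> 2 * c * (norm (W - Z))\<^sup>2"
proof -
  let ?G = "diag_lift P Q g" and ?G' = "diag_lift P' Q' g" and ?Z' = "diag_lift P' Q' z"
  have P: "transpose P ** P = mat 1" "transpose Q ** Q = mat 1" "sorted_vec z" "Z = diag_lift P Q z"
    and P': "transpose P' ** P' = mat 1" "transpose Q' ** Q' = mat 1" "sorted_vec w" "W = diag_lift P' Q' w"
    using Z W by (auto simp: is_svd_iff)
  show "0 \<le> g \<bullet> w - ?G \<bullet> W"
    using von_Neumann_trace[OF P(1,2) P'(1,2) g P'(3)] by (simp add: P'(4))
  have "?G' \<bullet> Z \<le> ?G \<bullet> Z"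
    using von_Neumann_trace[OF P'(1,2) P(1,2) g P(3)] by (simp add: P(4) inner_diag_lift_diag_lift[OF P(1,2)])
  then have "g \<bullet> w - ?G \<bullet> W \<le> (?G' - ?G) \<bullet> (W - Z)"
    by (simp add: P'(4) inner_diag_lift_diag_lift[OF P'(1,2)] inner_diff_left inner_diff_right)
  also have "\<dots> \<le> norm (?G' - ?G) * norm (W - Z)" by (rule norm_cauchy_schwarz)
  also have "\<dots> \<le> (c * (2 * norm (W - Z))) * norm (W - Z)"
  proof (rule mult_right_mono)
    have "norm (?G' - ?G) \<le> c * norm (?Z' - Z)" unfolding P(4)
    proof (rule diag_lift_Lipschitz[OF P'(1,2) P(1,2) c(1,2)])
      fix i j
      have "\<bar>g $ i + g $ j\<bar> = g $ i + g $ j" "\<bar>z $ i + z $ j\<bar> = z $ i + z $ j"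
        using g P(3) by (auto simp: sorted_vec_def)
      then show "\<bar>g $ i + g $ j\<bar> \<le> c * \<bar>z $ i + z $ j\<bar>"
        using c(3)[of i] c(3)[of j] by (simp add: algebra_simps)
    qed
    \<comment> \<open>\<open>?Z'\<close> has the singular values of \<open>Z\<close> and the factors
      of \<open>W\<close>. Passing through \<open>W\<close> costs \<open>norm (W - Z)\<close> twice,
      hence the constant 2.\<close>
    also have "norm (?Z' - Z) \<le> norm (?Z' - W) + norm (W - Z)"
      using norm_triangle_ineq[of "?Z' - W" "W - Z"] by simp
    also have "norm (?Z' - W) = norm (w - z)"
      by (simp add: P'(4) norm_minus_commute norm_diag_lift[OF P'(1,2)] flip: diag_lift_diff)
    also have "\<dots> \<le> norm (W - Z)" by (rule svd_dist_le[OF Z W])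
    finally show "norm (?G' - ?G) \<le> c * (2 * norm (W - Z))" using c(1) by (simp add: mult_left_mono)
  qed simp
  finally show "g \<bullet> w - ?G \<bullet> W \<le> 2 * c * (norm (W - Z))\<^sup>2" by (simp add: power2_eq_square)
qed

lemma GDERIV_unique: "GDERIV f x :> g \<Longrightarrow> GDERIV f x :> g' \<Longrightarrow> g = g'"
  unfolding gderiv_def by (metis has_derivative_unique vector_eq_ldot)

lemma gradient_eqI: "GDERIV f x :> g \<Longrightarrow> gradient f x = g"
  unfolding gradient_def by (rule the_equality) (auto intro: GDERIV_unique)

text \<open>Chain rule: a signed permutation is orthogonal, so its adjoint is its inverse and the
  gradient is equivariant.\<close>

lemma abs_symmetric_GDERIV:
  assumes f: "abs_symmetric f" and e: "(\<pi>, e) \<in> signed_perms"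
    and g: "GDERIV f z :> g" and g': "GDERIV f (signed_perm \<pi> e z) :> g'"
  shows "g' = signed_perm \<pi> e g"
proof -
  obtain \<rho> d where d: "(\<rho>, d) \<in> signed_perms" "\<And>x. signed_perm \<rho> d (signed_perm \<pi> e x) = x"
     "\<And>x. signed_perm \<pi> e (signed_perm \<rho> d x) = x"
    using exists_inverse_signed_perm[OF e] by blast
  have "linear (signed_perm \<pi> e)"
    by (rule linearI) (auto simp: signed_perm_def vec_eq_iff algebra_simps)
  then have "(signed_perm \<pi> e has_derivative signed_perm \<pi> e) (at z)"
    by (simp add: bounded_linear_imp_has_derivative linear_conv_bounded_linear)
  then have "((\<lambda>x. f (signed_perm \<pi> e x)) has_derivative (\<lambda>h. signed_perm \<pi> e h \<bullet> g')) (at z)"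
    using g' unfolding gderiv_def by (rule has_derivative_compose)
  moreover have "signed_perm \<pi> e h \<bullet> g' = h \<bullet> signed_perm \<rho> d g'" for h
    using inner_signed_perm[OF d(1), of "signed_perm \<pi> e h" g'] by (simp add: d(2))
  ultimately have "GDERIV f z :> signed_perm \<rho> d g'"
    using abs_symmetricD[OF f e] by (simp add: gderiv_def)
  with g show ?thesis using GDERIV_unique d(3) by metis
qed

text \<open>A transposition or a sign change that fixes \<open>z\<close> must fix the gradient. This
  removes the zero denominators from the ratios bounded next.\<close>

lemma abs_symmetric_gradient_block:
  assumes f: "abs_symmetric f" and g: "GDERIV f z :> g"
  shows "z $ i = z $ j \<Longrightarrow> g $ i = g $ j" "z $ i = 0 \<Longrightarrow> g $ i = 0"
proof -
  assume ij: "z $ i = z $ j"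
  have e: "(Transposition.transpose i j, \<lambda>_. 1) \<in> signed_perms" by (simp add: signed_perms_def)
  have "signed_perm (Transposition.transpose i j) (\<lambda>_. 1) z = z"
    using ij by (auto simp: signed_perm_def vec_eq_iff Transposition.transpose_def)
  with abs_symmetric_GDERIV[OF f e g, of g] g
  have "g = signed_perm (Transposition.transpose i j) (\<lambda>_. 1) g" by simp
  then have "g $ i = signed_perm (Transposition.transpose i j) (\<lambda>_. 1) g $ i" by simp
  then show "g $ i = g $ j" by (simp add: signed_perm_def)
next
  assume i: "z $ i = 0"
  have e: "(id, \<lambda>k. if k = i then - 1 else 1) \<in> signed_perms" by (simp add: signed_perms_def)
  have "signed_perm id (\<lambda>k. if k = i then - 1 else 1) z = z"
    using i by (auto simp: signed_perm_def vec_eq_iff)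
  with abs_symmetric_GDERIV[OF f e g, of g] g
  have "g = signed_perm id (\<lambda>k. if k = i then - 1 else 1) g" by simp
  then have "g $ i = signed_perm id (\<lambda>k. if k = i then - 1 else 1) g $ i" by simp
  then show "g $ i = 0" by (simp add: signed_perm_def)
qed

lemma ratio_bound_exists:
  fixes g z :: "real^'r"
  assumes "\<And>i j. z $ i = z $ j \<Longrightarrow> g $ i = g $ j" "\<And>i. z $ i = 0 \<Longrightarrow> g $ i = 0"
  shows "\<exists>c\<ge>0. (\<forall>i j. \<bar>g $ i - g $ j\<bar> \<le> c * \<bar>z $ i - z $ j\<bar>) \<and> (\<forall>i. \<bar>g $ i\<bar> \<le> c * \<bar>z $ i\<bar>)"
proof -
  \<comment> \<open>There are finitely many ratios, so their sum dominates each of them; those with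
    denominator 0 count as 0 by the convention for division.\<close>
  define a where "a p = \<bar>g $ fst p - g $ snd p\<bar> / \<bar>z $ fst p - z $ snd p\<bar>" for p
  define b where "b i = \<bar>g $ i\<bar> / \<bar>z $ i\<bar>" for i
  define c where "c = sum a UNIV + sum b UNIV"
  have nn: "0 \<le> sum a UNIV" "0 \<le> sum b UNIV" by (auto simp: a_def b_def intro!: sum_nonneg)
  have "a p \<le> sum a UNIV" "b i \<le> sum b UNIV" for p i
    by (auto simp: a_def b_def intro!: member_le_sum)
  then have ab: "a p \<le> c" "b i \<le> c" for p i
    using nn unfolding c_def by (smt (verit))+
  have "\<bar>g $ i - g $ j\<bar> \<le> c * \<bar>z $ i - z $ j\<bar>" for i j
    using ab(1)[of "(i, j)"] assms(1)[of i j] by (cases "z $ i = z $ j") (auto simp: a_def divide_simps)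
  moreover have "\<bar>g $ i\<bar> \<le> c * \<bar>z $ i\<bar>" for i
    using ab(2)[of i] assms(2)[of i] by (cases "z $ i = 0") (auto simp: b_def divide_simps)
  moreover have "0 \<le> c" using nn by (simp add: c_def)
  ultimately show ?thesis by blast
qed

text \<open>Both \<open>g + c *\<^sub>R z\<close> and \<open>z\<close> are sorted for large \<open>c\<close>, so the error estimate for sorted vectors
  applies to their difference.\<close>

lemma GDERIV_spectral_svd:
  fixes Z :: "real^'n^'m" and P :: "real^('r::{finite,linorder})^'m" and Q :: "real^('r::{finite,linorder})^'n"
  assumes r: "CARD('r) = min CARD('m) CARD('n)"
    and f: "abs_symmetric f" and Z: "is_svd Z P z Q" and g: "GDERIV f z :> g"
  shows "GDERIV (\<lambda>U. f (sing_vals U)) Z :> diag_lift P Q g"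
proof -
  obtain c where c: "0 \<le> c" "\<And>i j. \<bar>g $ i - g $ j\<bar> \<le> c * \<bar>z $ i - z $ j\<bar>" "\<And>i. \<bar>g $ i\<bar> \<le> c * \<bar>z $ i\<bar>"
    using ratio_bound_exists[of z g] abs_symmetric_gradient_block[OF f g] by metis
  have z: "sorted_vec z" using Z by (simp add: is_svd_iff)
  define k where "k = g + c *\<^sub>R z"
  have kz: "\<bar>k $ i - k $ j\<bar> \<le> 2 * c * \<bar>z $ i - z $ j\<bar>" "k $ i \<le> 2 * c * z $ i" for i j
  proof -
    have "k $ i - k $ j = (g $ i - g $ j) + c * (z $ i - z $ j)" by (simp add: k_def algebra_simps)
    then show "\<bar>k $ i - k $ j\<bar> \<le> 2 * c * \<bar>z $ i - z $ j\<bar>"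
      using c(2)[of i j] abs_triangle_ineq[of "g $ i - g $ j" "c * (z $ i - z $ j)"] c(1)
      by (simp add: abs_mult)
    show "k $ i \<le> 2 * c * z $ i" using c(3)[of i] z by (auto simp: k_def sorted_vec_def)
  qed
  have ks: "sorted_vec k" unfolding sorted_vec_def
  proof (intro conjI allI impI)
    fix i show "0 \<le> k $ i" using c(3)[of i] z by (auto simp: k_def sorted_vec_def abs_le_iff)
  next
    fix i j :: 'r assume "i \<le> j"
    then have "\<bar>z $ i - z $ j\<bar> = z $ i - z $ j" using z by (auto simp: sorted_vec_def)
    then show "k $ j \<le> k $ i" using c(2)[of i j] by (simp add: k_def abs_le_iff algebra_simps)
  qed
  \<comment> \<open>The matrix remainder is the vector remainder plus
    \<open>g \<bullet> w - diag_lift P Q g \<bullet> W\<close>. The latter is the loss for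
    \<open>k\<close>, between 0 and \<open>4 * c\<close> times the squared distance, minus
    \<open>c\<close> times the loss for \<open>z\<close>, between 0 and \<open>2 * c\<close> times
    it.\<close>
  have key: "\<bar>f (sing_vals W) - f (sing_vals Z) - (W - Z) \<bullet> diag_lift P Q g\<bar>
     \<le> \<bar>f w - f z - (w - z) \<bullet> g\<bar> + 4 * c * (norm (W - Z))\<^sup>2 \<and> norm (w - z) \<le> norm (W - Z)"
    if "is_svd W P' w Q'" for W P' w Q'
  proof -
    have 1: "0 \<le> k \<bullet> w - diag_lift P Q k \<bullet> W" "k \<bullet> w - diag_lift P Q k \<bullet> W \<le> 4 * c * (norm (W - Z))\<^sup>2"
      using svd_inner_error[OF Z that ks, of "2 * c"] kz c(1) by auto
    have 2: "0 \<le> z \<bullet> w - diag_lift P Q z \<bullet> W" "z \<bullet> w - diag_lift P Q z \<bullet> W \<le> 2 * 1 * (norm (W - Z))\<^sup>2"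
      using svd_inner_error[OF Z that z, of 1] by auto
    have "g \<bullet> w - diag_lift P Q g \<bullet> W = (k \<bullet> w - diag_lift P Q k \<bullet> W) - c * (z \<bullet> w - diag_lift P Q z \<bullet> W)"
      by (simp add: k_def diag_lift_add diag_lift_scaleR inner_add_left algebra_simps)
    moreover have "0 \<le> c * (z \<bullet> w - diag_lift P Q z \<bullet> W)" using c(1) 2(1) by simp
    moreover have "c * (z \<bullet> w - diag_lift P Q z \<bullet> W) \<le> c * (2 * 1 * (norm (W - Z))\<^sup>2)"
      using c(1) 2(2) by (intro mult_left_mono)
    moreover have "0 \<le> c * (norm (W - Z))\<^sup>2" using c(1) by simp
    ultimately have "\<bar>g \<bullet> w - diag_lift P Q g \<bullet> W\<bar> \<le> 4 * c * (norm (W - Z))\<^sup>2"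
      using 1 by (simp add: abs_le_iff)
    moreover have "g \<bullet> z = diag_lift P Q g \<bullet> Z"
      using Z by (auto simp: is_svd_iff inner_diag_lift_diag_lift)
    then have "f w - f z - (W - Z) \<bullet> diag_lift P Q g =
        (f w - f z - (w - z) \<bullet> g) + (g \<bullet> w - diag_lift P Q g \<bullet> W)"
      by (simp add: inner_diff_left inner_diff_right inner_commute[of _ g] inner_commute[of _ "diag_lift P Q g"])
    ultimately show ?thesis
      using svd_dist_le[OF Z that] sing_vals_svd[OF that] sing_vals_svd[OF Z] by auto
  qed
  show ?thesis
    unfolding gderiv_def has_derivative_at_alt
  proof (intro conjI allI impI)
    show "bounded_linear (\<lambda>h. h \<bullet> diag_lift P Q g)" by (rule bounded_linear_inner_left)
    fix e :: real assume e: "0 < e"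
    then obtain d where d: "0 < d" "\<And>w. norm (w - z) < d \<Longrightarrow> \<bar>f w - f z - (w - z) \<bullet> g\<bar> \<le> e / 2 * norm (w - z)"
      using g unfolding gderiv_def has_derivative_at_alt by (metis half_gt_zero real_norm_def)
    \<comment> \<open>Chosen so that \<open>4 * c * norm (W - Z) \<le> e / 2\<close>; the added 1
      keeps the denominator positive when \<open>c = 0\<close>.\<close>
    define d' where "d' = min d (e / (8 * c + 1))"
    have "0 < d'" using d e c(1) by (simp add: d'_def)
    moreover have "norm (f (sing_vals W) - f (sing_vals Z) - (W - Z) \<bullet> diag_lift P Q g) \<le> e * norm (W - Z)"
      if W: "norm (W - Z) < d'" for W
    proof -
      obtain P' w Q' where w: "is_svd W P' (w :: real^('r::{finite,linorder})) Q'" using svd_exists[OF r] by blast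
      note k = key[OF w]
      have "\<bar>f w - f z - (w - z) \<bullet> g\<bar> \<le> e / 2 * norm (w - z)"
        using k W by (intro d) (auto simp: d'_def)
      also have "\<dots> \<le> e / 2 * norm (W - Z)" using k e by (intro mult_left_mono) auto
      finally have 1: "\<bar>f w - f z - (w - z) \<bullet> g\<bar> \<le> e / 2 * norm (W - Z)" .
      have "norm (W - Z) * (8 * c + 1) \<le> e"
        using W c(1) by (simp add: d'_def pos_less_divide_eq less_imp_le)
      moreover have "norm (W - Z) * (8 * c) \<le> norm (W - Z) * (8 * c + 1)" by (intro mult_left_mono) auto
      ultimately have "norm (W - Z) * (8 * c) \<le> e" by (rule order_trans[rotated])
      then have "4 * c * norm (W - Z) \<le> e / 2" by (simp add: algebra_simps)
      then have "4 * c * norm (W - Z) * norm (W - Z) \<le> e / 2 * norm (W - Z)"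
        by (rule mult_right_mono) simp
      then have 2: "4 * c * (norm (W - Z))\<^sup>2 \<le> e / 2 * norm (W - Z)"
        by (simp only: power2_eq_square mult.assoc)
      have "e * norm (W - Z) = e / 2 * norm (W - Z) + e / 2 * norm (W - Z)" by simp
      then show ?thesis using k 1 2 unfolding real_norm_def by linarith
    qed
    ultimately show "\<exists>d>0. \<forall>W. norm (W - Z) < d \<longrightarrow>
       norm (f (sing_vals W) - f (sing_vals Z) - (W - Z) \<bullet> diag_lift P Q g) \<le> e * norm (W - Z)"
      by blast
  qed
qed

text \<open>A signed permutation passes to an honest singular value decomposition; equivariance of
  the gradient makes the formula independent of this change. The symmetric set \<open>D\<close>
  supplies a gradient at the permuted point.\<close>

theorem GDERIV_spectral:
  fixes P :: "real^('r::{finite,linorder})^'m" and Q :: "real^('r::{finite,linorder})^'n"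
  assumes r: "CARD('r) = min CARD('m) CARD('n)"
    and P: "transpose P ** P = mat 1" "transpose Q ** Q = mat 1"
    and f: "abs_symmetric f" and D: "abs_symmetric (\<lambda>x. x \<in> D)" "z \<in> D" "\<And>x. x \<in> D \<Longrightarrow> \<exists>g. GDERIV f x :> g"
    and g: "GDERIV f z :> g"
  shows "GDERIV (\<lambda>U. f (sing_vals U)) (diag_lift P Q z) :> diag_lift P Q g"
proof -
  obtain \<pi> e P' Q' where e: "(\<pi>, e) \<in> signed_perms" 
    and svd: "is_svd (diag_lift P Q z) P' (signed_perm \<pi> e z) Q'"
    and eq: "\<And>w. diag_lift P Q w = diag_lift P' Q' (signed_perm \<pi> e w)"
    using diag_lift_svd[OF P, of z] by metis
  have "signed_perm \<pi> e z \<in> D" using D abs_symmetricD[OF D(1) e] by simp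
  then obtain g' where g': "GDERIV f (signed_perm \<pi> e z) :> g'" using D(3) by blast
  then have "g' = signed_perm \<pi> e g" by (rule abs_symmetric_GDERIV[OF f e g])
  with GDERIV_spectral_svd[OF r f svd g'] eq show ?thesis by simp
qed

section \<open>Minimisation of strongly convex functions\<close>

lemma Conv_bar_ereal:
  assumes "h \<in> Conv_bar D"
  shows "x \<in> D \<Longrightarrow> h x = ereal (real_of_ereal (h x))" "x \<notin> D \<Longrightarrow> h x = \<infinity>"
  using assms by (auto simp: Conv_bar_def ereal_real)

lemma Conv_bar_cmult:
  assumes h: "h \<in> Conv_bar D" and \<alpha>: "0 < \<alpha>"
  shows "(\<lambda>u. ereal \<alpha> * h u) \<in> Conv_bar D"
proof -
  have "ereal \<alpha> * h x \<le> Liminf (at x) (\<lambda>u. ereal \<alpha> * h u)" for x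
    unfolding le_Liminf_iff
  proof (intro allI impI)
    fix c assume c: "c < ereal \<alpha> * h x"
    have eq: "ereal \<alpha> * v > c \<longleftrightarrow> v > c / ereal \<alpha>" for v
      using \<alpha> by (cases c; cases v) (auto simp: field_simps)
    have "c / ereal \<alpha> < Liminf (at x) h"
      using c h by (auto simp: eq Conv_bar_def intro: less_le_trans)
    then show "\<forall>\<^sub>F u in at x. c < ereal \<alpha> * h u"
      using less_LiminfD unfolding eq by blast
  qed
  moreover have "convex_on D (\<lambda>u. \<alpha> * real_of_ereal (h u))"
    using h \<alpha> by (intro convex_on_cmul) (auto simp: Conv_bar_def)
  ultimately show ?thesis using h \<alpha> by (auto simp: Conv_bar_def)
qed

text \<open>Lower semicontinuity in sequential form. It delivers membership of the limit in
  \<open>D\<close> as well, so \<open>D\<close> need not be closed for limits of minimising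
  sequences to stay in it.\<close>

lemma Conv_bar_closed_epigraph:
  assumes h: "h \<in> Conv_bar D" and u: "\<And>n. u n \<in> D" "u \<longlonglongrightarrow> x"
    and t: "\<And>n. real_of_ereal (h (u n)) \<le> t n" "t \<longlonglongrightarrow> \<tau>"
  shows "x \<in> D \<and> real_of_ereal (h x) \<le> \<tau>"
proof -
  have "h x \<le> ereal \<tau>"
  proof (rule ccontr)
    assume "\<not> h x \<le> ereal \<tau>"
    then obtain c where c: "\<tau> < c" "ereal c < h x" using ereal_dense2[of "ereal \<tau>" "h x"] by (auto simp: not_le)
    then have "ereal c < Liminf (at x) h" using h by (auto simp: Conv_bar_def intro: less_le_trans)
    then have "\<forall>\<^sub>F y in at x. ereal c < h y" by (rule less_LiminfD)
    \<comment> \<open>The filter \<open>at x\<close> omits \<open>x\<close>, which the sequence may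
      hit; \<open>ereal c < h x\<close> fills the gap.\<close>
    then have "\<forall>\<^sub>F y in nhds x. ereal c < h y"
      unfolding eventually_at_filter by (rule eventually_mono) (use c(2) in auto)
    then have "\<forall>\<^sub>F n in sequentially. ereal c < h (u n)"
      using u(2) by (rule eventually_compose_filterlim)
    moreover have "\<forall>\<^sub>F n in sequentially. t n < c" using t(2) c(1) by (rule order_tendstoD)
    ultimately have "\<forall>\<^sub>F n in sequentially. False"
    proof eventually_elim
      case (elim n)
      then show ?case using t(1)[of n] Conv_bar_ereal(1)[OF h u(1), of n]
        by (metis less_ereal.simps(1) not_less order_less_trans)
    qed
    then show False by simp
  qed
  moreover from this have "x \<in> D" using Conv_bar_ereal(2)[OF h, of x] by (cases "x \<in> D") auto
  ultimately show ?thesis using Conv_bar_ereal(1)[OF h, of x] by (metis ereal_less_eq(3))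
qed

lemma Conv_bar_bounded_below_cball:
  assumes h: "h \<in> Conv_bar D"
  shows "\<exists>m. \<forall>u\<in>D \<inter> cball a r. m \<le> real_of_ereal (h u)"
proof (rule ccontr)
  assume "\<not> ?thesis"
  then have "\<forall>n::nat. \<exists>u\<in>D \<inter> cball a r. real_of_ereal (h u) < - real n" by (meson not_le)
  then obtain u where u: "\<And>n::nat. u n \<in> D" "\<And>n. u n \<in> cball a r" "\<And>n. real_of_ereal (h (u n)) < - real n"
    by (metis IntE)
  have "bounded (range u)" by (rule bounded_subset[OF bounded_cball]) (use u(2) in blast)
  then obtain l r where r: "strict_mono (r :: nat \<Rightarrow> nat)" "(u \<circ> r) \<longlonglongrightarrow> l"
    using bounded_imp_convergent_subsequence by blast
  \<comment> \<open>From index \<open>N\<close> on the values are below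
    \<open>real_of_ereal (h l) - 1\<close>, which the closed epigraph forbids at the limit
    \<open>l\<close>.\<close>
  define N where "N = nat \<lceil>1 - real_of_ereal (h l)\<rceil>"
  have "(\<lambda>n. u (r (n + N))) \<longlonglongrightarrow> l" using LIMSEQ_ignore_initial_segment[OF r(2), of N] by (simp add: o_def)
  moreover have "real_of_ereal (h (u (r (n + N)))) \<le> real_of_ereal (h l) - 1" for n
  proof -
    have "real (n + N) \<le> real (r (n + N))" using seq_suble[OF r(1)] by (simp only: of_nat_le_iff)
    then show ?thesis using u(3)[of "r (n + N)"] by (simp add: N_def) linarith
  qed
  ultimately have "real_of_ereal (h l) \<le> real_of_ereal (h l) - 1"
    using Conv_bar_closed_epigraph[OF h, of "\<lambda>n. u (r (n + N))" l "\<lambda>_. real_of_ereal (h l) - 1"] u(1) by auto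
  then show False by simp
qed

text \<open>Convexity extends the bound on the unit ball around \<open>a\<close> along rays: the
  point \<open>v\<close> at distance 1 on the segment from \<open>a\<close> to \<open>u\<close> has
  value at least \<open>m\<close>, and \<open>H u\<close> is then bounded below linearly in the
  distance. This plays the role of an affine minorant.\<close>

lemma Conv_bar_linear_lower_bound:
  assumes h: "h \<in> Conv_bar D" and a: "a \<in> D"
  shows "\<exists>C\<ge>0. \<forall>u\<in>D. - C * (1 + norm (u - a)) \<le> real_of_ereal (h u)"
proof -
  define H where "H u = real_of_ereal (h u)" for u
  obtain m where m: "\<And>u. u \<in> D \<Longrightarrow> u \<in> cball a 1 \<Longrightarrow> m \<le> H u"
    using Conv_bar_bounded_below_cball[OF h, of a 1] unfolding H_def by (meson IntI)
  have conv: "convex_on D H" using h unfolding H_def by (simp add: Conv_bar_def)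
  define C where "C = \<bar>m\<bar> + \<bar>H a\<bar>"
  have "- C * (1 + norm (u - a)) \<le> H u" if u: "u \<in> D" for u
  proof (cases "norm (u - a) \<le> 1")
    case True
    then have "m \<le> H u" using m[OF u] by (simp add: dist_norm norm_minus_commute)
    moreover have "- C * (1 + norm (u - a)) \<le> - C * 1" by (intro mult_left_mono_neg) (auto simp: C_def)
    ultimately show ?thesis by (simp add: C_def)
  next
    case False
    define n where "n = norm (u - a)"
    define t where "t = 1 / n"
    have n: "1 < n" using False by (simp add: n_def)
    then have t: "0 \<le> t" "t \<le> 1" by (simp_all add: t_def)
    define v where "v = (1 - t) *\<^sub>R a + t *\<^sub>R u"
    have "v - a = t *\<^sub>R (u - a)" by (simp add: v_def algebra_simps)
    then have "norm (v - a) = 1" using n by (auto simp: t_def n_def)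
    then have "v \<in> cball a 1" by (simp add: dist_norm norm_minus_commute)
    moreover have "v \<in> D" using conv a u t by (simp add: convex_on_def v_def convexD)
    ultimately have "m \<le> H v" using m by blast
    also have "H v \<le> (1 - t) * H a + t * H u"
      using convex_onD[OF conv t a u] by (simp add: v_def)
    finally have "n * m \<le> n * ((1 - t) * H a + t * H u)" using n by (intro mult_left_mono) auto
    also have "\<dots> = (n - 1) * H a + H u" using n by (simp add: t_def field_simps)
    finally have "n * m - (n - 1) * H a \<le> H u" by simp
    moreover have "- (n * \<bar>m\<bar>) \<le> n * m" using n by (simp add: abs_if)
    moreover have "(n - 1) * H a \<le> n * \<bar>H a\<bar>"
    proof -
      have "(n - 1) * H a \<le> (n - 1) * \<bar>H a\<bar>" using n by (intro mult_left_mono) auto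
      also have "\<dots> \<le> n * \<bar>H a\<bar>" by (intro mult_right_mono) auto
      finally show ?thesis .
    qed
    ultimately have "- C * n \<le> H u" by (simp add: C_def algebra_simps)
    moreover have "0 \<le> C" by (simp add: C_def)
    ultimately show ?thesis by (simp add: n_def algebra_simps)
  qed
  moreover have "0 \<le> C" by (simp add: C_def)
  ultimately show ?thesis unfolding H_def by blast
qed

section \<open>Minimisers of prox objectives: existence, uniqueness, growth\<close>

text \<open>Common shape of the prox step and of the refined point problem. Outside \<open>D\<close>
  the value uses \<open>real_of_ereal \<infinity> = 0\<close> and means nothing; minimality is
  asserted over \<open>D\<close> only.\<close>

definition prox_objective :: "('a::euclidean_space \<Rightarrow> ereal) \<Rightarrow> real \<Rightarrow> 'a \<Rightarrow> 'a \<Rightarrow> real \<Rightarrow> 'a \<Rightarrow> real" where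
  "prox_objective h c b w \<kappa> u = real_of_ereal (h u) + c + b \<bullet> (u - w) + \<kappa> / 2 * (norm (u - w))\<^sup>2"

lemma prox_objective_coercive:
  assumes h: "h \<in> Conv_bar D" and \<kappa>: "0 < \<kappa>"
  shows "\<exists>K1 K2. 0 \<le> K1 \<and> 0 \<le> K2 \<and>
     (\<forall>u\<in>D. \<kappa> / 2 * (norm (u - w))\<^sup>2 - K1 * norm (u - w) - K2 \<le> prox_objective h c b w \<kappa> u)"
proof -
  obtain a where a: "a \<in> D" using h by (auto simp: Conv_bar_def)
  obtain C where C: "0 \<le> C" "\<And>u. u \<in> D \<Longrightarrow> - C * (1 + norm (u - a)) \<le> real_of_ereal (h u)"
    using Conv_bar_linear_lower_bound[OF h a] by blast
  define K1 where "K1 = C + norm b"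
  define K2 where "K2 = C * (1 + norm (w - a)) + \<bar>c\<bar>"
  have "\<kappa> / 2 * (norm (u - w))\<^sup>2 - K1 * norm (u - w) - K2 \<le> prox_objective h c b w \<kappa> u" if u: "u \<in> D" for u
  proof -
    have "C * norm (u - a) \<le> C * (norm (u - w) + norm (w - a))"
      using norm_triangle_ineq[of "u - w" "w - a"] C(1) by (intro mult_left_mono) auto
    moreover have "- (norm b * norm (u - w)) \<le> b \<bullet> (u - w)"
      using Cauchy_Schwarz_ineq2[of b "u - w"] by linarith
    moreover have "- \<bar>c\<bar> \<le> c" by simp
    ultimately show ?thesis
      using C(2)[OF u] by (simp add: prox_objective_def K1_def K2_def algebra_simps)
  qed
  moreover have "0 \<le> K1" "0 \<le> K2" using C(1) by (auto simp: K1_def K2_def)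
  ultimately show ?thesis by blast
qed

text \<open>Direct method: coercivity bounds a minimising sequence, and the closed epigraph controls
  both the limit point and its value.\<close>

lemma prox_objective_attains_min:
  assumes h: "h \<in> Conv_bar D" and \<kappa>: "0 < \<kappa>"
  shows "\<exists>p\<in>D. \<forall>u\<in>D. prox_objective h c b w \<kappa> p \<le> prox_objective h c b w \<kappa> u"
proof -
  let ?F = "prox_objective h c b w \<kappa>"
  obtain K1 K2 where K: "0 \<le> K1" "0 \<le> K2"
     "\<And>u. u \<in> D \<Longrightarrow> \<kappa> / 2 * (norm (u - w))\<^sup>2 - K1 * norm (u - w) - K2 \<le> ?F u"
    using prox_objective_coercive[OF h \<kappa>] by metis
  have "- (K1\<^sup>2 / (2 * \<kappa>)) - K2 \<le> ?F u" if "u \<in> D" for u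
  proof -
    have "0 \<le> (\<kappa> * norm (u - w) - K1)\<^sup>2 / (2 * \<kappa>)" using \<kappa> by simp
    also have "\<dots> = \<kappa> / 2 * (norm (u - w))\<^sup>2 - K1 * norm (u - w) + K1\<^sup>2 / (2 * \<kappa>)"
      using \<kappa> by (simp add: power2_eq_square field_simps)
    finally show ?thesis using K(3)[OF that] by linarith
  qed
  then have bdd: "bdd_below (?F ` D)" by (intro bdd_belowI2)
  have ne: "?F ` D \<noteq> {}" using h by (auto simp: Conv_bar_def)
  define m where "m = Inf (?F ` D)"
  have "\<exists>u\<in>D. ?F u < m + 1 / real (Suc n)" for n
    using cInf_lessD[OF ne, of "m + 1 / real (Suc n)"] by (auto simp: m_def)
  then obtain u where u: "\<And>n. u n \<in> D" "\<And>n. ?F (u n) < m + 1 / real (Suc n)" by metis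
  have "norm (u n - w) \<le> 1 + 2 * (K1 + K2 + \<bar>m\<bar> + 1) / \<kappa>" for n
  proof (cases "norm (u n - w) \<le> 1")
    case True
    moreover have "0 \<le> 2 * (K1 + K2 + \<bar>m\<bar> + 1) / \<kappa>" using K \<kappa> by simp
    ultimately show ?thesis by linarith
  next
    case False
    let ?n = "norm (u n - w)"
    have "1 / real (Suc n) \<le> 1" by simp
    then have "\<kappa> / 2 * ?n\<^sup>2 \<le> K1 * ?n + (K2 + \<bar>m\<bar> + 1)" using K(3)[OF u(1), of n] u(2)[of n] by linarith
    also have "(K2 + \<bar>m\<bar> + 1) \<le> (K2 + \<bar>m\<bar> + 1) * ?n"
      using False K(2) mult_left_mono[of 1 ?n "K2 + \<bar>m\<bar> + 1"] by simp
    finally have "(\<kappa> / 2 * ?n) * ?n \<le> (K1 + K2 + \<bar>m\<bar> + 1) * ?n"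
      by (simp add: power2_eq_square algebra_simps)
    moreover have "0 < ?n" using False by linarith
    ultimately have "\<kappa> / 2 * ?n \<le> K1 + K2 + \<bar>m\<bar> + 1" by (rule mult_right_le_imp_le)
    then have "?n \<le> 2 * (K1 + K2 + \<bar>m\<bar> + 1) / \<kappa>" using \<kappa> by (simp add: field_simps)
    then show ?thesis by simp
  qed
  then have "bounded (range (\<lambda>n. u n - w))" by (intro boundedI) auto
  then have "bounded ((\<lambda>v. w + v) ` range (\<lambda>n. u n - w))" by (rule bounded_translation)
  then have "bounded (range u)" by (simp add: image_image)
  then obtain p r where r: "strict_mono (r :: nat \<Rightarrow> nat)" "(u \<circ> r) \<longlonglongrightarrow> p"
    using bounded_imp_convergent_subsequence by blast
  \<comment> \<open>Upper bound for \<open>h\<close> along the sequence, obtained by moving the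
    continuous terms to the other side; it converges although the values of \<open>h\<close> need
    not.\<close>
  define t where "t n = m + 1 / real (Suc (r n)) - c - b \<bullet> (u (r n) - w) - \<kappa> / 2 * (norm (u (r n) - w))\<^sup>2" for n
  have lim: "(\<lambda>n. u (r n)) \<longlonglongrightarrow> p" using r(2) by (simp add: o_def)
  have "(\<lambda>n. 1 / real (Suc (r n))) \<longlonglongrightarrow> 0"
    using LIMSEQ_subseq_LIMSEQ[OF LIMSEQ_Suc[OF lim_1_over_n] r(1)] by (simp add: o_def)
  then have "t \<longlonglongrightarrow> m + 0 - c - b \<bullet> (p - w) - \<kappa> / 2 * (norm (p - w))\<^sup>2"
    unfolding t_def by (intro tendsto_intros lim)
  moreover have "real_of_ereal (h (u (r n))) \<le> t n" for n
    using u(2)[of "r n"] by (simp add: t_def prox_objective_def)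
  ultimately have "p \<in> D \<and> real_of_ereal (h p) \<le> m + 0 - c - b \<bullet> (p - w) - \<kappa> / 2 * (norm (p - w))\<^sup>2"
    using Conv_bar_closed_epigraph[OF h u(1) lim] by blast
  then have "p \<in> D" "?F p \<le> m" by (auto simp: prox_objective_def)
  moreover have "m \<le> ?F v" if "v \<in> D" for v unfolding m_def using bdd that by (intro cInf_lower) auto
  ultimately show ?thesis by (meson order_trans)
qed

lemma norm_diff_square_shift:
  fixes u v p :: "'a::real_inner"
  shows "(norm (u - v))\<^sup>2 = (norm (p - v))\<^sup>2 + 2 * ((p - v) \<bullet> (u - p)) + (norm (u - p))\<^sup>2"
  unfolding power2_norm_eq_inner by (simp add: inner_diff_left inner_diff_right inner_commute algebra_simps)

text \<open>Along the segment from \<open>p\<close> to \<open>u\<close> the quadratic part is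
  exactly strongly convex, so minimality gives the growth with factor \<open>1 - t\<close>; letting
  \<open>t\<close> tend to 0 restores the full constant.\<close>

lemma prox_objective_growth:
  assumes h: "h \<in> Conv_bar D" and p: "p \<in> D"
    and min: "\<And>u. u \<in> D \<Longrightarrow> prox_objective h c b w \<kappa> p \<le> prox_objective h c b w \<kappa> u" and u: "u \<in> D"
  shows "prox_objective h c b w \<kappa> p + \<kappa> / 2 * (norm (u - p))\<^sup>2 \<le> prox_objective h c b w \<kappa> u"
proof -
  let ?F = "prox_objective h c b w \<kappa>"
  define S where "S = \<kappa> / 2 * (norm (u - p))\<^sup>2"
  have conv: "convex_on D (\<lambda>u. real_of_ereal (h u))" using h by (simp add: Conv_bar_def)
  have "(1 - t) * S \<le> ?F u - ?F p" if t: "0 < t" "t < 1" for t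
  proof -
    define v where "v = (1 - t) *\<^sub>R p + t *\<^sub>R u"
    have v: "v \<in> D" using conv p u t by (simp add: convex_on_def v_def convexD)
    have "real_of_ereal (h v) \<le> (1 - t) * real_of_ereal (h p) + t * real_of_ereal (h u)"
      using convex_onD[OF conv, of t p u] t p u by (simp add: v_def)
    moreover have vw: "v - w = (p - w) + t *\<^sub>R (u - p)" "u - w = (p - w) + (u - p)"
      by (simp_all add: v_def algebra_simps)
    have "b \<bullet> (v - w) = (1 - t) * (b \<bullet> (p - w)) + t * (b \<bullet> (u - w))"
      unfolding vw inner_add_right inner_scaleR_right by (simp add: algebra_simps)
    moreover have "\<kappa> / 2 * (norm (v - w))\<^sup>2
        = (1 - t) * (\<kappa> / 2 * (norm (p - w))\<^sup>2) + t * (\<kappa> / 2 * (norm (u - w))\<^sup>2) - t * (1 - t) * S"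
      unfolding vw S_def power2_norm_eq_inner
      by (simp only: inner_add_left inner_add_right inner_scaleR_left inner_scaleR_right inner_commute[of "u - p" "p - w"])
         (simp add: field_simps)
    ultimately have "?F v \<le> (1 - t) * ?F p + t * ?F u - t * (1 - t) * S"
      by (simp add: prox_objective_def algebra_simps)
    with min[OF v] have "t * ((1 - t) * S) \<le> t * (?F u - ?F p)" by (simp add: algebra_simps)
    then show ?thesis using t by simp
  qed
  then have ev: "\<forall>\<^sub>F t in at_right 0. (1 - t) * S \<le> ?F u - ?F p"
    by (intro eventually_at_rightI[of 0 1]) auto
  have "((\<lambda>t. (1 - t) * S) \<longlongrightarrow> (1 - 0) * S) (at_right (0::real))"
    by (intro tendsto_intros)
  then have "(1 - 0) * S \<le> ?F u - ?F p"
    using ev by (rule tendsto_upperbound) simp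
  then show ?thesis by (simp add: S_def)
qed

text \<open>\<open>arg_min\<close> is a choice among minimisers, so it can be identified only
  through strict minimality.\<close>

lemma arg_min_ereal_eqI:
  fixes \<phi> :: "'a \<Rightarrow> ereal"
  assumes "\<And>u. u \<in> D \<Longrightarrow> \<phi> u = ereal (F u)" "\<And>u. u \<notin> D \<Longrightarrow> \<phi> u = \<infinity>"
    and "p \<in> D" "\<And>u. u \<in> D \<Longrightarrow> u \<noteq> p \<Longrightarrow> F p < F u"
  shows "arg_min \<phi> (\<lambda>_. True) = p"
proof -
  have less: "\<phi> p < \<phi> u" if "u \<noteq> p" for u
    using assms that by (cases "u \<in> D") auto
  have "is_arg_min \<phi> (\<lambda>_. True) u \<longleftrightarrow> u = p" for u
    using less unfolding is_arg_min_def by (metis less_irrefl less_trans)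
  then have "is_arg_min \<phi> (\<lambda>_. True) = (\<lambda>u. u = p)" by blast
  then show ?thesis unfolding arg_min_def by simp
qed

lemma arg_min_prox_objective:
  assumes h: "h \<in> Conv_bar D" and \<kappa>: "0 < \<kappa>"
    and \<phi>: "\<And>u. u \<in> D \<Longrightarrow> \<phi> u = ereal (prox_objective h c b w \<kappa> u)" "\<And>u. u \<notin> D \<Longrightarrow> \<phi> u = \<infinity>"
  defines "p \<equiv> arg_min \<phi> (\<lambda>_. True)"
  shows "p \<in> D" "u \<in> D \<Longrightarrow>
    prox_objective h c b w \<kappa> p + \<kappa> / 2 * (norm (u - p))\<^sup>2 \<le> prox_objective h c b w \<kappa> u"
proof -
  let ?F = "prox_objective h c b w \<kappa>"
  obtain p' where p': "p' \<in> D" "\<And>u. u \<in> D \<Longrightarrow> ?F p' \<le> ?F u"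
    using prox_objective_attains_min[OF h \<kappa>] by metis
  have growth: "?F p' + \<kappa> / 2 * (norm (u - p'))\<^sup>2 \<le> ?F u" if "u \<in> D" for u
    using prox_objective_growth[OF h p'(1) _ that] p'(2) by blast
  have "?F p' < ?F u" if "u \<in> D" "u \<noteq> p'" for u
  proof -
    have "0 < \<kappa> / 2 * (norm (u - p'))\<^sup>2" using that \<kappa> by simp
    then show ?thesis using growth[OF that(1)] by linarith
  qed
  then have "p = p'" unfolding p_def using \<phi> p'(1) by (intro arg_min_ereal_eqI)
  then show "p \<in> D" "u \<in> D \<Longrightarrow> ?F p + \<kappa> / 2 * (norm (u - p))\<^sup>2 \<le> ?F u"
    using p'(1) growth by auto
qed

section \<open>The accelerated gradient method on vectors\<close>

lemma descent_lemma:
  fixes f :: "'a::real_inner \<Rightarrow> real"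
  assumes G: "convex G" "\<And>x. x \<in> G \<Longrightarrow> GDERIV f x :> g x" and lip: "M-lipschitz_on G g"
    and w: "w \<in> G" and u: "u \<in> G"
  shows "f u \<le> f w + g w \<bullet> (u - w) + M / 2 * (norm (u - w))\<^sup>2"
proof -
  define d where "d = u - w"
  \<comment> \<open>Up to the constant \<open>f w\<close>, the gap between \<open>f\<close> and its
    quadratic upper model along the segment; the Lipschitz gradient makes its derivative
    nonpositive.\<close>
  define \<phi> where "\<phi> t = f (w + t *\<^sub>R d) - t * (g w \<bullet> d) - M * t\<^sup>2 / 2 * (norm d)\<^sup>2" for t
  have "\<phi> 1 \<le> \<phi> 0"
  proof (rule DERIV_nonpos_imp_nonincreasing[of 0 1 \<phi>])
    fix t :: real assume t: "0 \<le> t" "t \<le> 1"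
    have "w + t *\<^sub>R d = (1 - t) *\<^sub>R w + t *\<^sub>R u" by (simp add: d_def algebra_simps)
    then have v: "w + t *\<^sub>R d \<in> G" using G(1) w u t by (simp add: convexD)
    have "((\<lambda>t. w + t *\<^sub>R d) has_derivative (\<lambda>h. h *\<^sub>R d)) (at t)"
      by (auto intro!: derivative_eq_intros)
    then have "((\<lambda>t. f (w + t *\<^sub>R d)) has_derivative (\<lambda>h. (h *\<^sub>R d) \<bullet> g (w + t *\<^sub>R d))) (at t)"
      using G(2)[OF v] unfolding gderiv_def by (rule has_derivative_compose)
    also have "(\<lambda>h. (h *\<^sub>R d) \<bullet> g (w + t *\<^sub>R d)) = (*) (g (w + t *\<^sub>R d) \<bullet> d)"
      by (simp add: fun_eq_iff inner_commute)
    finally have f': "((\<lambda>t. f (w + t *\<^sub>R d)) has_real_derivative (g (w + t *\<^sub>R d) \<bullet> d)) (at t)"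
      by (simp add: has_field_derivative_def)
    have "(\<phi> has_real_derivative (g (w + t *\<^sub>R d) \<bullet> d - g w \<bullet> d - M * t * (norm d)\<^sup>2)) (at t)"
      unfolding \<phi>_def by (auto intro!: derivative_eq_intros f' simp: field_simps)
    moreover have "g (w + t *\<^sub>R d) \<bullet> d - g w \<bullet> d - M * t * (norm d)\<^sup>2 \<le> 0"
    proof -
      have "(g (w + t *\<^sub>R d) - g w) \<bullet> d \<le> norm (g (w + t *\<^sub>R d) - g w) * norm d" by (rule norm_cauchy_schwarz)
      also have "\<dots> \<le> (M * norm (t *\<^sub>R d)) * norm d"
        using lipschitz_onD[OF lip v w] by (intro mult_right_mono) (auto simp: dist_norm)
      finally show ?thesis using t by (simp add: inner_diff_left power2_eq_square mult.assoc)
    qed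
    ultimately show "\<exists>y. (\<phi> has_real_derivative y) (at t) \<and> y \<le> 0" by blast
  qed simp
  then show ?thesis by (simp add: \<phi>_def d_def)
qed

lemma convex_on_above_tangent:
  fixes f :: "'a::real_inner \<Rightarrow> real"
  assumes f: "convex_on G f" and g: "GDERIV f w :> g" and w: "w \<in> G" and u: "u \<in> G"
  shows "f w + g \<bullet> (u - w) \<le> f u"
proof -
  define d where "d = u - w"
  have "((\<lambda>t. w + t *\<^sub>R d) has_derivative (\<lambda>h. h *\<^sub>R d)) (at 0)"
    by (auto intro!: derivative_eq_intros)
  moreover have "(f has_derivative (\<lambda>h. h \<bullet> g)) (at (w + 0 *\<^sub>R d))" using g by (simp add: gderiv_def)
  ultimately have "((\<lambda>t. f (w + t *\<^sub>R d)) has_derivative (\<lambda>h. (h *\<^sub>R d) \<bullet> g)) (at 0)"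
    by (rule has_derivative_compose)
  also have "(\<lambda>h. (h *\<^sub>R d) \<bullet> g) = (*) (g \<bullet> d)" by (simp add: fun_eq_iff inner_commute)
  finally have "((\<lambda>t. f (w + t *\<^sub>R d)) has_real_derivative (g \<bullet> d)) (at 0)"
    by (simp add: has_field_derivative_def)
  then have "((\<lambda>t. (f (w + t *\<^sub>R d) - f w) / t) \<longlongrightarrow> g \<bullet> d) (at 0)"
    by (simp add: DERIV_def)
  then have "((\<lambda>t. (f (w + t *\<^sub>R d) - f w) / t) \<longlongrightarrow> g \<bullet> d) (at_right 0)"
    by (rule filterlim_mono) (auto simp: at_le)
  moreover have "\<forall>\<^sub>F t in at_right 0. (f (w + t *\<^sub>R d) - f w) / t \<le> f u - f w"
  proof (rule eventually_at_rightI[of 0 1])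
    fix t :: real assume t: "t \<in> {0<..<1}"
    have "w + t *\<^sub>R d = (1 - t) *\<^sub>R w + t *\<^sub>R u" by (simp add: d_def algebra_simps)
    then have "f (w + t *\<^sub>R d) \<le> (1 - t) * f w + t * f u" using convex_onD[OF f, of t w u] t w u by simp
    then show "(f (w + t *\<^sub>R d) - f w) / t \<le> f u - f w" using t by (simp add: divide_simps algebra_simps)
  qed simp
  ultimately have "g \<bullet> d \<le> f u - f w" by (rule tendsto_upperbound) simp
  then show ?thesis by (simp add: d_def)
qed

lemma norm_add_square:
  fixes p q :: "'a::real_inner"
  shows "(norm (p + q))\<^sup>2 = (norm p)\<^sup>2 + 2 * (p \<bullet> q) + (norm q)\<^sup>2"
  using norm_diff_square_shift[of "p + q" 0 p] by simp

lemma norm_square_two_point_convexity: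
  fixes p q :: "'a::real_inner"
  assumes "0 \<le> s" "0 \<le> t"
  shows "(norm (s *\<^sub>R p + t *\<^sub>R q))\<^sup>2 \<le> (s + t) * (s * (norm p)\<^sup>2 + t * (norm q)\<^sup>2)"
proof -
  have "(s + t) * (s * (norm p)\<^sup>2 + t * (norm q)\<^sup>2) - (norm (s *\<^sub>R p + t *\<^sub>R q))\<^sup>2 = s * t * (norm (p - q))\<^sup>2"
    unfolding power2_norm_eq_inner
    by (simp add: inner_add_left inner_add_right inner_diff_left inner_diff_right inner_commute[of q p] algebra_simps)
  moreover have "0 \<le> s * t * (norm (p - q))\<^sup>2" using assms by simp
  ultimately show ?thesis by linarith
qed

section \<open>Estimate sequences for the accelerated method\<close>

locale composite_sacg = sacg \<psi>\<^sub>s \<psi>\<^sub>n y\<^sub>0 \<theta> \<mu> L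
  for \<psi>\<^sub>s :: "'a::euclidean_space \<Rightarrow> real" and \<psi>\<^sub>n y\<^sub>0 \<theta> \<mu> L +
  fixes D :: "'a set"
  assumes \<psi>n: "\<psi>\<^sub>n \<in> Conv_bar D" and \<mu>: "0 \<le> \<mu>" and L: "0 < L"
begin

declare A.simps(2) [simp del] \<Gamma>.simps(2) [simp del]

definition obj :: "'a \<Rightarrow> real" where
  "obj u = \<psi>\<^sub>s u + real_of_ereal (\<psi>\<^sub>n u)"

definition real_model :: "'a \<Rightarrow> 'a \<Rightarrow> real" where
  "real_model w u = lin_approx \<psi>\<^sub>s w u + real_of_ereal (\<psi>\<^sub>n u) + \<mu> / 2 * (norm (u - w))\<^sup>2"

text \<open>Strong convexity and smoothness from a single base point \<open>w\<close>, tested on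
  \<open>D\<close>. The base point itself may lie outside \<open>D\<close>, as the points
  \<open>xt k\<close> do in general; smoothness and convexity of \<open>\<psi>\<^sub>s\<close> enter
  the analysis only in this form.\<close>

definition sandwiched :: "'a \<Rightarrow> bool" where
  "sandwiched w \<longleftrightarrow> (\<forall>u\<in>D. lin_approx \<psi>\<^sub>s w u + \<mu> / 2 * (norm (u - w))\<^sup>2 \<le> \<psi>\<^sub>s u \<and>
     \<psi>\<^sub>s u \<le> lin_approx \<psi>\<^sub>s w u + L / 2 * (norm (u - w))\<^sup>2)"

lemma \<psi>_obj: "u \<in> D \<Longrightarrow> \<psi> u = ereal (obj u)" "u \<notin> D \<Longrightarrow> \<psi> u = \<infinity>"
  using Conv_bar_ereal[OF \<psi>n, of u] by (auto simp: \<psi>_def obj_def) (metis plus_ereal.simps(1))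

lemma model_real: "u \<in> D \<Longrightarrow> model w u = ereal (real_model w u)" "u \<notin> D \<Longrightarrow> model w u = \<infinity>"
  using Conv_bar_ereal[OF \<psi>n, of u] by (auto simp: model_def real_model_def) (metis plus_ereal.simps(1))

lemma prox_step:
  shows "prox_step w \<in> D"
    and "u \<in> D \<Longrightarrow> real_model w (prox_step w) + L / 2 * (norm (prox_step w - w))\<^sup>2
      + (L + \<mu>) / 2 * (norm (u - prox_step w))\<^sup>2 \<le> real_model w u + L / 2 * (norm (u - w))\<^sup>2"
proof -
  let ?h = "\<lambda>u. ereal (1 / L) * \<psi>\<^sub>n u"
  \<comment> \<open>The method divides the model by \<open>L\<close>, hence the curvature
    \<open>(L + \<mu>) / L\<close>; identity \<open>F\<close> multiplies back.\<close>
  let ?F = "prox_objective ?h (\<psi>\<^sub>s w / L) (gradient \<psi>\<^sub>s w /\<^sub>R L) w ((L + \<mu>) / L)"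
  have h: "?h \<in> Conv_bar D" using L by (intro Conv_bar_cmult[OF \<psi>n]) simp
  have \<kappa>: "0 < (L + \<mu>) / L" using L \<mu> by simp
  have F: "L * ?F u = real_model w u + L / 2 * (norm (u - w))\<^sup>2" for u
  proof -
    have "real_of_ereal (?h u) = real_of_ereal (\<psi>\<^sub>n u) / L" using L by simp
    then show ?thesis using L
      by (simp add: prox_objective_def real_model_def lin_approx_def field_simps)
  qed
  have 1: "ereal (1 / L) * model w u + ereal (1 / 2 * (norm (u - w))\<^sup>2) = ereal (?F u)" if "u \<in> D" for u
  proof -
    have "?F u = (real_model w u + L / 2 * (norm (u - w))\<^sup>2) / L" using F[of u] L by (simp add: field_simps)
    then show ?thesis using L by (simp add: model_real that add_divide_distrib)
  qed
  have 2: "ereal (1 / L) * model w u + ereal (1 / 2 * (norm (u - w))\<^sup>2) = \<infinity>" if "u \<notin> D" for u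
    using L by (simp add: model_real that)
  note am = arg_min_prox_objective[OF h \<kappa> 1 2, folded prox_step_def]
  show "prox_step w \<in> D" using am(1) by simp
  assume "u \<in> D"
  then have "L * (?F (prox_step w) + (L + \<mu>) / L / 2 * (norm (u - prox_step w))\<^sup>2) \<le> L * ?F u"
    using am(2) L by (intro mult_left_mono) auto
  then show "real_model w (prox_step w) + L / 2 * (norm (prox_step w - w))\<^sup>2
      + (L + \<mu>) / 2 * (norm (u - prox_step w))\<^sup>2 \<le> real_model w u + L / 2 * (norm (u - w))\<^sup>2"
    unfolding distrib_left F using L by simp
qed

lemma y_Suc: "y (Suc k) = prox_step (xt k)"
  by (simp add: y_def xt_def x_def Let_def)

lemma x_Suc: "x (Suc k) = x k + (a k / (1 + \<mu> * A (Suc k))) *\<^sub>R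
   (L *\<^sub>R (y (Suc k) - xt k) + \<mu> *\<^sub>R (y (Suc k) - x k))"
  unfolding y_Suc by (simp add: y_def xt_def x_def Let_def)

text \<open>Index 0 is excluded because the starting point need not belong to
  \<open>D\<close>.\<close>

lemma y_in: "1 \<le> k \<Longrightarrow> y k \<in> D"
  using prox_step(1) y_Suc by (cases k) auto

lemma A_nonneg: "0 \<le> A k" and a_ge: "1 / L \<le> a k"
proof -
  have step: "1 / L \<le> next_a B" if "0 \<le> B" for B
  proof -
    define t where "t = (1 + \<mu> * B) / L"
    have t: "1 / L \<le> t" unfolding t_def using that \<mu> L by (intro divide_right_mono) auto
    have "0 \<le> t" using that \<mu> L by (simp add: t_def)
    then have "0 \<le> 4 * t * B" using that by simp
    then have "t \<le> sqrt (t\<^sup>2 + 4 * t * B)" by (intro real_le_rsqrt) simp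
    then have "t \<le> (t + sqrt (t\<^sup>2 + 4 * t * B)) / 2" by simp
    with t have "1 / L \<le> (t + sqrt (t\<^sup>2 + 4 * t * B)) / 2" by (rule order_trans)
    then show ?thesis by (simp add: next_a_def Let_def t_def)
  qed
  show A: "0 \<le> A k" for k
  proof (induction k)
    case (Suc k)
    have "0 \<le> 1 / L" using L by simp
    then have "0 \<le> next_a (A k)" using step[OF Suc] by (rule order_trans)
    then show ?case using Suc by (simp add: A.simps(2))
  qed simp
  show "1 / L \<le> a k" using step[OF A] by (simp add: a_def)
qed

lemma A_Suc: "A (Suc k) = A k + a k" by (simp add: a_def A.simps(2))

lemma a_pos: "0 < a k" using a_ge[of k] L by (smt (verit) divide_pos_pos)

lemma A_pos: "1 \<le> k \<Longrightarrow> 0 < A k"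
  using A_nonneg a_pos A_Suc by (cases k) (auto intro: add_nonneg_pos)

lemma A_ge: "real k / L \<le> A k"
proof (induction k)
  case (Suc k)
  have "real (Suc k) / L = real k / L + 1 / L" by (simp add: add_divide_distrib)
  then show ?case using Suc a_ge[of k] by (simp add: A_Suc)
qed simp

text \<open>\<open>a k\<close> is the positive root of the quadratic
  \<open>t\<^sup>2 = \<tau> * (A k + t)\<close>, where \<open>\<tau>\<close> is the step parameter
  of the iteration. This relation balances the two quadratic terms in the induction for
  \<open>A_obj_le\<close>.\<close>

lemma a_square: "L * (a k)\<^sup>2 = A (Suc k) * (1 + \<mu> * A k)"
proof -
  define t where "t = (1 + \<mu> * A k) / L"
  have t: "0 \<le> t" using \<mu> L A_nonneg[of k] by (simp add: t_def)
  have a: "a k = (t + sqrt (t\<^sup>2 + 4 * t * A k)) / 2"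
    by (simp add: a_def next_a_def Let_def t_def)
  have "(sqrt (t\<^sup>2 + 4 * t * A k))\<^sup>2 = t\<^sup>2 + 4 * t * A k"
    using t A_nonneg[of k] by simp
  moreover have "sqrt (t\<^sup>2 + 4 * t * A k) = 2 * a k - t" using a by simp
  ultimately have "(2 * a k - t)\<^sup>2 = t\<^sup>2 + 4 * t * A k" by simp
  then have "(a k)\<^sup>2 = t * A (Suc k)" by (simp add: A_Suc power2_eq_square algebra_simps)
  then have "L * (a k)\<^sup>2 = A (Suc k) * (L * t)" by simp
  then show ?thesis using L by (simp add: t_def)
qed

lemma \<gamma>_eq: "\<gamma> k u = real_model (xt k) (y (Suc k)) + L * ((xt k - y (Suc k)) \<bullet> (u - y (Suc k)))
    + \<mu> / 2 * (norm (u - y (Suc k)))\<^sup>2"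
  by (simp add: \<gamma>_def q_def model_real y_in)

text \<open>Completing the square: with the prox term added, \<open>\<gamma> k\<close> is the
  optimal value of the prox problem plus its growth term. So \<open>\<gamma> k\<close> lies below
  the model exactly by the growth of the prox objective.\<close>

lemma \<gamma>_plus:
  "\<gamma> k u + L / 2 * (norm (u - xt k))\<^sup>2 = real_model (xt k) (y (Suc k))
     + L / 2 * (norm (y (Suc k) - xt k))\<^sup>2 + (L + \<mu>) / 2 * (norm (u - y (Suc k)))\<^sup>2"
  unfolding \<gamma>_eq norm_diff_square_shift[of u "xt k" "y (Suc k)"]
  by (simp add: inner_diff_left algebra_simps)

lemma \<gamma>_le_model: "u \<in> D \<Longrightarrow> \<gamma> k u \<le> real_model (xt k) u"
  using prox_step(2)[of u "xt k"] \<gamma>_plus[of k u] unfolding y_Suc[symmetric] by linarith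

lemma \<gamma>_le_obj: "sandwiched (xt k) \<Longrightarrow> u \<in> D \<Longrightarrow> \<gamma> k u \<le> obj u"
  using \<gamma>_le_model[of u k] by (fastforce simp: sandwiched_def obj_def real_model_def)

lemma A_\<Gamma>_Suc: "A (Suc k) * \<Gamma> (Suc k) u = A k * \<Gamma> k u + a k * \<gamma> k u"
  using A_pos[of "Suc k"] by (simp add: \<Gamma>.simps(2) distrib_left)

text \<open>The factor \<open>A k\<close> makes the case \<open>k = 0\<close> trivial, where
  \<open>\<Gamma> 0 = 0\<close> need not be a lower bound.\<close>

lemma A_\<Gamma>_le_obj:
  assumes "\<And>j. j < k \<Longrightarrow> sandwiched (xt j)" "u \<in> D"
  shows "A k * \<Gamma> k u \<le> A k * obj u"
  using assms(1)
proof (induction k)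
  case (Suc k)
  have "a k * \<gamma> k u \<le> a k * obj u" using Suc.prems a_pos assms(2) \<gamma>_le_obj by (intro mult_left_mono) (auto simp: less_imp_le)
  moreover have "A k * \<Gamma> k u \<le> A k * obj u" using Suc by simp
  ultimately show ?case unfolding A_\<Gamma>_Suc unfolding A_Suc distrib_right by linarith
qed simp

text \<open>The regularised estimate is a quadratic of curvature \<open>1 + \<mu> * A k\<close>, and
  the update rule for \<open>x\<close> is its minimisation.\<close>

lemma A_\<Gamma>_quadratic:
  "A k * \<Gamma> k u + 1 / 2 * (norm (u - y\<^sub>0))\<^sup>2 =
     A k * \<Gamma> k (x k) + 1 / 2 * (norm (x k - y\<^sub>0))\<^sup>2 + (1 + \<mu> * A k) / 2 * (norm (u - x k))\<^sup>2"
proof (induction k arbitrary: u)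
  case 0
  then show ?case by (simp add: x_def)
next
  case (Suc k)
  let ?y = "y (Suc k)"
  define x' where "x' = x (Suc k)"
  define w where "w = L *\<^sub>R (?y - xt k) + \<mu> *\<^sub>R (?y - x k)"
  have pos: "0 < 1 + \<mu> * A (Suc k)" using \<mu> A_nonneg[of "Suc k"] by (simp add: add_pos_nonneg)
  have xk: "(1 + \<mu> * A (Suc k)) *\<^sub>R (x' - x k) = a k *\<^sub>R w"
    using pos by (simp add: x'_def x_Suc w_def)
  define c where "c = A k * \<Gamma> k (x k) + 1 / 2 * (norm (x k - y\<^sub>0))\<^sup>2"
  have form: "A (Suc k) * \<Gamma> (Suc k) v + 1 / 2 * (norm (v - y\<^sub>0))\<^sup>2 =
      c + (1 + \<mu> * A k) / 2 * (norm (v - x k))\<^sup>2 + a k * \<gamma> k v" for v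
    using Suc[of v] unfolding A_\<Gamma>_Suc c_def by simp
  define d where "d = u - x'"
  have u: "u - x k = (x' - x k) + d" "u - ?y = (x' - ?y) + d" by (simp_all add: d_def)
  have "w \<bullet> d = L * ((?y - xt k) \<bullet> d) + \<mu> * ((?y - x k) \<bullet> d)"
    by (simp add: w_def inner_add_left)
  moreover have "(1 + \<mu> * A (Suc k)) * ((x' - x k) \<bullet> d) = a k * (w \<bullet> d)"
    using arg_cong[OF xk, of "\<lambda>v. v \<bullet> d"] by simp
  ultimately have "(1 + \<mu> * A (Suc k)) * ((x' - x k) \<bullet> d) = a k * (L * ((?y - xt k) \<bullet> d) + \<mu> * ((?y - x k) \<bullet> d))"
    by simp
  \<comment> \<open>Stationarity at \<open>x'\<close>: the coefficient linear in \<open>d\<close>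
    vanishes, which is the update rule multiplied by \<open>1 + \<mu> * A (Suc k)\<close>.\<close>
  then have lin: "(1 + \<mu> * A k) * ((x' - x k) \<bullet> d) + a k * (L * ((xt k - ?y) \<bullet> d) + \<mu> * ((x' - ?y) \<bullet> d)) = 0"
    by (simp add: A_Suc inner_diff_left algebra_simps)
  have "(1 + \<mu> * A k) / 2 * (norm (u - x k))\<^sup>2 + a k * \<gamma> k u =
     (1 + \<mu> * A k) / 2 * (norm (x' - x k))\<^sup>2 + a k * \<gamma> k x' + (1 + \<mu> * A (Suc k)) / 2 * (norm d)\<^sup>2
     + ((1 + \<mu> * A k) * ((x' - x k) \<bullet> d) + a k * (L * ((xt k - ?y) \<bullet> d) + \<mu> * ((x' - ?y) \<bullet> d)))"
    unfolding \<gamma>_eq u norm_add_square inner_add_right A_Suc by (simp add: field_simps)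
  then have "(1 + \<mu> * A k) / 2 * (norm (u - x k))\<^sup>2 + a k * \<gamma> k u =
     (1 + \<mu> * A k) / 2 * (norm (x' - x k))\<^sup>2 + a k * \<gamma> k x' + (1 + \<mu> * A (Suc k)) / 2 * (norm d)\<^sup>2"
    unfolding lin by simp
  then show ?case unfolding form by (simp add: x'_def d_def)
qed

text \<open>Since \<open>x k\<close> minimises the regularised estimate, the gradient of
  \<open>\<Gamma> k\<close> at \<open>x k\<close> is \<open>(y\<^sub>0 - x k) /\<^sub>R A k\<close>,
  that is \<open>r k\<close>.\<close>

lemma \<Gamma>_expansion:
  assumes k: "1 \<le> k"
  shows "\<Gamma> k u = \<Gamma> k (x k) + r k \<bullet> (u - x k) + \<mu> / 2 * (norm (u - x k))\<^sup>2"
proof -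
  have A: "0 < A k" using A_pos[OF k] .
  have r: "A k * (r k \<bullet> v) = - ((x k - y\<^sub>0) \<bullet> v)" for v
  proof -
    have "x 0 = y\<^sub>0" by (simp add: x_def)
    then have "A k *\<^sub>R r k = - (x k - y\<^sub>0)" using A by (simp add: r_def)
    then show ?thesis by (metis inner_minus_left inner_scaleR_left)
  qed
  have "A k * \<Gamma> k u = A k * \<Gamma> k (x k) - (x k - y\<^sub>0) \<bullet> (u - x k) + A k * (\<mu> / 2 * (norm (u - x k))\<^sup>2)"
    using A_\<Gamma>_quadratic[of k u] norm_diff_square_shift[of u "y\<^sub>0" "x k"] by (simp add: field_simps)
  also have "\<dots> = A k * (\<Gamma> k (x k) + r k \<bullet> (u - x k) + \<mu> / 2 * (norm (u - x k))\<^sup>2)"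
    by (simp add: distrib_left r)
  finally show ?thesis using A by simp
qed

text \<open>The corrections in \<open>\<eta>\<close> and \<open>\<eta>t\<close> are the expansion of
  \<open>\<Gamma> k\<close> from \<open>x k\<close> to \<open>y k\<close>, so they combine into the
  value of \<open>\<Gamma> k\<close> at \<open>y k\<close>.\<close>

lemma \<eta>t_eq: "1 \<le> k \<Longrightarrow> \<eta>t k = obj (y k) - \<Gamma> k (y k)"
  using \<Gamma>_expansion[of k "y k"] by (simp add: \<eta>t_def \<eta>_def \<psi>_obj y_in)

lemma \<Gamma>_expansion_y:
  assumes k: "1 \<le> k"
  shows "\<Gamma> k u = \<Gamma> k (y k) + rt k \<bullet> (u - y k) + \<mu> / 2 * (norm (u - y k))\<^sup>2"
  using \<Gamma>_expansion[OF k, of u] \<Gamma>_expansion[OF k, of "y k"] norm_diff_square_shift[of u "x k" "y k"]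
  by (simp add: rt_def inner_add_left inner_diff_right algebra_simps)

text \<open>Induction step: convexity of \<open>\<gamma> k\<close> merges its values at
  \<open>y k\<close> and \<open>u\<close> into one at their average \<open>v\<close>, the step size
  equation turns the remaining quadratic into a prox term around \<open>xt k\<close>, and the prox
  step bounds the objective at the new point.\<close>

lemma A_obj_le:
  assumes "\<And>j. j < k \<Longrightarrow> sandwiched (xt j)"
  shows "A k * obj (y k) \<le> A k * \<Gamma> k u + 1 / 2 * (norm (u - y\<^sub>0))\<^sup>2"
  using assms
proof (induction k arbitrary: u)
  case 0
  then show ?case by simp
next
  case (Suc k)
  let ?y = "y (Suc k)"
  have sw: "sandwiched (xt k)" using Suc.prems by simp
  have A': "0 < A (Suc k)" by (rule A_pos) simp
  have A: "0 \<le> A k" and a: "0 < a k" by (rule A_nonneg, rule a_pos)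
  \<comment> \<open>With these weights \<open>v - xt k\<close> is a multiple of
    \<open>u - x k\<close>, since \<open>xt k\<close> is the same average of \<open>y k\<close> and
    \<open>x k\<close>.\<close>
  define v where "v = (A k / A (Suc k)) *\<^sub>R y k + (a k / A (Suc k)) *\<^sub>R u"
  have vA: "A (Suc k) *\<^sub>R (v - b) = A k *\<^sub>R (y k - b) + a k *\<^sub>R (u - b)" for b
    using A' by (simp add: v_def scaleR_right_diff_distrib scaleR_right_distrib scaleR_left_distrib A_Suc)
  have "A k * obj (y k) \<le> A k * \<Gamma> k (x k) + 1 / 2 * (norm (x k - y\<^sub>0))\<^sup>2"
    using Suc.IH Suc.prems by simp
  \<comment> \<open>For \<open>k = 0\<close> the point \<open>y 0\<close> may lie outside
    \<open>D\<close>, but the factor \<open>A 0\<close> vanishes.\<close>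
  moreover have "A k * \<gamma> k (y k) \<le> A k * obj (y k)"
  proof (cases k)
    case (Suc j)
    then show ?thesis using A sw by (intro mult_left_mono \<gamma>_le_obj y_in) auto
  qed simp
  ultimately have 1: "A k * \<gamma> k (y k) + a k * \<gamma> k u + (1 + \<mu> * A k) / 2 * (norm (u - x k))\<^sup>2
      \<le> A (Suc k) * \<Gamma> (Suc k) u + 1 / 2 * (norm (u - y\<^sub>0))\<^sup>2"
    using A_\<Gamma>_quadratic[of k u] unfolding A_\<Gamma>_Suc by linarith
  have 2: "A (Suc k) * \<gamma> k v \<le> A k * \<gamma> k (y k) + a k * \<gamma> k u"
  proof -
    have "A (Suc k) * ((xt k - ?y) \<bullet> (v - ?y)) = A k * ((xt k - ?y) \<bullet> (y k - ?y)) + a k * ((xt k - ?y) \<bullet> (u - ?y))"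
      using arg_cong[OF vA[of ?y], of "\<lambda>p. (xt k - ?y) \<bullet> p"] by (simp only: inner_add_right inner_scaleR_right)
    then have lin: "A (Suc k) * (L * ((xt k - ?y) \<bullet> (v - ?y))) =
        A k * (L * ((xt k - ?y) \<bullet> (y k - ?y))) + a k * (L * ((xt k - ?y) \<bullet> (u - ?y)))"
      by (simp only: mult.left_commute[of _ L] distrib_left[symmetric])
    have "(A (Suc k))\<^sup>2 * (norm (v - ?y))\<^sup>2 = (norm (A (Suc k) *\<^sub>R (v - ?y)))\<^sup>2"
      by (simp add: power_mult_distrib)
    also have "\<dots> \<le> A (Suc k) * (A k * (norm (y k - ?y))\<^sup>2 + a k * (norm (u - ?y))\<^sup>2)"
      unfolding vA using norm_square_two_point_convexity[OF A less_imp_le[OF a]] by (simp add: A_Suc)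
    finally have "A (Suc k) * (norm (v - ?y))\<^sup>2 \<le> A k * (norm (y k - ?y))\<^sup>2 + a k * (norm (u - ?y))\<^sup>2"
      using A' by (simp add: power2_eq_square mult.assoc)
    then have "\<mu> / 2 * (A (Suc k) * (norm (v - ?y))\<^sup>2) \<le> \<mu> / 2 * (A k * (norm (y k - ?y))\<^sup>2 + a k * (norm (u - ?y))\<^sup>2)"
      using \<mu> by (intro mult_left_mono) auto
    moreover have "A (Suc k) * real_model (xt k) ?y = A k * real_model (xt k) ?y + a k * real_model (xt k) ?y"
      by (simp add: A_Suc distrib_right)
    ultimately show ?thesis using lin unfolding \<gamma>_eq
      by (simp add: distrib_left mult.left_commute[of _ "\<mu>"])
  qed
  have 3: "(1 + \<mu> * A k) / 2 * (norm (u - x k))\<^sup>2 = A (Suc k) * (L / 2 * (norm (v - xt k))\<^sup>2)"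
  proof -
    have "v - xt k = (a k / A (Suc k)) *\<^sub>R (u - x k)"
      by (simp add: v_def xt_def extrapolate_def scaleR_right_diff_distrib)
    then have "(norm (v - xt k))\<^sup>2 = (a k)\<^sup>2 / (A (Suc k))\<^sup>2 * (norm (u - x k))\<^sup>2"
      by (simp add: power_mult_distrib power_divide)
    then have "A (Suc k) * (L / 2 * (norm (v - xt k))\<^sup>2) = (L * (a k)\<^sup>2) / A (Suc k) / 2 * (norm (u - x k))\<^sup>2"
      using A' by (simp add: power2_eq_square field_simps)
    then show ?thesis unfolding a_square using A' by simp
  qed
  have "obj ?y \<le> real_model (xt k) ?y + L / 2 * (norm (?y - xt k))\<^sup>2"
  proof -
    have "\<psi>\<^sub>s ?y \<le> lin_approx \<psi>\<^sub>s (xt k) ?y + L / 2 * (norm (?y - xt k))\<^sup>2"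
      using sw y_in[of "Suc k"] by (simp add: sandwiched_def)
    moreover have "0 \<le> \<mu> / 2 * (norm (?y - xt k))\<^sup>2" using \<mu> by simp
    ultimately show ?thesis unfolding obj_def real_model_def by linarith
  qed
  also have "\<dots> \<le> \<gamma> k v + L / 2 * (norm (v - xt k))\<^sup>2"
    unfolding \<gamma>_plus using L \<mu> by simp
  finally have "A (Suc k) * obj ?y \<le> A (Suc k) * (\<gamma> k v + L / 2 * (norm (v - xt k))\<^sup>2)"
    using A' by (intro mult_left_mono) auto
  with 1 2 3 show ?case unfolding distrib_left by linarith
qed

text \<open>The failure test negates the estimate \<open>A_obj_le\<close> after its right-hand side
  has been minimised over \<open>u\<close>.\<close>

lemma not_fails:
  assumes k: "1 \<le> k" and sw: "\<And>j. j < k \<Longrightarrow> sandwiched (xt j)"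
  shows "\<not> fails k"
proof -
  define v where "v = A k *\<^sub>R rt k + y k - y\<^sub>0"
  define s where "s = 1 + \<mu> * A k"
  have s: "0 < s" using \<mu> A_nonneg[of k] by (simp add: s_def add_pos_nonneg)
  \<comment> \<open>The minimiser of
    \<open>v \<bullet> d + s / 2 * (norm d)\<^sup>2\<close>.\<close>
  define d where "d = - (v /\<^sub>R s)"
  have "A k * obj (y k) \<le> A k * \<Gamma> k (y k + d) + 1 / 2 * (norm ((y k - y\<^sub>0) + d))\<^sup>2"
    using A_obj_le[of k "y k + d"] sw by (simp add: algebra_simps)
  also have "\<dots> = A k * \<Gamma> k (y k) + 1 / 2 * (norm (y k - y\<^sub>0))\<^sup>2 + (v \<bullet> d + s / 2 * (norm d)\<^sup>2)"
    unfolding norm_add_square \<Gamma>_expansion_y[OF k, of "y k + d"] v_def s_def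
    by (simp add: inner_add_left inner_diff_left field_simps)
  also have "v \<bullet> d + s / 2 * (norm d)\<^sup>2 = - ((norm v)\<^sup>2 / s) / 2"
  proof -
    have "v \<bullet> d = - ((norm v)\<^sup>2 / s)" by (simp add: d_def power2_norm_eq_inner divide_inverse)
    moreover have "(norm d)\<^sup>2 = (norm v)\<^sup>2 / s\<^sup>2" using s by (simp add: d_def power_mult_distrib field_simps)
    ultimately show ?thesis using s by (simp add: power2_eq_square)
  qed
  finally have "(norm v)\<^sup>2 / s + 2 * (A k * \<eta>t k) \<le> (norm (y k - y\<^sub>0))\<^sup>2"
    unfolding \<eta>t_eq[OF k] by (simp add: right_diff_distrib)
  then show ?thesis by (simp add: fails_def v_def s_def not_less mult.assoc)
qed

lemma \<eta>t_nonneg: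
  assumes k: "1 \<le> k" and sw: "\<And>j. j < k \<Longrightarrow> sandwiched (xt j)"
  shows "0 \<le> \<eta>t k"
  using A_\<Gamma>_le_obj[of k "y k"] sw y_in[OF k] A_pos[OF k] by (simp add: \<eta>t_eq[OF k])

lemma obj_lower_bound:
  assumes k: "1 \<le> k" and sw: "\<And>j. j < k \<Longrightarrow> sandwiched (xt j)" and u: "u \<in> D"
  shows "obj (y k) + rt k \<bullet> (u - y k) + \<mu> / 2 * (norm (u - y k))\<^sup>2 - \<eta>t k \<le> obj u"
proof -
  have "\<Gamma> k u \<le> obj u" using A_\<Gamma>_le_obj[of k u] sw u A_pos[OF k] by simp
  then show ?thesis using \<Gamma>_expansion_y[OF k, of u] \<eta>t_eq[OF k] by simp
qed

text \<open>The passed failure test bounds \<open>2 * A k * \<eta>t k\<close> by the squared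
  distance \<open>d\<close> and \<open>(norm v)\<^sup>2\<close> by
  \<open>(1 + \<mu> * A k) * d\<close>. Removing \<open>y k - y\<^sub>0\<close> from
  \<open>v\<close> doubles the latter and adds \<open>2 * d\<close>, which gives
  \<open>4 + 2 * \<mu>\<close>; the \<open>\<eta>t\<close> term makes it
  \<open>5 + 2 * \<mu>\<close>.\<close>

lemma accurate_if_large:
  assumes k: "1 \<le> k" and sw: "\<And>j. j < k \<Longrightarrow> sandwiched (xt j)"
    and A: "1 \<le> A k" "5 + 2 * \<mu> \<le> \<theta>\<^sup>2 * A k"
  shows "accurate k"
proof -
  define d where "d = (norm (y k - y\<^sub>0))\<^sup>2"
  define v where "v = A k *\<^sub>R rt k + (y k - y\<^sub>0)"
  define B where "B = A k"
  have B: "1 \<le> B" "5 + 2 * \<mu> \<le> \<theta>\<^sup>2 * B" using A by (auto simp: B_def)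
  have s: "0 < 1 + \<mu> * B" using \<mu> B by (simp add: add_pos_nonneg)
  have d: "0 \<le> d" by (simp add: d_def)
  have e: "0 \<le> \<eta>t k" by (rule \<eta>t_nonneg[OF k sw])
  have nf: "(norm v)\<^sup>2 / (1 + \<mu> * B) + 2 * B * \<eta>t k \<le> d"
    using not_fails[OF k sw] by (simp add: fails_def v_def d_def B_def not_less add_diff_eq)
  have "0 \<le> (norm v)\<^sup>2 / (1 + \<mu> * B)" using s by simp
  with nf have 1: "2 * B * \<eta>t k \<le> d" by linarith
  have "0 \<le> 2 * B * \<eta>t k" using B e by simp
  with nf have "(norm v)\<^sup>2 / (1 + \<mu> * B) \<le> d" by linarith
  then have 2: "(norm v)\<^sup>2 \<le> (1 + \<mu> * B) * d" using s by (simp add: pos_divide_le_eq mult.commute)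
  have "B\<^sup>2 * (norm (rt k))\<^sup>2 = (norm (v - (y k - y\<^sub>0)))\<^sup>2"
    using B by (simp add: v_def B_def power_mult_distrib)
  also have "v - (y k - y\<^sub>0) = v + (y\<^sub>0 - y k)" by simp
  also have "(norm \<dots>)\<^sup>2 \<le> 2 * (norm v)\<^sup>2 + 2 * d"
    using norm_square_two_point_convexity[of 1 1 v "y\<^sub>0 - y k"] by (simp add: d_def norm_minus_commute[of y\<^sub>0 "y k"])
  also have "\<dots> \<le> (4 + 2 * \<mu> * B) * d" using 2 by (simp add: algebra_simps)
  also have "\<dots> \<le> (B * (4 + 2 * \<mu>)) * d"
    using B \<mu> d by (intro mult_right_mono) (auto simp: distrib_left)
  finally have "B * (norm (rt k))\<^sup>2 \<le> (4 + 2 * \<mu>) * d"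
    using B by (simp add: power2_eq_square mult.assoc)
  with 1 have "B * ((norm (rt k))\<^sup>2 + 2 * \<eta>t k) \<le> (5 + 2 * \<mu>) * d"
    by (simp add: algebra_simps)
  also have "\<dots> \<le> (\<theta>\<^sup>2 * B) * d" using B(2) d by (rule mult_right_mono)
  also have "\<dots> = B * (\<theta>\<^sup>2 * d)" by simp
  finally have "B * ((norm (rt k))\<^sup>2 + 2 * \<eta>t k) \<le> B * (\<theta>\<^sup>2 * d)" .
  moreover have "0 < B" using B(1) by simp
  ultimately have "(norm (rt k))\<^sup>2 + 2 * \<eta>t k \<le> \<theta>\<^sup>2 * d" by (rule mult_left_le_imp_le)
  then show ?thesis by (simp add: accurate_def d_def)
qed

lemma accurate_eventually:
  assumes sw: "\<And>j. sandwiched (xt j)" and \<theta>: "0 < \<theta>"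
  shows "\<exists>k\<ge>1. accurate k"
proof -
  \<comment> \<open>\<open>A k\<close> grows at least linearly; the summand 1 secures
    \<open>1 \<le> A k\<close>, which also excludes \<open>k = 0\<close>.\<close>
  obtain k :: nat where k: "L * (1 + (5 + 2 * \<mu>) / \<theta>\<^sup>2) < real k" using reals_Archimedean2 by blast
  then have "1 + (5 + 2 * \<mu>) / \<theta>\<^sup>2 < real k / L" using L by (simp add: pos_less_divide_eq mult.commute)
  with A_ge[of k] have A: "1 + (5 + 2 * \<mu>) / \<theta>\<^sup>2 < A k" by linarith
  moreover have p: "0 \<le> (5 + 2 * \<mu>) / \<theta>\<^sup>2" using \<mu> by simp
  ultimately have "1 \<le> A k" "(5 + 2 * \<mu>) / \<theta>\<^sup>2 \<le> A k" by linarith+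
  then have "5 + 2 * \<mu> \<le> \<theta>\<^sup>2 * A k" using \<theta> by (simp add: pos_divide_le_eq mult.commute)
  moreover have "1 \<le> k"
  proof (rule ccontr)
    assume "\<not> 1 \<le> k"
    then have "A k = 0" by (cases k) auto
    with \<open>1 \<le> A k\<close> show False by simp
  qed
  ultimately show ?thesis using accurate_if_large \<open>1 \<le> A k\<close> sw by blast
qed

section \<open>The output of the accelerated method\<close>

lemma result_Success:
  assumes "result = Success z v \<epsilon>"
  shows "z \<in> D" "(norm v)\<^sup>2 + 2 * \<epsilon> \<le> \<theta>\<^sup>2 * (norm (z - y\<^sub>0))\<^sup>2"
    "Delta \<mu> \<psi> (refined_point \<psi>\<^sub>s \<psi>\<^sub>n L z v) z v \<le> ereal \<epsilon>"
proof -
  define k where "k = (LEAST k. stops k)"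
  have ex: "\<exists>k. stops k" using assms by (auto simp: result_def split: if_splits)
  then have "stops k" unfolding k_def by (rule LeastI_ex)
  moreover have "result = (if fails k then Failure y\<^sub>0
         else if Delta \<mu> \<psi> (yh k) (y k) (rt k) > ereal (\<eta>t k) then Failure y\<^sub>0
         else Success (y k) (rt k) (\<eta>t k))"
    using ex by (simp add: result_def k_def Let_def)
  ultimately have *: "1 \<le> k" "accurate k" "\<not> Delta \<mu> \<psi> (yh k) (y k) (rt k) > ereal (\<eta>t k)"
    "z = y k" "v = rt k" "\<epsilon> = \<eta>t k"
    using assms by (auto simp: stops_def split: if_splits)
  then show "z \<in> D" "(norm v)\<^sup>2 + 2 * \<epsilon> \<le> \<theta>\<^sup>2 * (norm (z - y\<^sub>0))\<^sup>2"
    "Delta \<mu> \<psi> (refined_point \<psi>\<^sub>s \<psi>\<^sub>n L z v) z v \<le> ereal \<epsilon>"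
    by (auto simp: y_in accurate_def yh_def not_less)
qed

text \<open>If no iteration stops, every \<open>xt j\<close> is a gradient point, so accuracy is
  reached eventually, a contradiction. At the first stopping index \<open>k\<close> the points
  \<open>xt j\<close> with \<open>j < k\<close> are gradient points, which is all the estimates up
  to \<open>k\<close> use.\<close>

theorem convex_result_Success:
  assumes sw: "\<And>w. w \<in> gradient_points \<Longrightarrow> sandwiched w" and \<theta>: "0 < \<theta>"
  shows "\<exists>z v \<epsilon>. result = Success z v \<epsilon> \<and>
    (\<forall>u\<in>D. obj z + v \<bullet> (u - z) + \<mu> / 2 * (norm (u - z))\<^sup>2 - \<epsilon> \<le> obj u)"
proof -
  have ex: "\<exists>k. stops k"
  proof (rule ccontr)
    assume n: "\<nexists>k. stops k"
    then have "sandwiched (xt j)" for j by (intro sw) (auto simp: gradient_points_def)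
    then obtain k where "1 \<le> k" "accurate k" using accurate_eventually \<theta> by blast
    with n show False by (auto simp: stops_def)
  qed
  define k where "k = (LEAST k. stops k)"
  have "stops k" unfolding k_def using ex by (rule LeastI_ex)
  then have k: "1 \<le> k" by (simp add: stops_def)
  have swk: "sandwiched (xt j)" if "j < k" for j
  proof (rule sw)
    have "\<not> stops i" if "i \<le> j" for i
      using that \<open>j < k\<close> not_less_Least[of i stops] by (simp add: k_def)
    then show "xt j \<in> gradient_points" by (auto simp: gradient_points_def)
  qed
  note lower = obj_lower_bound[OF k swk]
  \<comment> \<open>The lower bound holds at every \<open>u\<close>, in particular at the refined
    point, so the final test passes too.\<close>
  have "Delta \<mu> \<psi> u (y k) (rt k) \<le> ereal (\<eta>t k)" for u
  proof (cases "u \<in> D")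
    case True
    then show ?thesis using lower[OF _ True] by (simp add: Delta_def \<psi>_obj y_in[OF k])
  next
    case False
    then show ?thesis by (simp add: Delta_def \<psi>_obj y_in[OF k])
  qed
  then have "result = Success (y k) (rt k) (\<eta>t k)"
    using ex not_fails[OF k swk] by (simp add: result_def k_def[symmetric] Let_def not_less)
  with lower show ?thesis by blast
qed

end

section \<open>Reduction of the matrix problem to vectors\<close>

lemma GDERIV_quadratic_perturbation:
  fixes f :: "'a::real_inner \<Rightarrow> real"
  assumes "GDERIV f w :> g"
  shows "GDERIV (\<lambda>u. c * f u - b \<bullet> u + 1 / 2 * (norm u)\<^sup>2 + d) w :> c *\<^sub>R g - b + w"
  using assms unfolding gderiv_def power2_norm_eq_inner
  by (auto intro!: derivative_eq_intros simp: inner_add_right inner_diff_right inner_commute)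

locale sigma_acg_problem = sigma_acg f\<^sub>1 f2V hV lam \<theta> M\<^sub>2 Z\<^sub>0 P Q
  for f\<^sub>1 :: "real^'n^'m \<Rightarrow> real" and f2V :: "real^('r::{finite,linorder}) \<Rightarrow> real"
    and hV :: "real^('r::{finite,linorder}) \<Rightarrow> ereal" and lam \<theta> M\<^sub>2 Z\<^sub>0
    and P :: "real^('r::{finite,linorder})^'m" and Q :: "real^('r::{finite,linorder})^'n" +
  fixes D :: "(real^('r::{finite,linorder})) set"
  assumes r: "CARD('r) = min CARD('m) CARD('n)"
    and hV: "hV \<in> Conv_bar D" "abs_symmetric hV"
    and f2V: "C1_on D f2V" "M\<^sub>2-lipschitz_on D (gradient f2V)" "0 < M\<^sub>2" "abs_symmetric f2V"
    and lam: "0 < lam" and \<theta>: "0 < \<theta>"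
    and svd: "is_svd (Z\<^sub>0 - lam *\<^sub>R gradient f\<^sub>1 Z\<^sub>0) P (sing_vals (Z\<^sub>0 - lam *\<^sub>R gradient f\<^sub>1 Z\<^sub>0)) Q"
begin

abbreviation L :: real where "L \<equiv> lam * M\<^sub>2 + 1"

definition f\<^sub>2 :: "real^'n^'m \<Rightarrow> real" where "f\<^sub>2 U = f2V (sing_vals U)"

definition h :: "real^'n^'m \<Rightarrow> ereal" where "h U = hV (sing_vals U)"

definition \<psi>\<^sub>s :: "real^'n^'m \<Rightarrow> real" where
  "\<psi>\<^sub>s U = lam * (lin_approx f\<^sub>1 Z\<^sub>0 U + f\<^sub>2 U) + 1 / 2 * (norm (U - Z\<^sub>0))\<^sup>2"

definition \<psi>\<^sub>n :: "real^'n^'m \<Rightarrow> ereal" where "\<psi>\<^sub>n U = ereal lam * h U"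

definition \<psi> :: "real^'n^'m \<Rightarrow> ereal" where "\<psi> U = ereal (\<psi>\<^sub>s U) + \<psi>\<^sub>n U"

definition H :: "real^('r::{finite,linorder}) \<Rightarrow> real" where "H u = real_of_ereal (hV u)"

abbreviation up :: "real^('r::{finite,linorder}) \<Rightarrow> real^'n^'m" where "up \<equiv> diag_lift P Q"

abbreviation dn :: "real^'n^'m \<Rightarrow> real^('r::{finite,linorder})" where "dn \<equiv> diag_part P Q"

abbreviation sv :: "real^'n^'m \<Rightarrow> real^('r::{finite,linorder})" where "sv \<equiv> sing_vals"

lemma orth: "transpose P ** P = mat 1" "transpose Q ** Q = mat 1"
  and Z0_lam: "Z\<^sub>0 - lam *\<^sub>R gradient f\<^sub>1 Z\<^sub>0 = up s"
  using svd by (auto simp: is_svd_iff s_def)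

sublocale vec: composite_sacg \<psi>sV \<psi>nV start \<theta> 1 L D
proof
  show "\<psi>nV \<in> Conv_bar D"
    using Conv_bar_cmult[OF hV(1) lam] by (simp add: \<psi>nV_def[abs_def])
  show "0 < L" using lam f2V(3) by (simp add: add_pos_pos)
qed simp

lemma \<psi>nV_real: "real_of_ereal (\<psi>nV u) = lam * H u"
  by (simp add: \<psi>nV_def H_def)

text \<open>\<open>D\<close> is where the symmetric function \<open>hV\<close> is finite.\<close>

lemma D_sym: "abs_symmetric (\<lambda>x. x \<in> D)"
proof -
  have "x \<in> D \<longleftrightarrow> hV x \<noteq> \<infinity>" for x using Conv_bar_ereal[OF hV(1), of x] by (cases "x \<in> D") auto
  then show ?thesis using hV(2) by (simp add: abs_symmetric_def)
qed

lemma H_sym: "abs_symmetric H" using hV(2) by (simp add: abs_symmetric_def H_def)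

lemma D_convex: "convex D" and H_convex: "convex_on D H"
proof -
  show "convex_on D H" using hV(1) unfolding H_def by (simp add: Conv_bar_def)
  then show "convex D" by (simp add: convex_on_def)
qed

lemma sv_up: "abs_symmetric f \<Longrightarrow> f (sv (up z)) = f z"
  by (rule abs_symmetric_sing_vals_diag_lift[OF _ orth])

lemma sv_up_in: "sv (up z) \<in> D \<longleftrightarrow> z \<in> D"
  using sv_up[OF D_sym] .

lemma dn_in: "sv U \<in> D \<Longrightarrow> dn U \<in> D"
  and H_dn: "sv U \<in> D \<Longrightarrow> H (dn U) \<le> H (sv U)"
  using convex_abs_symmetric_diag_part[OF orth r H_convex H_sym D_sym] by auto

lemma norm_split: "(norm (U - up z))\<^sup>2 = (norm (dn U - z))\<^sup>2 + (norm (U - up (dn U)))\<^sup>2"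
  by (rule norm_diff_diag_lift[OF orth])

text \<open>The part of \<open>\<psi>\<^sub>s\<close> independent of the argument; the vector
  objective \<open>\<psi>sV\<close> omits it.\<close>

definition c\<^sub>0 :: real where "c\<^sub>0 = lam * (f\<^sub>1 Z\<^sub>0 - gradient f\<^sub>1 Z\<^sub>0 \<bullet> Z\<^sub>0) + 1 / 2 * (norm Z\<^sub>0)\<^sup>2"

text \<open>The linear terms of the linearised \<open>f\<^sub>1\<close> and of the proximal square
  add up to the matrix that the method decomposes, which is why its factors fit the whole
  objective.\<close>

lemma \<psi>\<^sub>s_eq: "\<psi>\<^sub>s U = lam * f\<^sub>2 U - up s \<bullet> U + 1 / 2 * (norm U)\<^sup>2 + c\<^sub>0"
proof -
  have "up s \<bullet> U = Z\<^sub>0 \<bullet> U - lam * (gradient f\<^sub>1 Z\<^sub>0 \<bullet> U)"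
    by (simp add: inner_diff_left flip: Z0_lam)
  then show ?thesis
    unfolding power2_norm_eq_inner \<psi>\<^sub>s_def lin_approx_def c\<^sub>0_def
    by (simp add: inner_diff_left inner_diff_right inner_commute[of U Z\<^sub>0] algebra_simps)
qed

lemma \<psi>\<^sub>s_up: "\<psi>\<^sub>s (up z) = \<psi>sV z + c\<^sub>0"
  by (simp add: \<psi>\<^sub>s_eq \<psi>sV_def f\<^sub>2_def sv_up[OF f2V(4)] inner_diag_lift_diag_lift[OF orth] norm_diag_lift[OF orth])

lemma \<psi>\<^sub>n_real: "sv U \<in> D \<Longrightarrow> \<psi>\<^sub>n U = ereal (lam * H (sv U))" "sv U \<notin> D \<Longrightarrow> \<psi>\<^sub>n U = \<infinity>"
  using Conv_bar_ereal[OF hV(1), of "sv U"] lam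
  by (auto simp: \<psi>\<^sub>n_def h_def H_def) (metis times_ereal.simps(1))

lemma H_up: "H (sv (up z)) = H z" by (rule sv_up[OF H_sym])

lemma \<psi>_up: "z \<in> D \<Longrightarrow> \<psi> (up z) = ereal (vec.obj z + c\<^sub>0)"
  by (simp add: \<psi>_def \<psi>\<^sub>s_up \<psi>\<^sub>n_real sv_up_in H_up vec.obj_def \<psi>nV_real)

lemma GDERIV_\<psi>sV: "GDERIV f2V w :> g \<Longrightarrow> GDERIV \<psi>sV w :> lam *\<^sub>R g - s + w"
  using GDERIV_quadratic_perturbation[of f2V w g lam s 0] by (simp add: \<psi>sV_def[abs_def])

text \<open>At a lifted point the gradient is again lifted, so the linearisation there sees a matrix
  \<open>U\<close> only through \<open>dn U\<close>.\<close>

lemma gradient_\<psi>\<^sub>s: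
  assumes z: "z \<in> D"
  shows "gradient \<psi>\<^sub>s (up z) = up (gradient \<psi>sV z)"
proof -
  have D: "\<And>x. x \<in> D \<Longrightarrow> \<exists>g. GDERIV f2V x :> g" using f2V(1) by (simp add: C1_on_def)
  then obtain g where g: "GDERIV f2V z :> g" using z by blast
  have "GDERIV f\<^sub>2 (up z) :> up g"
    using GDERIV_spectral[OF r orth f2V(4) D_sym z D g] by (simp add: f\<^sub>2_def[abs_def])
  then have "GDERIV \<psi>\<^sub>s (up z) :> lam *\<^sub>R up g - up s + up z"
    using GDERIV_quadratic_perturbation[of f\<^sub>2 "up z" "up g" lam "up s" c\<^sub>0] by (simp add: \<psi>\<^sub>s_eq[abs_def])
  then show ?thesis
    using gradient_eqI[OF GDERIV_\<psi>sV[OF g]] by (simp add: gradient_eqI diag_lift_add diag_lift_diff diag_lift_scaleR)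
qed

lemma \<psi>sV_expansion:
  "\<psi>sV u = lam * f2V u - s \<bullet> u + 1 / 2 * (norm w)\<^sup>2 + w \<bullet> (u - w) + 1 / 2 * (norm (u - w))\<^sup>2"
  using norm_diff_square_shift[of u 0 w] by (simp add: \<psi>sV_def)

lemma lin_approx_\<psi>sV:
  assumes "GDERIV f2V w :> g"
  shows "lin_approx \<psi>sV w u = lam * (f2V w + g \<bullet> (u - w)) - s \<bullet> u + 1 / 2 * (norm w)\<^sup>2 + w \<bullet> (u - w)"
  unfolding lin_approx_def gradient_eqI[OF GDERIV_\<psi>sV[OF assms]]
  by (simp add: \<psi>sV_def inner_add_left inner_diff_left inner_diff_right algebra_simps)

text \<open>The quadratic in \<open>\<psi>sV\<close> is exact and adds curvature 1 to
  \<open>lam * M\<^sub>2\<close>, hence \<open>L\<close>. \<open>G\<close> is later taken to be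
  \<open>D\<close> for the refined point and a larger set for the extrapolated points.\<close>

lemma \<psi>sV_upper:
  assumes G: "convex G" "C1_on G f2V" "M\<^sub>2-lipschitz_on G (gradient f2V)" and w: "w \<in> G" and u: "u \<in> G"
  shows "\<psi>sV u \<le> lin_approx \<psi>sV w u + L / 2 * (norm (u - w))\<^sup>2"
proof -
  have g: "GDERIV f2V x :> gradient f2V x" if "x \<in> G" for x
    using G(2) that gradient_eqI by (metis C1_on_def)
  have "lam * f2V u \<le> lam * (f2V w + gradient f2V w \<bullet> (u - w) + M\<^sub>2 / 2 * (norm (u - w))\<^sup>2)"
    using descent_lemma[OF G(1) g G(3) w u] lam by (intro mult_left_mono) auto
  then show ?thesis
    unfolding lin_approx_\<psi>sV[OF g[OF w]] \<psi>sV_expansion[of u w]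
    by (simp add: distrib_left distrib_right add_divide_distrib mult.assoc)
qed

lemma \<psi>sV_lower:
  assumes "convex_on G f2V" "C1_on G f2V" and w: "w \<in> G" and u: "u \<in> G"
  shows "lin_approx \<psi>sV w u + 1 / 2 * (norm (u - w))\<^sup>2 \<le> \<psi>sV u"
proof -
  obtain g where g: "GDERIV f2V w :> g" using assms by (auto simp: C1_on_def)
  have "lam * (f2V w + g \<bullet> (u - w)) \<le> lam * f2V u"
    using convex_on_above_tangent[OF assms(1) g w u] lam by (intro mult_left_mono) auto
  then show ?thesis unfolding lin_approx_\<psi>sV[OF g] \<psi>sV_expansion[of u w] by simp
qed

section \<open>Transfer of the refined point and of the tests\<close>

definition prox_obj :: "real^('r::{finite,linorder}) \<Rightarrow> real^('r::{finite,linorder}) \<Rightarrow> real^('r::{finite,linorder}) \<Rightarrow> real" where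
  "prox_obj z v u = lin_approx \<psi>sV z u - v \<bullet> u + L / 2 * (norm (u - z))\<^sup>2 + lam * H u"

lemma refined_point_vec:
  fixes z v :: "real^('r::{finite,linorder})"
  defines "zh \<equiv> refined_point \<psi>sV \<psi>nV L z v"
  shows "zh \<in> D" "u \<in> D \<Longrightarrow> prox_obj z v zh + L / 2 * (norm (u - zh))\<^sup>2 \<le> prox_obj z v u"
proof -
  have F: "prox_objective \<psi>nV (\<psi>sV z - v \<bullet> z) (gradient \<psi>sV z - v) z L u = prox_obj z v u" for u
    by (simp add: prox_objective_def prox_obj_def lin_approx_def \<psi>nV_real inner_diff_left inner_diff_right)
  have 1: "ereal (lin_approx \<psi>sV z u - v \<bullet> u + L / 2 * (norm (u - z))\<^sup>2) + \<psi>nV u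
     = ereal (prox_objective \<psi>nV (\<psi>sV z - v \<bullet> z) (gradient \<psi>sV z - v) z L u)" if "u \<in> D" for u
    unfolding F by (subst Conv_bar_ereal(1)[OF vec.\<psi>n that]) (simp add: \<psi>nV_real prox_obj_def)
  have 2: "ereal (lin_approx \<psi>sV z u - v \<bullet> u + L / 2 * (norm (u - z))\<^sup>2) + \<psi>nV u = \<infinity>" if "u \<notin> D" for u
    using Conv_bar_ereal(2)[OF vec.\<psi>n that] by simp
  note am = arg_min_prox_objective[OF vec.\<psi>n vec.L 1 2, folded refined_point_def, folded zh_def, unfolded F]
  show "zh \<in> D" "u \<in> D \<Longrightarrow> prox_obj z v zh + L / 2 * (norm (u - zh))\<^sup>2 \<le> prox_obj z v u"
    using am by blast+
qed

lemma refined_point_up: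
  assumes z: "z \<in> D"
  shows "refined_point \<psi>\<^sub>s \<psi>\<^sub>n L (up z) (up v) = up (refined_point \<psi>sV \<psi>nV L z v)"
proof -
  define zh where "zh = refined_point \<psi>sV \<psi>nV L z v"
  note zh = refined_point_vec(1)[of z v, folded zh_def] refined_point_vec(2)[of _ z v, folded zh_def]
  define F where "F U = lin_approx \<psi>\<^sub>s (up z) U - up v \<bullet> U + L / 2 * (norm (U - up z))\<^sup>2 + lam * H (sv U)" for U
  \<comment> \<open>The matrix objective is the vector objective at \<open>dn U\<close> plus two
    terms that are nonnegative on the domain: the squared distance to the range and the decrease of
    \<open>H\<close>.\<close>
  have F: "F U = prox_obj z v (dn U) + c\<^sub>0 + L / 2 * (norm (U - up (dn U)))\<^sup>2 + lam * (H (sv U) - H (dn U))" for U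
    unfolding F_def lin_approx_def gradient_\<psi>\<^sub>s[OF z] \<psi>\<^sub>s_up norm_split[of U z] prox_obj_def
    by (simp add: inner_diff_right inner_diag_lift diag_part_diag_lift[OF orth] algebra_simps)
  have "F (up zh) < F U" if U: "sv U \<in> D" "U \<noteq> up zh" for U
  proof -
    have L: "0 < L" by (rule vec.L)
    have "F (up zh) = prox_obj z v zh + c\<^sub>0"
      unfolding F by (simp add: diag_part_diag_lift[OF orth] H_up)
    moreover have "0 \<le> lam * (H (sv U) - H (dn U))" using lam H_dn[OF U(1)] by simp
    moreover have "prox_obj z v zh + L / 2 * (norm (dn U - zh))\<^sup>2 \<le> prox_obj z v (dn U)"
      using zh(2) dn_in[OF U(1)] by blast
    \<comment> \<open>Strictness: a matrix other than \<open>up zh\<close> either has a different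
      diagonal part or lies off the range.\<close>
    moreover have "0 < L / 2 * (norm (dn U - zh))\<^sup>2 + L / 2 * (norm (U - up (dn U)))\<^sup>2"
    proof -
      have "0 < (norm (U - up zh))\<^sup>2" using U(2) by simp
      then have "0 < L / 2 * (norm (U - up zh))\<^sup>2" using L by (intro mult_pos_pos) auto
      then show ?thesis unfolding norm_split[of U zh] by (simp only: distrib_left)
    qed
    ultimately show ?thesis unfolding F[of U] by linarith
  qed
  then show ?thesis
    unfolding refined_point_def zh_def[symmetric, unfolded refined_point_def]
    by (intro arg_min_ereal_eqI[where D = "{U. sv U \<in> D}" and F = F])
       (auto simp: \<psi>\<^sub>n_real F_def sv_up_in zh(1))
qed

lemma Delta_up:
  assumes "z \<in> D" "w \<in> D"
  shows "Delta 1 \<psi> (up w) (up z) (up v) = Delta 1 vec.\<psi> w z v"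
  using assms
  by (simp add: Delta_def \<psi>_up vec.\<psi>_obj inner_diag_lift_diag_lift[OF orth] norm_diag_lift[OF orth]
      flip: diag_lift_diff)

text \<open>The refined point is no worse than \<open>z\<close> in its own subproblem, and the
  descent lemma passes from the model to the objective. Together with the final test this gives
  \<open>0 \<le> \<epsilon>\<close>, also for nonconvex \<open>f2V\<close>.\<close>

lemma Delta_nonneg:
  assumes z: "z \<in> D"
  shows "0 \<le> Delta 1 vec.\<psi> (refined_point \<psi>sV \<psi>nV L z v) z v"
proof -
  define zh where "zh = refined_point \<psi>sV \<psi>nV L z v"
  note zh = refined_point_vec(1)[of z v, folded zh_def] refined_point_vec(2)[of _ z v, folded zh_def]
  have "prox_obj z v zh + L / 2 * (norm (z - zh))\<^sup>2 \<le> prox_obj z v z" using zh(2) z by blast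
  moreover have "\<psi>sV zh \<le> lin_approx \<psi>sV z zh + L / 2 * (norm (zh - z))\<^sup>2"
    by (rule \<psi>sV_upper[OF D_convex f2V(1,2) z zh(1)])
  moreover have "0 \<le> L / 2 * (norm (z - zh))\<^sup>2" using vec.L by simp
  moreover have "prox_obj z v z = \<psi>sV z - v \<bullet> z + lam * H z"
    by (simp add: prox_obj_def lin_approx_def)
  moreover have "0 \<le> 1 / 2 * (norm (zh - z))\<^sup>2" by simp
  ultimately have "0 \<le> vec.obj z - vec.obj zh + (v \<bullet> (zh - z) + 1 / 2 * (norm (zh - z))\<^sup>2)"
    unfolding vec.obj_def \<psi>nV_real prox_obj_def inner_diff_right by linarith
  then show ?thesis
    unfolding zh_def[symmetric] by (simp add: Delta_def vec.\<psi>_obj z zh(1))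
qed

text \<open>\<open>start\<close> is \<open>dn Z\<^sub>0\<close>, so the part of
  \<open>Z\<^sub>0\<close> off the range only enlarges the matrix distance; the vector accuracy test
  is the stricter one.\<close>

lemma norm_start_le: "norm (z - start) \<le> norm (up z - Z\<^sub>0)"
proof -
  have "(norm (start - z))\<^sup>2 \<le> (norm (Z\<^sub>0 - up z))\<^sup>2"
    using norm_split[of Z\<^sub>0 z] by (simp add: start_def diag_part_def)
  then have "norm (start - z) \<le> norm (Z\<^sub>0 - up z)" by (rule power2_le_imp_le) simp
  then show ?thesis by (simp add: norm_minus_commute)
qed

lemma result_eq:
  "result = (case vec.result of Success z v \<epsilon> \<Rightarrow> Success (up z) (up v) \<epsilon> | Failure _ \<Rightarrow> Failure Z\<^sub>0 | Diverges \<Rightarrow> Diverges)"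
  unfolding result_def diag_lift_def ..

lemma accuracy_up:
  assumes "(norm v)\<^sup>2 + 2 * \<epsilon> \<le> \<theta>\<^sup>2 * (norm (z - start))\<^sup>2"
  shows "(norm (up v))\<^sup>2 + 2 * \<epsilon> \<le> \<theta>\<^sup>2 * (norm (up z - Z\<^sub>0))\<^sup>2"
proof -
  have "\<theta>\<^sup>2 * (norm (z - start))\<^sup>2 \<le> \<theta>\<^sup>2 * (norm (up z - Z\<^sub>0))\<^sup>2"
    using norm_start_le[of z] by (intro mult_left_mono power_mono) auto
  then show ?thesis using assms by (simp add: norm_diag_lift[OF orth])
qed

lemma Success_properties:
  assumes "result = Success Z V \<epsilon>"
  shows "Z \<in> edom h" "0 \<le> \<epsilon>" "(norm V)\<^sup>2 + 2 * \<epsilon> \<le> \<theta>\<^sup>2 * (norm (Z - Z\<^sub>0))\<^sup>2"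
    "Delta 1 \<psi> (refined_point \<psi>\<^sub>s \<psi>\<^sub>n L Z V) Z V \<le> ereal \<epsilon>"
proof -
  obtain z v where res: "vec.result = Success z v \<epsilon>" and ZV: "Z = up z" "V = up v"
    using assms unfolding result_eq by (auto split: acg_result.splits)
  note S = vec.result_Success[OF res]
  have "sv Z \<in> D" using S(1) by (simp add: ZV sv_up_in)
  then have "h Z = ereal (real_of_ereal (h Z))" unfolding h_def by (rule Conv_bar_ereal(1)[OF hV(1)])
  then show "Z \<in> edom h" by (metis edom_def mem_Collect_eq less_ereal.simps(4))
  show "0 \<le> \<epsilon>" using order_trans[OF Delta_nonneg[OF S(1)] S(3)] by simp
  show "(norm V)\<^sup>2 + 2 * \<epsilon> \<le> \<theta>\<^sup>2 * (norm (Z - Z\<^sub>0))\<^sup>2"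
    unfolding ZV by (rule accuracy_up[OF S(2)])
  show "Delta 1 \<psi> (refined_point \<psi>\<^sub>s \<psi>\<^sub>n L Z V) Z V \<le> ereal \<epsilon>"
    using S(3) unfolding ZV refined_point_up[OF S(1)] Delta_up[OF S(1) refined_point_vec(1)] .
qed

section \<open>The subdifferential inclusion for convex \<open>f\<^sub>2\<close>\<close>

text \<open>The lifted vectors form a linear copy of the vector space on which
  \<open>f\<^sub>2\<close> agrees with \<open>f2V\<close>, so convexity restricts to it.\<close>

lemma convex_spectral_imp_convex:
  assumes G: "abs_symmetric (\<lambda>x. x \<in> G)" and conv: "convex_on {U. sv U \<in> G} f\<^sub>2"
  shows "convex_on G f2V"
proof -
  have up_in: "up x \<in> {U. sv U \<in> G} \<longleftrightarrow> x \<in> G" and up_f: "f\<^sub>2 (up x) = f2V x" for x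
    using sv_up[OF G] sv_up[OF f2V(4)] by (simp_all add: f\<^sub>2_def)
  have "convex G"
  proof (rule convexI)
    fix x y and a b :: real assume "x \<in> G" "y \<in> G" "0 \<le> a" "0 \<le> b" "a + b = 1"
    then have "a *\<^sub>R up x + b *\<^sub>R up y \<in> {U. sv U \<in> G}"
      using conv unfolding convex_on_def by (intro convexD) (auto simp: up_in[simplified])
    then have "up (a *\<^sub>R x + b *\<^sub>R y) \<in> {U. sv U \<in> G}" by (simp only: diag_lift_add diag_lift_scaleR)
    then show "a *\<^sub>R x + b *\<^sub>R y \<in> G" unfolding up_in .
  qed
  then show ?thesis
  proof (intro convex_onI)
    fix t x y assume "0 < (t::real)" "t < 1" "x \<in> G" "y \<in> G"
    then have "f\<^sub>2 ((1 - t) *\<^sub>R up x + t *\<^sub>R up y) \<le> (1 - t) * f\<^sub>2 (up x) + t * f\<^sub>2 (up y)"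
      by (intro convex_onD[OF conv]) (auto simp: up_in[simplified])
    then show "f2V ((1 - t) *\<^sub>R x + t *\<^sub>R y) \<le> (1 - t) * f2V x + t * f2V y"
      by (simp add: up_f flip: diag_lift_add diag_lift_scaleR)
  qed
qed

lemma convex_Success:
  assumes G: "D \<subseteq> G" "abs_symmetric (\<lambda>x. x \<in> G)" "C1_on G f2V" "M\<^sub>2-lipschitz_on G (gradient f2V)"
    "gradient_points \<subseteq> G" and conv: "convex_on {U. sv U \<in> G} f\<^sub>2"
  shows "\<exists>Z V \<epsilon>. result = Success Z V \<epsilon> \<and>
    V \<in> eps_subdifferential \<epsilon> (\<lambda>U. \<psi> U - ereal (1 / 2 * (norm (U - Z))\<^sup>2)) Z \<and>
    (norm V)\<^sup>2 + 2 * \<epsilon> \<le> \<theta>\<^sup>2 * (norm (Z - Z\<^sub>0))\<^sup>2"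
proof -
  have f2V_conv: "convex_on G f2V" by (rule convex_spectral_imp_convex[OF G(2) conv])
  then have "convex G" by (simp add: convex_on_def)
  have "vec.sandwiched w" if "w \<in> vec.gradient_points" for w
  proof -
    have w: "w \<in> G" using that G(5) by (auto simp: gradient_points_def)
    then show ?thesis
      using G(1) \<psi>sV_upper[OF \<open>convex G\<close> G(3,4) w] \<psi>sV_lower[OF f2V_conv G(3) w]
      by (auto simp: vec.sandwiched_def)
  qed
  then obtain z v \<epsilon> where res: "vec.result = Success z v \<epsilon>"
    and lower: "\<And>u. u \<in> D \<Longrightarrow> vec.obj z + v \<bullet> (u - z) + 1 / 2 * (norm (u - z))\<^sup>2 - \<epsilon> \<le> vec.obj u"
    using vec.convex_result_Success \<theta> by blast
  note S = vec.result_Success[OF res]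
  have "\<psi> U - ereal (1 / 2 * (norm (U - up z))\<^sup>2)
      \<ge> \<psi> (up z) - ereal (1 / 2 * (norm (up z - up z))\<^sup>2) + ereal (up v \<bullet> (U - up z) - \<epsilon>)" for U
  proof (cases "sv U \<in> D")
    case True
    define u where "u = dn U"
    have "f2V u \<le> f2V (sv U)" unfolding u_def
      using convex_abs_symmetric_diag_part(2)[OF orth r f2V_conv f2V(4) G(2)] True G(1) by blast
    then have "lam * f2V u \<le> lam * f2V (sv U)" "lam * H u \<le> lam * H (sv U)"
      using lam H_dn[OF True] by (simp_all add: u_def)
    moreover have "(norm U)\<^sup>2 = (norm u)\<^sup>2 + (norm (U - up u))\<^sup>2"
      using norm_split[of U 0] diag_lift_scaleR[of P Q 0 0] by (simp add: u_def)
    moreover have "up s \<bullet> U = s \<bullet> u" "up v \<bullet> (U - up z) = v \<bullet> (u - z)"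
      by (simp_all add: u_def inner_diff_right inner_diag_lift diag_part_diag_lift[OF orth])
    moreover have "(norm (U - up z))\<^sup>2 = (norm (u - z))\<^sup>2 + (norm (U - up u))\<^sup>2"
      using norm_split[of U z] by (simp add: u_def)
    moreover have "vec.obj z + v \<bullet> (u - z) + 1 / 2 * (norm (u - z))\<^sup>2 - \<epsilon> \<le> vec.obj u"
      using lower dn_in[OF True] by (simp add: u_def)
    \<comment> \<open>The squared distance of \<open>U\<close> to the range occurs in
      \<open>\<psi>\<^sub>s U\<close> and in the subtracted square with the same factor and cancels;
      what remains is the vector inequality and the decrease of \<open>f2V\<close> and
      \<open>H\<close>.\<close>
    ultimately have "vec.obj z + c\<^sub>0 + (up v \<bullet> (U - up z) - \<epsilon>)
       \<le> \<psi>\<^sub>s U + lam * H (sv U) - 1 / 2 * (norm (U - up z))\<^sup>2"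
      unfolding \<psi>\<^sub>s_eq f\<^sub>2_def vec.obj_def[of u] \<psi>sV_def[of u] \<psi>nV_real[of u] by linarith
    then show ?thesis
      using True by (simp add: \<psi>_up S(1)) (simp add: \<psi>_def \<psi>\<^sub>n_real)
  next
    case False
    then show ?thesis by (simp add: \<psi>_def \<psi>\<^sub>n_real)
  qed
  then have "up v \<in> eps_subdifferential \<epsilon> (\<lambda>U. \<psi> U - ereal (1 / 2 * (norm (U - up z))\<^sup>2)) (up z)"
    unfolding eps_subdifferential_def by blast
  moreover have "result = Success (up z) (up v) \<epsilon>" unfolding result_eq res by simp
  ultimately show ?thesis using accuracy_up[OF S(2)] by blast
qed

end

text \<open>In part (b) \<open>G\<close> is the region where \<open>f2V\<close> is smooth and
  \<open>f\<^sub>2\<close> convex; it has to contain the points at which gradients are evaluated.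
  The whole space is an admissible choice when \<open>f2V\<close> is smooth and
  \<open>f\<^sub>2\<close> convex everywhere.\<close>

theorem proposition7p5p1:
  fixes f\<^sub>1 f\<^sub>2 \<psi>\<^sub>s :: "real^'n^'m \<Rightarrow> real"
    and h \<psi>\<^sub>n \<psi> :: "real^'n^'m \<Rightarrow> ereal"
    and f2V :: "real^('r::{finite,linorder}) \<Rightarrow> real"
    and hV :: "real^('r::{finite,linorder}) \<Rightarrow> ereal"
    and D :: "(real^('r::{finite,linorder})) set"
    and lam \<theta> M\<^sub>2 L :: real
    and Z\<^sub>0 :: "real^'n^'m"
    and P :: "real^('r::{finite,linorder})^'m"
    and Q :: "real^('r::{finite,linorder})^'n"
  assumes r: "CARD('r) = min CARD('m) CARD('n)"
    and D: "D \<noteq> {}" "convex D"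
    and hV: "hV \<in> Conv_bar D" "abs_symmetric hV"
    and f2V: "C1_on D f2V" "M\<^sub>2-lipschitz_on D (gradient f2V)" "M\<^sub>2 > 0" "abs_symmetric f2V"
    and f\<^sub>2: "f\<^sub>2 = (\<lambda>U. f2V (sing_vals U))"
    and h: "h = (\<lambda>U. hV (sing_vals U))"
    and f\<^sub>1: "C1_on (edom h) f\<^sub>1"
    and lam: "lam > 0"
    and \<theta>: "0 < \<theta>" "\<theta> < 1"
    and Z\<^sub>0: "\<exists>g. GDERIV f\<^sub>1 Z\<^sub>0 :> g"
    and svd: "is_svd (Z\<^sub>0 - lam *\<^sub>R gradient f\<^sub>1 Z\<^sub>0) P (sing_vals (Z\<^sub>0 - lam *\<^sub>R gradient f\<^sub>1 Z\<^sub>0)) Q"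
    and \<psi>\<^sub>s: "\<psi>\<^sub>s = (\<lambda>U. lam * (lin_approx f\<^sub>1 Z\<^sub>0 U + f\<^sub>2 U) + 1 / 2 * (norm (U - Z\<^sub>0))\<^sup>2)"
    and \<psi>\<^sub>n: "\<psi>\<^sub>n = (\<lambda>U. ereal lam * h U)"
    and \<psi>: "\<psi> = (\<lambda>U. ereal (\<psi>\<^sub>s U) + \<psi>\<^sub>n U)"
    and L: "L = lam * M\<^sub>2 + 1"
  shows
    "(\<forall>Z V \<epsilon>. sigma_acg.result f\<^sub>1 f2V hV lam \<theta> M\<^sub>2 Z\<^sub>0 P Q = Success Z V \<epsilon> \<longrightarrow>
        Z \<in> edom h \<and> 0 \<le> \<epsilon> \<and>
        (norm V)\<^sup>2 + 2 * \<epsilon> \<le> \<theta>\<^sup>2 * (norm (Z - Z\<^sub>0))\<^sup>2 \<and>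
        (let Zh = arg_min (\<lambda>U. ereal (lin_approx \<psi>\<^sub>s Z U - V \<bullet> U + L / 2 * (norm (U - Z))\<^sup>2) + \<psi>\<^sub>n U)
                    (\<lambda>_. True)
         in \<psi> Z - \<psi> Zh + ereal (V \<bullet> (Zh - Z) + 1 / 2 * (norm (Zh - Z))\<^sup>2) \<le> ereal \<epsilon>))
   \<and>
     (\<forall>G. D \<subseteq> G \<and> abs_symmetric (\<lambda>x. x \<in> G) \<and> C1_on G f2V \<and> M\<^sub>2-lipschitz_on G (gradient f2V) \<and>
          sigma_acg.gradient_points f\<^sub>1 f2V hV lam \<theta> M\<^sub>2 Z\<^sub>0 P Q \<subseteq> G \<and>
          convex_on {U :: real^'n^'m. sing_vals U \<in> G} f\<^sub>2 \<longrightarrow>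
        (\<exists>Z V \<epsilon>. sigma_acg.result f\<^sub>1 f2V hV lam \<theta> M\<^sub>2 Z\<^sub>0 P Q = Success Z V \<epsilon> \<and>
           V \<in> eps_subdifferential \<epsilon> (\<lambda>U. \<psi> U - ereal (1 / 2 * (norm (U - Z))\<^sup>2)) Z \<and>
           (norm V)\<^sup>2 + 2 * \<epsilon> \<le> \<theta>\<^sup>2 * (norm (Z - Z\<^sub>0))\<^sup>2))"
proof -
  interpret M: sigma_acg_problem f\<^sub>1 f2V hV lam \<theta> M\<^sub>2 Z\<^sub>0 P Q D
    by unfold_locales (rule r hV f2V lam \<theta>(1) svd)+
  have f2_eq: "f\<^sub>2 = M.f\<^sub>2" and h_eq: "h = M.h"
    by (simp_all add: fun_eq_iff f\<^sub>2 h M.f\<^sub>2_def M.h_def)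
  have \<psi>s_eq: "\<psi>\<^sub>s = M.\<psi>\<^sub>s" and \<psi>n_eq: "\<psi>\<^sub>n = M.\<psi>\<^sub>n"
    by (simp_all add: fun_eq_iff \<psi>\<^sub>s \<psi>\<^sub>n M.\<psi>\<^sub>s_def M.\<psi>\<^sub>n_def f2_eq h_eq)
  have \<psi>_eq: "\<psi> = M.\<psi>"
    by (simp add: fun_eq_iff \<psi> M.\<psi>_def \<psi>s_eq \<psi>n_eq)
  show ?thesis
    unfolding f2_eq h_eq \<psi>s_eq \<psi>n_eq \<psi>_eq L
  proof (intro conjI allI impI, goal_cases)
    case (1 Z V \<epsilon>)
    then show ?case by (rule M.Success_properties)
  next
    case (2 Z V \<epsilon>)
    then show ?case by (rule M.Success_properties)
  next
    case (3 Z V \<epsilon>)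
    then show ?case by (rule M.Success_properties)
  next
    case (4 Z V \<epsilon>)
    then show ?case using M.Success_properties(4) by (simp add: Let_def Delta_def refined_point_def)
  next
    case (5 G)
    then show ?case using M.convex_Success[of G] by blast
  qed
qed

end
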